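(* Let $a,b,c\in\mathbb R$ satisfy $a,b>-1$, $0<c-a-b-2<1$ and $c\le1$. Then the following hold. (a) Suppose $c=1$. Then: (1) $T_{a,b,c}$ and $S_{a,b,c}$ map $L^p(\mathbb D)$ boundedly into $L^{q,\infty}(\mathbb D)$ if $0\le\frac1p<b+1$ and $q=-\frac1a$, while both are unbounded from $L^p(\mathbb D)$ to $L^{q,\infty}(\mathbb D)$ if $p=\frac{1}{b+1}$ and $-a\le\frac1q\le1$. (2) $T_{a,b,c}$ and $S_{a,b,c}$ map $L^{p,1}(\mathbb D)$ boundedly into $L^{q,\infty}(\mathbb D)$ if $p=\frac{1}{b+1}$ and $-a<\frac1q\le1$. (3) $T_{a,b,c}$ maps $L^{\frac{1}{b+1},1}(\mathbb D)$ boundedly into $L^{-\frac1a,\infty}(\mathbb D)$, while $S_{a,b,c}$ does not. (b) Suppose $c<1$. Then: (1) $T_{a,b,c}$ and $S_{a,b,c}$ map $L^p(\mathbb D)$ boundedly into $L^{q,\infty}(\mathbb D)$ if $0\le\frac1p<b+1$ and $q=-\frac1a$. (2) $T_{a,b,c}$ and $S_{a,b,c}$ map $L^{p,1}(\mathbb D)$ boundedly into $L^{q,\infty}(\mathbb D)$ if $p=\frac{1}{b+1}$ and $-a\le\frac1q\le1$.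
   Context: $\mathbb D$ is the open unit disc in $\mathbb C$, $dA$ is normalized area measure on $\mathbb D$, and $|E|$ is the $dA$-measure of $E\subseteq\mathbb D$. For $a,b,c\in\mathbb R$, $$T_{a,b,c}f(z):=(1-|z|^2)^a\int_{\mathbb D}\frac{(1-|w|^2)^b}{(1-z\overline w)^c}f(w)\,dA(w),\qquad S_{a,b,c}f(z):=(1-|z|^2)^a\int_{\mathbb D}\frac{(1-|w|^2)^b}{|1-z\overline w|^c}f(w)\,dA(w),$$ with the principal branch of the power. $L^p(\mathbb D)=L^p(\mathbb D,dA)$. For $1\le q<\infty$, $\|f\|_{L^{q,\infty}}=\sup_{\lambda>0}\lambda|\{|f|>\lambda\}|^{1/q}$. For $1\le p<\infty$, $\|f\|_{L^{p,1}}=p\int_0^\infty|\{|f|>\lambda\}|^{1/p}\,d\lambda$. An operator $\mathcal T$ maps $X$ boundedly into $Y$ if for every $f\in X$ the defining integral converges absolutely for a.e. $z$ and $\|\mathcal Tf\|_Y\le C\|f\|_X$ with $C$ independent of $f$; otherwise it is unbounded from $X$ to $Y$. *)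

theory Defs
  imports "HOL-Analysis.Analysis" "HOL-Probability.Essential_Supremum"
begin

abbreviation unit_disc :: "complex set"
  where "unit_disc \<equiv> ball 0 1"

definition dA :: "complex measure"
  where "dA = uniform_measure (lebesgue_on unit_disc) unit_disc"

text \<open>
  Real powers of the positive weights are real \<open>powr\<close>; the power of \<open>1 - z * cnj w\<close> in the
  first integrand is complex \<open>powr\<close>, that is \<open>exp (c * Ln _)\<close> with the principal logarithm.
\<close>

definition T_integrand :: "real \<Rightarrow> real \<Rightarrow> (complex \<Rightarrow> complex) \<Rightarrow> complex \<Rightarrow> complex \<Rightarrow> complex"
  where "T_integrand b c f z w =
    complex_of_real ((1 - (norm w)\<^sup>2) powr b) / (1 - z * cnj w) powr complex_of_real c * f w"

definition S_integrand :: "real \<Rightarrow> real \<Rightarrow> (complex \<Rightarrow> complex) \<Rightarrow> complex \<Rightarrow> complex \<Rightarrow> complex"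
  where "S_integrand b c f z w =
    complex_of_real ((1 - (norm w)\<^sup>2) powr b / norm (1 - z * cnj w) powr c) * f w"

definition T_op :: "real \<Rightarrow> real \<Rightarrow> real \<Rightarrow> (complex \<Rightarrow> complex) \<Rightarrow> complex \<Rightarrow> complex"
  where "T_op a b c f z =
    complex_of_real ((1 - (norm z)\<^sup>2) powr a) * (LINT w|dA. T_integrand b c f z w)"

definition S_op :: "real \<Rightarrow> real \<Rightarrow> real \<Rightarrow> (complex \<Rightarrow> complex) \<Rightarrow> complex \<Rightarrow> complex"
  where "S_op a b c f z =
    complex_of_real ((1 - (norm z)\<^sup>2) powr a) * (LINT w|dA. S_integrand b c f z w)"

text \<open>
  The norms take values in \<open>[0, \<infinity>]\<close>; each space consists of the measurable functions
  of finite norm (functions rather than classes modulo null sets).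
\<close>

definition Lp_norm :: "ennreal \<Rightarrow> (complex \<Rightarrow> complex) \<Rightarrow> ennreal"
  where "Lp_norm p f =
    (if p = \<infinity> then esssup dA (\<lambda>z. ennreal (norm (f z)))
     else let I = (\<integral>\<^sup>+ z. ennreal (norm (f z) powr enn2real p) \<partial>dA)
          in if I = \<infinity> then \<infinity> else ennreal (enn2real I powr (1 / enn2real p)))"

definition dist_fun :: "(complex \<Rightarrow> complex) \<Rightarrow> real \<Rightarrow> real"
  where "dist_fun f t = measure dA {z \<in> unit_disc. norm (f z) > t}"

definition weak_norm :: "real \<Rightarrow> (complex \<Rightarrow> complex) \<Rightarrow> ennreal"
  where "weak_norm q f = (SUP t\<in>{0<..}. ennreal (t * dist_fun f t powr (1 / q)))"

definition Lp1_norm :: "real \<Rightarrow> (complex \<Rightarrow> complex) \<Rightarrow> ennreal"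
  where "Lp1_norm p f =
    ennreal p * (\<integral>\<^sup>+ t\<in>{0<..}. ennreal (dist_fun f t powr (1 / p)) \<partial>lborel)"

text \<open>
  \<open>K f z\<close> is the integrand defining the value of the operator \<open>F\<close> at \<open>f\<close> and \<open>z\<close>. Bochner
  integrability is absolute convergence; it is required explicitly because the integral of a
  non-integrable function is \<open>0\<close> by convention. Since \<open>C\<close> is real, the last inequality gives
  \<open>NY (F f) < \<infinity>\<close>.
\<close>

definition maps_boundedly ::
  "((complex \<Rightarrow> complex) \<Rightarrow> complex \<Rightarrow> complex \<Rightarrow> complex) \<Rightarrow>
   ((complex \<Rightarrow> complex) \<Rightarrow> complex \<Rightarrow> complex) \<Rightarrow>
   ((complex \<Rightarrow> complex) \<Rightarrow> ennreal) \<Rightarrow> ((complex \<Rightarrow> complex) \<Rightarrow> ennreal) \<Rightarrow> bool"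
  where "maps_boundedly K F NX NY \<longleftrightarrow>
    (\<exists>C::real. C \<ge> 0 \<and>
      (\<forall>f \<in> borel_measurable dA. NX f < \<infinity> \<longrightarrow>
        (AE z in dA. integrable dA (K f z)) \<and>
        F f \<in> borel_measurable dA \<and>
        NY (F f) \<le> ennreal C * NX f))"

abbreviation T_bounded :: "real \<Rightarrow> real \<Rightarrow> real \<Rightarrow>
    ((complex \<Rightarrow> complex) \<Rightarrow> ennreal) \<Rightarrow> ((complex \<Rightarrow> complex) \<Rightarrow> ennreal) \<Rightarrow> bool"
  where "T_bounded a b c \<equiv> maps_boundedly (T_integrand b c) (T_op a b c)"

abbreviation S_bounded :: "real \<Rightarrow> real \<Rightarrow> real \<Rightarrow>
    ((complex \<Rightarrow> complex) \<Rightarrow> ennreal) \<Rightarrow> ((complex \<Rightarrow> complex) \<Rightarrow> ennreal) \<Rightarrow> bool"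
  where "S_bounded a b c \<equiv> maps_boundedly (S_integrand b c) (S_op a b c)"

end

theory Submission
  imports Defs "HOL-Probability.Probability" "HOL-Complex_Analysis.Complex_Analysis"
begin

text \<open>
  Write \<open>y = 1 - |w|\<^sup>2\<close>, \<open>p = 1 / (b + 1)\<close>, and let \<open>\<epsilon>(t)\<close> be the measure of \<open>E\<^sub>t = {|f| > t}\<close>. If the mean of
  a kernel \<open>k \<ge> 0\<close> over every circle about \<open>0\<close> is at most \<open>B\<close>, then splitting each layer \<open>E\<^sub>t\<close> of \<open>f\<close> at
  the height \<open>y = K \<epsilon>(t)\<close> bounds \<open>\<integral> k(z w\<^sup>*) y\<^sup>b |f(w)| dA(w)\<close>, up to constants, by \<open>K\<^sup>b\<^sup>+\<^sup>1 N + K\<^sup>b J(z)\<close>,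
  where \<open>N\<close> is the \<open>L\<^sup>p\<^sup>,\<^sup>1\<close> norm of \<open>f\<close> and \<open>J\<close> has circular means at most \<open>B N\<close>. Optimising \<open>K\<close> bounds the
  \<open>p\<close>-th moments over circles. Since \<open>b + 1 < -a\<close>, Chebyshev's inequality on each circle then gives the
  weak type estimate with exponent \<open>-1/a\<close>.

  For \<open>c < 1\<close> the kernel \<open>|1 - \<zeta>|\<^sup>-\<^sup>c\<close> has bounded circular means. All positive statements except the
  critical one for \<open>T\<close> follow from this by trading a small power of \<open>1 - |z|\<^sup>2\<close> or \<open>1 - |w|\<^sup>2\<close> against
  \<open>|1 - z w\<^sup>*|\<close>, and \<open>L\<^sup>P \<subseteq> L\<^sup>p\<^sup>,\<^sup>1\<close> for \<open>P > p\<close>. In the critical case \<open>k = Re (1 / (1 - \<zeta>)) \<ge> 0\<close> has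
  circular mean \<open>1\<close>; this controls the real part of the holomorphic function defining \<open>T f\<close> for \<open>f \<ge> 0\<close>, and
  an argument of M. Riesz and Calderon passes from the real part to the modulus.

  The counterexamples are \<open>y\<^sup>-\<^sup>(\<^sup>b\<^sup>+\<^sup>1\<^sup>) / (1 - ln y)\<close> on \<open>L\<^sup>p\<close>, and the indicator of a thin annulus \<open>y \<le> d\<close> for \<open>S\<close> on
  \<open>L\<^sup>p\<^sup>,\<^sup>1\<close>: the circular means of \<open>1 / |1 - \<zeta>|\<close> grow logarithmically.
\<close>

section \<open>Radial averages on the disc\<close>

text \<open>Together, c <= 1 and c - a - b - 2 > 0 give a + b + 1 < 0, that is -1/a < p; with a, b >
  -1 also a, b < 0 and c > 0. This strict gap drives the proof: a moment of order s on circles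
  leaves the weight y^(a s) to be integrated over heights y away from 0, and that converges at
  infinity exactly when s > -1/a, so any s in (-1/a, p] serves. The same gap is spent a second time
  at c = 1, where the comparison of modulus and real part breaks down for odd integers s and s has
  to move slightly below p. Circles are the natural sets because both weights depend on the modulus
  alone, so only rotation averages of the kernel enter. At c = 1 the kernel has unbounded means, so
  absolute values can be used only after lowering its exponent. That costs a little of either the
  source exponent (P > p) or the target exponent (1/q > -a). At the double endpoint nothing is left
  to trade, and only the oscillation of the kernel of T, visible in the bounded means of its real
  part, separates T from S.\<close>

abbreviation wt :: "complex \<Rightarrow> real"
  where "wt z \<equiv> 1 - (norm z)\<^sup>2"

lemma wt_pos: "norm z < 1 \<Longrightarrow> 0 < wt z"
  by (simp add: abs_square_less_1)

lemma wt_le_1: "wt z \<le> 1"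
  by simp

lemma norm_mult_cnj_less_1: "norm z < 1 \<Longrightarrow> norm w < 1 \<Longrightarrow> norm (z * cnj w) < (1::real)"
  using mult_strict_mono'[of "norm z" 1 "norm w" 1] by (simp add: norm_mult)

text \<open>Used in two roles: it parametrises circles through \<open>ecis\<close>, and it is the
  law of \<open>wt\<close> under \<open>dA\<close>.\<close>

definition circ :: "real measure"
  where "circ = uniform_measure lborel {0..1}"

abbreviation ecis :: "real \<Rightarrow> complex"
  where "ecis t \<equiv> cis (2 * pi * t)"

lemma space_dA [simp]: "space dA = unit_disc"
  by (simp add: dA_def)

lemma sets_dA: "sets dA = sets (lebesgue_on unit_disc)"
  by (simp add: dA_def)

lemma sets_dA_borel:
  assumes "A \<in> sets borel" "A \<subseteq> unit_disc"
  shows "A \<in> sets dA"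
proof -
  have "A \<in> sets lebesgue" using assms by auto
  then show ?thesis unfolding sets_dA using assms(2)
    by (auto simp: sets_restrict_space_iff)
qed

text \<open>\<open>dA\<close> lives on the Lebesgue sets of the disc, whereas the kernels are Borel
  on the plane; measurability passes from the latter to the former along this map.\<close>

lemma id_measurable_dA: "(\<lambda>x. x) \<in> measurable dA borel"
proof (rule measurableI)
  fix A :: "complex set" assume "A \<in> sets borel"
  then have "A \<inter> unit_disc \<in> sets dA" by (intro sets_dA_borel) auto
  then show "(\<lambda>x. x) -` A \<inter> space dA \<in> sets dA" by simp
qed simp

lemma borel_measurable_dA: "f \<in> measurable borel M \<Longrightarrow> f \<in> measurable dA M"
  by (rule measurable_compose[OF id_measurable_dA])

lemma wt_measurable_dA [measurable]: "wt \<in> borel_measurable dA"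
  by (rule borel_measurable_dA) measurable

lemma emeasure_disc_pos: "emeasure lborel unit_disc \<noteq> 0"
proof -
  have "0 < measure lborel unit_disc" using content_ball_pos[of 1 "0::complex"] by simp
  then show ?thesis using emeasure_eq_0_AE measure_eq_emeasure_eq_ennreal[of 0 lborel unit_disc] by fastforce
qed

lemma emeasure_disc_finite: "emeasure lborel unit_disc \<noteq> \<infinity>"
  using emeasure_lborel_ball_finite[of "0::complex" 1] by auto

lemma emeasure_ball_eq_measure: "emeasure lborel (ball (0::complex) s) = ennreal (measure lborel (ball (0::complex) s))"
  using emeasure_lborel_ball_finite[of "0::complex" s] by (intro emeasure_eq_ennreal_measure) auto

lemma nn_integral_dA:
  assumes [measurable]: "f \<in> borel_measurable borel"
  shows "(\<integral>\<^sup>+ w. f w \<partial>dA) =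
    (\<integral>\<^sup>+ w. f w * indicator unit_disc w \<partial>lborel) / emeasure lborel unit_disc"
proof -
  have D: "unit_disc \<in> sets (lebesgue_on unit_disc)"
    by (metis sets.top space_lebesgue_on)
  have f: "f \<in> borel_measurable (lebesgue_on unit_disc)"
    by (intro measurable_restrict_space1 measurable_completion) simp
  have "(\<integral>\<^sup>+ w. f w \<partial>dA) =
      (\<integral>\<^sup>+ w. f w * indicator unit_disc w \<partial>lebesgue_on unit_disc) / emeasure (lebesgue_on unit_disc) unit_disc"
    unfolding dA_def by (rule nn_integral_uniform_measure[OF f D])
  also have "(\<integral>\<^sup>+ w. f w * indicator unit_disc w \<partial>lebesgue_on unit_disc) =
      (\<integral>\<^sup>+ w. f w * indicator unit_disc w * indicator unit_disc w \<partial>lebesgue)"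
    by (subst nn_integral_restrict_space) auto
  also have "\<dots> = (\<integral>\<^sup>+ w. f w * indicator unit_disc w \<partial>lebesgue)"
    by (intro nn_integral_cong) (auto simp: indicator_def)
  also have "\<dots> = (\<integral>\<^sup>+ w. f w * indicator unit_disc w \<partial>lborel)"
    by (rule nn_integral_completion) measurable
  also have "emeasure (lebesgue_on unit_disc) unit_disc = emeasure lborel unit_disc"
    by (subst emeasure_restrict_space) auto
  finally show ?thesis .
qed

lemma prob_space_dA: "prob_space dA"
  unfolding dA_def
proof (rule prob_space_uniform_measure)
  have "emeasure (lebesgue_on unit_disc) unit_disc = emeasure lborel unit_disc"
    by (subst emeasure_restrict_space) auto
  then show "emeasure (lebesgue_on unit_disc) unit_disc \<noteq> 0"
      "emeasure (lebesgue_on unit_disc) unit_disc \<noteq> \<infinity>"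
    using emeasure_disc_pos emeasure_disc_finite by simp_all
qed

interpretation dA: prob_space dA by (rule prob_space_dA)

lemma prob_space_circ: "prob_space circ"
  unfolding circ_def by (rule prob_space_uniform_measure) auto

interpretation circ: prob_space circ by (rule prob_space_circ)

lemma sets_circ [simp, measurable_cong]: "sets circ = sets borel"
  by (simp add: circ_def)

lemma space_circ [simp]: "space circ = UNIV"
  by (simp add: circ_def)

lemma nn_integral_circ:
  assumes [measurable]: "f \<in> borel_measurable borel"
  shows "(\<integral>\<^sup>+ t. f t \<partial>circ) = (\<integral>\<^sup>+ t. f t * indicator {0..1} t \<partial>lborel)"
  unfolding circ_def
  by (subst nn_integral_uniform_measure) (auto simp: divide_ennreal_def)

text \<open>
  Uniqueness of Haar measure: by Fubini and translation invariance, any two translation invariant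
  measures \<open>\<mu>\<close>, \<open>\<nu>\<close> satisfy \<open>\<mu>(A) \<nu>(B) = \<nu>(A) \<mu>(-B)\<close>; take \<open>\<nu>\<close> the rotated measure and \<open>B\<close> the disc.
\<close>

lemma rotation_lborel:
  fixes u :: complex
  assumes u: "norm u = 1"
  shows "distr lborel borel (\<lambda>w. u * w) = lborel"
proof -
  define M where "M = distr lborel borel (\<lambda>w. u * w)"
  have M[measurable_cong]: "sets M = sets borel" by (simp add: M_def)
  have u0: "u \<noteq> 0" using u by auto
  have inv: "(\<integral>\<^sup>+ w. f (a + w) \<partial>lborel) = (\<integral>\<^sup>+ w. f w \<partial>lborel)"
    if [measurable]: "f \<in> borel_measurable borel" for f :: "complex \<Rightarrow> ennreal" and a
  proof -
    have "(\<integral>\<^sup>+ w. f (a + w) \<partial>lborel) = (\<integral>\<^sup>+ w. f w \<partial>distr lborel borel ((+) a))"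
      by (subst nn_integral_distr) auto
    then show ?thesis by (simp add: lborel_distr_plus)
  qed
  have nnM: "(\<integral>\<^sup>+ w. f w \<partial>M) = (\<integral>\<^sup>+ w. f (u * w) \<partial>lborel)"
    if [measurable]: "f \<in> borel_measurable borel" for f :: "complex \<Rightarrow> ennreal"
    unfolding M_def by (subst nn_integral_distr) auto
  have ball: "indicator unit_disc (u * w) = (indicator unit_disc w :: ennreal)"
     "indicator unit_disc (- w) = (indicator unit_disc w :: ennreal)" for w
    using u by (auto simp: indicator_def norm_mult)
  define c where "c = emeasure lborel unit_disc"
  have eq: "emeasure lborel A * c = emeasure M A * c" if [measurable]: "A \<in> sets borel" for A
  proof -
    have cI: "(\<integral>\<^sup>+ y. indicator unit_disc y \<partial>lborel) = c"
      by (simp add: c_def)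
    have [measurable]: "unit_disc \<in> sets (borel :: complex measure)" by simp
    have "emeasure lborel A * c = (\<integral>\<^sup>+ x. (\<integral>\<^sup>+ y. indicator A x * indicator unit_disc (u * y) \<partial>lborel) \<partial>lborel)"
    proof -
      have "(\<integral>\<^sup>+ y. indicator A x * indicator unit_disc (u * y) \<partial>lborel) = indicator A x * c" for x :: complex
        unfolding ball cI[symmetric] by (rule nn_integral_cmult) measurable
      moreover have "(\<integral>\<^sup>+ x. indicator A x * c \<partial>lborel) = emeasure lborel A * c"
        by (subst nn_integral_multc) auto
      ultimately show ?thesis by simp
    qed
    \<comment> \<open>For fixed x the shift by - x / u turns u * y into u * y - x; after Fubini,
      shifting x by u * y leaves a disc that no longer depends on y.\<close>
    also have "\<dots> = (\<integral>\<^sup>+ x. (\<integral>\<^sup>+ y. indicator A x * indicator unit_disc (u * (- (x / u) + y)) \<partial>lborel) \<partial>lborel)"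
    proof (rule nn_integral_cong)
      fix x
      show "(\<integral>\<^sup>+ y. indicator A x * indicator unit_disc (u * y) \<partial>lborel) =
          (\<integral>\<^sup>+ y. indicator A x * indicator unit_disc (u * (- (x / u) + y)) \<partial>lborel)"
        using inv[of "\<lambda>y. indicator A x * indicator unit_disc (u * y)" "- (x / u)"] by simp
    qed
    also have "\<dots> = (\<integral>\<^sup>+ x. (\<integral>\<^sup>+ y. indicator A x * indicator unit_disc (u * y - x) \<partial>lborel) \<partial>lborel)"
      using u0 by (intro nn_integral_cong) (simp add: algebra_simps)
    also have "\<dots> = (\<integral>\<^sup>+ y. (\<integral>\<^sup>+ x. indicator A x * indicator unit_disc (u * y - x) \<partial>lborel) \<partial>lborel)"
      by (rule lborel_pair.Fubini') measurable
    also have "\<dots> = (\<integral>\<^sup>+ y. (\<integral>\<^sup>+ x. indicator A (u * y + x) * indicator unit_disc (u * y - (u * y + x)) \<partial>lborel) \<partial>lborel)"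
    proof (rule nn_integral_cong)
      fix y
      show "(\<integral>\<^sup>+ x. indicator A x * indicator unit_disc (u * y - x) \<partial>lborel) =
          (\<integral>\<^sup>+ x. indicator A (u * y + x) * indicator unit_disc (u * y - (u * y + x)) \<partial>lborel)"
        using inv[of "\<lambda>x. indicator A x * indicator unit_disc (u * y - x)" "u * y"] by simp
    qed
    also have "\<dots> = (\<integral>\<^sup>+ y. (\<integral>\<^sup>+ x. indicator A (u * y + x) * indicator unit_disc x \<partial>lborel) \<partial>lborel)"
      by (simp add: ball)
    also have "\<dots> = (\<integral>\<^sup>+ x. (\<integral>\<^sup>+ y. indicator A (u * y + x) * indicator unit_disc x \<partial>lborel) \<partial>lborel)"
      by (rule lborel_pair.Fubini') measurable
    also have "\<dots> = (\<integral>\<^sup>+ x. (\<integral>\<^sup>+ y. indicator A (u * (x / u + y)) * indicator unit_disc x \<partial>lborel) \<partial>lborel)"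
      using u0 by (intro nn_integral_cong) (simp add: algebra_simps)
    also have "\<dots> = (\<integral>\<^sup>+ x. (\<integral>\<^sup>+ y. indicator A (u * y) * indicator unit_disc x \<partial>lborel) \<partial>lborel)"
    proof (rule nn_integral_cong)
      fix x
      show "(\<integral>\<^sup>+ y. indicator A (u * (x / u + y)) * indicator unit_disc x \<partial>lborel) =
          (\<integral>\<^sup>+ y. indicator A (u * y) * indicator unit_disc x \<partial>lborel)"
        using inv[of "\<lambda>y. indicator A (u * y) * indicator unit_disc x" "x / u"] by simp
    qed
    also have "\<dots> = emeasure M A * c"
    proof -
      have "(\<integral>\<^sup>+ y. indicator A (u * y) * indicator unit_disc x \<partial>lborel) = emeasure M A * indicator unit_disc x" for x :: complex
      proof -
        have "emeasure M A = (\<integral>\<^sup>+ y. indicator A (u * y) \<partial>lborel)"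
          by (subst nnM[symmetric]) (auto simp: M)
        then show ?thesis by (simp add: nn_integral_multc)
      qed
      moreover have "(\<integral>\<^sup>+ x. emeasure M A * indicator unit_disc x \<partial>lborel) = emeasure M A * c"
        unfolding cI[symmetric] by (rule nn_integral_cmult) measurable
      ultimately show ?thesis by simp
    qed
    finally show ?thesis .
  qed
  have "emeasure M A = emeasure lborel A" if "A \<in> sets borel" for A
  proof -
    have "c * emeasure lborel A = c * emeasure M A"
      using eq[OF that] by (simp only: mult.commute)
    then show ?thesis
      using emeasure_disc_pos emeasure_disc_finite unfolding c_def[symmetric]
      by (auto simp: ennreal_mult_cancel_left)
  qed
  then show ?thesis unfolding M_def[symmetric]
    by (intro measure_eqI) (auto simp: M)
qed

lemma rotation_dA:
  assumes [measurable]: "f \<in> borel_measurable borel" and u: "norm u = 1"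
  shows "(\<integral>\<^sup>+ w. f (u * w) \<partial>dA) = (\<integral>\<^sup>+ w. f w \<partial>dA)"
proof -
  have [measurable]: "unit_disc \<in> sets (borel :: complex measure)" by simp
  have "(\<integral>\<^sup>+ w. f w * indicator unit_disc w \<partial>lborel) =
     (\<integral>\<^sup>+ w. f w * indicator unit_disc w \<partial>distr lborel borel (\<lambda>w. u * w))"
    by (simp add: rotation_lborel[OF u])
  also have "\<dots> = (\<integral>\<^sup>+ w. f (u * w) * indicator unit_disc (u * w) \<partial>lborel)"
    by (subst nn_integral_distr) simp_all
  also have "\<dots> = (\<integral>\<^sup>+ w. f (u * w) * indicator unit_disc w \<partial>lborel)"
    using u by (intro nn_integral_cong) (auto simp: indicator_def norm_mult)
  finally show ?thesis by (simp add: nn_integral_dA)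
qed

text \<open>The disc of radius s has normalized area s^2, so with s^2 = 1 - r its complement has
  area r. Hence 1 - |w|^2 is uniformly distributed and radial integrals carry no Jacobian.\<close>

lemma emeasure_dA_wt_le:
  assumes "0 \<le> r" "r \<le> 1"
  shows "emeasure dA {w \<in> unit_disc. wt w \<le> r} = ennreal r"
proof -
  have cont: "continuous_on A wt" for A by (intro continuous_intros)
  define s where "s = sqrt (1 - r)"
  have s: "0 \<le> s" "s \<le> 1" "s\<^sup>2 = 1 - r" using assms by (auto simp: s_def)
  have B: "{w \<in> unit_disc. wt w \<le> r} = unit_disc - ball 0 s"
  proof -
    have "wt w \<le> r \<longleftrightarrow> s \<le> norm w" for w :: complex
    proof -
      have "wt w \<le> r \<longleftrightarrow> s\<^sup>2 \<le> (norm w)\<^sup>2" using s by auto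
      also have "\<dots> \<longleftrightarrow> s \<le> norm w" using s abs_le_square_iff[of s "norm w"] by simp
      finally show ?thesis .
    qed
    then show ?thesis unfolding set_eq_iff mem_Collect_eq Diff_iff mem_ball_0
      by (metis not_less)
  qed
  have [measurable]: "unit_disc - ball 0 s \<in> sets (borel :: complex measure)" by simp
  have "emeasure dA (unit_disc - ball 0 s) = (\<integral>\<^sup>+ w. indicator (unit_disc - ball 0 s) w \<partial>dA)"
    by (subst nn_integral_indicator) (auto intro: sets_dA_borel)
  also have "\<dots> = (\<integral>\<^sup>+ w. indicator (unit_disc - ball 0 s) w * indicator unit_disc w \<partial>lborel) / emeasure lborel unit_disc"
    by (rule nn_integral_dA) measurable
  also have "(\<integral>\<^sup>+ w. indicator (unit_disc - ball 0 s) w * indicator unit_disc w \<partial>lborel) =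
      emeasure lborel (unit_disc - ball (0::complex) s)"
  proof -
    have "indicator (unit_disc - ball 0 s) w * indicator unit_disc w = (indicator (unit_disc - ball 0 s) w :: ennreal)" for w :: complex
      by (auto split: split_indicator)
    then show ?thesis by simp
  qed
  also have "\<dots> = emeasure lborel unit_disc - emeasure lborel (ball (0::complex) s)"
    using s emeasure_lborel_ball_finite[of "0::complex" s] by (intro emeasure_Diff) auto
  also have "\<dots> = ennreal (measure lborel unit_disc) - ennreal (measure lborel (ball (0::complex) s))"
    by (simp only: emeasure_ball_eq_measure)
  also have "measure lborel (ball (0::complex) s) = (1 - r) * measure lborel unit_disc"
    using content_ball_conv_unit_ball[of s "0::complex"] s by simp
  also have "ennreal (measure lborel unit_disc) - ennreal ((1 - r) * measure lborel unit_disc) =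
      ennreal (r * measure lborel unit_disc)"
    using assms by (subst ennreal_minus) (auto simp: algebra_simps intro!: mult_nonneg_nonneg)
  also have "\<dots> / emeasure lborel unit_disc = ennreal r"
    using content_ball_pos[of 1 "0::complex"] assms
    unfolding emeasure_ball_eq_measure by (subst divide_ennreal) auto
  finally show ?thesis using B by simp
qed

text \<open>This replaces polar coordinates: both laws have the same distribution function, which
  determines them.\<close>

lemma distr_wt_dA: "distr dA borel wt = circ"
proof -
  interpret D: prob_space "distr dA borel wt"
    by (rule dA.prob_space_distr) (rule borel_measurable_dA, measurable)
  have *: "emeasure (distr dA borel wt) {..x} = emeasure circ {..x}" for x
  proof -
    have "emeasure (distr dA borel wt) {..x} = emeasure dA {w \<in> unit_disc. wt w \<le> x}"
      by (subst emeasure_distr) (auto intro!: arg_cong[where f="emeasure dA"])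
    moreover have "emeasure circ {..x} = ennreal (min 1 (max 0 x))"
    proof -
      have "{0..1} \<inter> {..x} = {0..min 1 x}" by auto
      then show ?thesis unfolding circ_def
        by (auto simp: divide_ennreal_def min_def max_def)
    qed
    moreover have "emeasure dA {w \<in> unit_disc. wt w \<le> x} = ennreal (min 1 (max 0 x))"
    proof (cases "x < 0")
      case True
      have "\<not> wt w \<le> x" if "norm w < 1" for w using wt_pos[OF that] True by linarith
      then have "{w \<in> unit_disc. wt w \<le> x} = {}" by auto
      then show ?thesis using True by (simp only: emeasure_empty) simp
    next
      case False
      show ?thesis
      proof (cases "x \<le> 1")
        case True
        then show ?thesis using False emeasure_dA_wt_le[of x] by simp
      next
        case f: False
        then have "{w \<in> unit_disc. wt w \<le> x} = {w \<in> unit_disc. wt w \<le> 1}"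
          using wt_le_1[THEN order_trans, of x] by auto
        then show ?thesis using f False emeasure_dA_wt_le[of 1] by simp
      qed
    qed
    ultimately show ?thesis by simp
  qed
  interpret R1: real_distribution "distr dA borel wt" by standard auto
  interpret R2: real_distribution circ by standard auto
  have "cdf (distr dA borel wt) = cdf circ"
    unfolding fun_eq_iff cdf_def measure_def * by simp
  then show ?thesis
    by (rule cdf_unique[OF R1.real_distribution_axioms R2.real_distribution_axioms])
qed

lemma nn_integral_radial:
  assumes [measurable]: "\<phi> \<in> borel_measurable borel"
  shows "(\<integral>\<^sup>+ w. \<phi> (wt w) \<partial>dA) = (\<integral>\<^sup>+ y. \<phi> y * indicator {0..1} y \<partial>lborel)"
proof -
  have "(\<integral>\<^sup>+ w. \<phi> (wt w) \<partial>dA) = (\<integral>\<^sup>+ y. \<phi> y \<partial>distr dA borel wt)"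
    by (subst nn_integral_distr) auto
  then show ?thesis by (simp add: distr_wt_dA nn_integral_circ)
qed

text \<open>Both \<open>dA\<close> and \<open>wt\<close> are rotation invariant, so \<open>J\<close>
  may be averaged over rotations. The rotation \<open>e\<close> is left free because z * cnj w turns
  the opposite way when w is rotated.\<close>

lemma nn_integral_radial_mean:
  assumes [measurable]: "\<phi> \<in> borel_measurable borel" "J \<in> borel_measurable borel"
    and e [measurable]: "e \<in> borel_measurable borel" and norm_e: "\<And>t. norm (e t) = 1"
  shows "(\<integral>\<^sup>+ w. \<phi> (wt w) * J w \<partial>dA) = (\<integral>\<^sup>+ w. \<phi> (wt w) * (\<integral>\<^sup>+ t. J (e t * w) \<partial>circ) \<partial>dA)"
proof -
  interpret pair_sigma_finite circ dA ..
  have [measurable]: "(\<lambda>(t, w). \<phi> (wt w) * J (e t * w)) \<in> borel_measurable (circ \<Otimes>\<^sub>M dA)"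
  proof -
    have 1: "(\<lambda>p. \<phi> (wt (snd p)) * J (e (fst p) * snd p)) \<in> borel_measurable (borel \<Otimes>\<^sub>M borel)"
      by measurable
    have 2: "(\<lambda>x. (fst x, snd x)) \<in> measurable (circ \<Otimes>\<^sub>M dA) (borel \<Otimes>\<^sub>M borel)"
      by (intro measurable_Pair measurable_compose[OF measurable_snd id_measurable_dA]) auto
    show ?thesis using measurable_compose[OF 2 1] by (simp add: case_prod_beta')
  qed
  have "(\<integral>\<^sup>+ w. \<phi> (wt w) * J w \<partial>dA) = (\<integral>\<^sup>+ t. (\<integral>\<^sup>+ w. \<phi> (wt w) * J w \<partial>dA) \<partial>circ)"
    by (simp add: circ.emeasure_space_1[simplified])
  also have "\<dots> = (\<integral>\<^sup>+ t. (\<integral>\<^sup>+ w. \<phi> (wt (e t * w)) * J (e t * w) \<partial>dA) \<partial>circ)"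
    by (intro nn_integral_cong rotation_dA[symmetric]) (auto simp: norm_e)
  also have "\<dots> = (\<integral>\<^sup>+ t. (\<integral>\<^sup>+ w. \<phi> (wt w) * J (e t * w) \<partial>dA) \<partial>circ)"
    by (simp add: norm_mult norm_e)
  also have "\<dots> = (\<integral>\<^sup>+ w. (\<integral>\<^sup>+ t. \<phi> (wt w) * J (e t * w) \<partial>circ) \<partial>dA)"
    by (rule Fubini'[symmetric]) fact
  also have "\<dots> = (\<integral>\<^sup>+ w. \<phi> (wt w) * (\<integral>\<^sup>+ t. J (e t * w) \<partial>circ) \<partial>dA)"
    by (intro nn_integral_cong nn_integral_cmult) measurable
  finally show ?thesis .
qed

lemma nn_integral_radial_le:
  assumes \<phi> [measurable]: "\<phi> \<in> borel_measurable borel" and J: "J \<in> borel_measurable borel"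
    and e: "e \<in> borel_measurable borel" "\<And>t. norm (e t) = 1"
    and le: "\<And>z. norm z < 1 \<Longrightarrow> (\<integral>\<^sup>+ t. J (e t * z) \<partial>circ) \<le> A"
  shows "(\<integral>\<^sup>+ w. \<phi> (wt w) * J w \<partial>dA) \<le> A * (\<integral>\<^sup>+ y. \<phi> y * indicator {0..1} y \<partial>lborel)"
proof -
  have "(\<integral>\<^sup>+ w. \<phi> (wt w) * J w \<partial>dA) \<le> (\<integral>\<^sup>+ w. \<phi> (wt w) * A \<partial>dA)"
    unfolding nn_integral_radial_mean[OF \<phi> J e]
    by (intro nn_integral_mono mult_left_mono le) auto
  also have "\<dots> = (\<integral>\<^sup>+ w. \<phi> (wt w) \<partial>dA) * A"
    by (rule nn_integral_multc) (rule borel_measurable_dA, measurable)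
  also have "\<dots> = A * (\<integral>\<^sup>+ y. \<phi> y * indicator {0..1} y \<partial>lborel)"
    by (subst nn_integral_radial) (auto simp: mult.commute)
  finally show ?thesis .
qed

lemma ecis_measurable: "ecis \<in> borel_measurable borel"
  unfolding cis_conv_exp by measurable

section \<open>Circular means of the kernels\<close>

lemma circ_eq_density: "circ = density lborel (indicator {0..1})"
  unfolding circ_def uniform_measure_def by (simp add: divide_ennreal_def)

lemma has_integral_circ:
  fixes f :: "real \<Rightarrow> complex"
  assumes cont: "continuous_on UNIV f" and int: "(f has_integral I) {0..1}"
  shows "integrable circ f" "integral\<^sup>L circ f = I"
proof -
  have [measurable]: "f \<in> borel_measurable borel"
    using cont by (rule borel_measurable_continuous_onI)
  have s: "set_integrable lborel {0..1} f"
    using cont by (intro borel_integrable_atLeastAtMost') (auto intro: continuous_on_subset)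
  have d: "circ = density lborel (\<lambda>x. ennreal (indicator {0..1} x))"
    unfolding circ_eq_density by (simp add: ennreal_indicator)
  show "integrable circ f"
    unfolding d using s by (subst integrable_density) (auto simp: set_integrable_def)
  have "integral\<^sup>L circ f = set_lebesgue_integral lborel {0..1} f"
    unfolding d set_lebesgue_integral_def by (subst integral_density) auto
  also have "\<dots> = integral {0..1} f"
    using s by (rule set_borel_integral_eq_integral)
  finally show "integral\<^sup>L circ f = I" using int by (simp add: integral_unique)
qed

lemma continuous_on_ecis_mult:
  assumes "continuous_on (ball 0 1) g" "norm z < 1"
  shows "continuous_on UNIV (\<lambda>t. g (ecis t * z))"
proof -
  have "continuous_on UNIV (\<lambda>t. ecis t * z)"
    unfolding cis_conv_exp by (intro continuous_intros)
  moreover have "(\<lambda>t. ecis t * z) ` UNIV \<subseteq> ball 0 1"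
    using assms(2) by (auto simp: norm_mult)
  ultimately show ?thesis using continuous_on_compose2[OF assms(1)] by blast
qed

text \<open>Mean value property, read off from Cauchy's formula on the unit circle for v -> g (v *
  z), which is holomorphic on the closed disc because |z| < 1.\<close>

lemma circ_mean_holomorphic:
  assumes hol: "g holomorphic_on unit_disc" and z: "norm z < 1"
  shows "integrable circ (\<lambda>t. g (ecis t * z))"
    and "(LINT t|circ. g (ecis t * z)) = g 0"
proof -
  have "(\<lambda>v. v * z) ` cball 0 1 \<subseteq> unit_disc"
  proof (rule image_subsetI)
    fix v :: complex assume "v \<in> cball 0 1"
    then have "norm v * norm z \<le> 1 * norm z" by (intro mult_right_mono) auto
    then have "norm (v * z) < 1" using z unfolding norm_mult by linarith
    then show "v * z \<in> unit_disc" by simp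
  qed
  then have "(\<lambda>v. g (v * z)) holomorphic_on cball 0 1"
  proof -
    assume sub: "(\<lambda>v. v * z) ` cball 0 1 \<subseteq> unit_disc"
    have "(\<lambda>v. v * z) holomorphic_on cball 0 1" by (intro holomorphic_intros)
    from holomorphic_on_compose_gen[OF this hol sub] show ?thesis by (simp add: o_def)
  qed
  then have "((\<lambda>u. g (u * z) / (u - 0)) has_contour_integral (2 * of_real pi * \<i> * g (0 * z))) (circlepath 0 1)"
    by (intro Cauchy_integral_circlepath_simple) auto
  then have "((\<lambda>x. g (circlepath 0 1 x * z) / (circlepath 0 1 x - 0) * vector_derivative (circlepath 0 1) (at x within {0..1})) has_integral
     2 * of_real pi * \<i> * g 0) {0..1}"
    by (simp add: has_contour_integral_def)
  then have "((\<lambda>x. 2 * of_real pi * \<i> * g (ecis x * z)) has_integral 2 * of_real pi * \<i> * g 0) {0..1}"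
  proof (rule has_integral_eq[rotated])
    fix x :: real assume x: "x \<in> {0..1}"
    have e: "circlepath 0 1 x = ecis x" by (simp add: circlepath cis_conv_exp mult_ac)
    have "vector_derivative (circlepath 0 1) (at x within {0..1}) = 2 * of_real pi * \<i> * ecis x"
      using x by (subst vector_derivative_circlepath01) (auto simp: cis_conv_exp mult_ac)
    then show "g (circlepath 0 1 x * z) / (circlepath 0 1 x - 0) * vector_derivative (circlepath 0 1) (at x within {0..1}) =
        2 * of_real pi * \<i> * g (ecis x * z)"
      unfolding e by simp
  qed
  then have "((\<lambda>x. inverse (2 * of_real pi * \<i>) * (2 * of_real pi * \<i> * g (ecis x * z))) has_integral
      inverse (2 * of_real pi * \<i>) * (2 * of_real pi * \<i> * g 0)) {0..1}"
    by (rule has_integral_mult_right)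
  then have *: "((\<lambda>x. g (ecis x * z)) has_integral g 0) {0..1}"
    by (simp add: field_simps)
  have cont: "continuous_on UNIV (\<lambda>t. g (ecis t * z))"
    using hol z by (intro continuous_on_ecis_mult holomorphic_on_imp_continuous_on)
  show "integrable circ (\<lambda>t. g (ecis t * z))" "(LINT t|circ. g (ecis t * z)) = g 0"
    using has_integral_circ[OF cont *] by auto
qed

lemma one_minus_disc:
  assumes "norm z < 1"
  shows "1 - z \<noteq> 0" "0 < Re (1 - z)" "0 < Re (1 / (1 - z))"
proof -
  show *: "0 < Re (1 - z)" using assms complex_Re_le_cmod[of z] by simp
  then show "1 - z \<noteq> 0" by force
  then have "0 < (norm (1 - z))\<^sup>2" by simp
  then show "0 < Re (1 / (1 - z))"
    using * by (simp add: Re_divide cmod_def)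
qed

lemma circ_mean_Re:
  assumes hol: "g holomorphic_on unit_disc" and z: "norm z < 1"
    and pos: "\<And>w. norm w < 1 \<Longrightarrow> 0 \<le> Re (g w)"
  shows "(\<integral>\<^sup>+ t. ennreal (Re (g (ecis t * z))) \<partial>circ) = ennreal (Re (g 0))"
proof -
  note m = circ_mean_holomorphic[OF hol z]
  have "(\<integral>\<^sup>+ t. ennreal (Re (g (ecis t * z))) \<partial>circ) = ennreal (LINT t|circ. Re (g (ecis t * z)))"
    using m(1) z by (intro nn_integral_eq_integral integrable_Re) (auto intro!: pos simp: norm_mult)
  then show ?thesis using m by simp
qed

lemma circ_mean_Cauchy_kernel:
  assumes "norm z < 1"
  shows "(\<integral>\<^sup>+ t. ennreal (Re (1 / (1 - ecis t * z))) \<partial>circ) = 1"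
proof -
  have "(\<lambda>w. 1 / (1 - w)) holomorphic_on unit_disc"
    using one_minus_disc(1) by (intro holomorphic_intros) auto
  from circ_mean_Re[OF this assms] show ?thesis
    using one_minus_disc(3) by (auto intro: less_imp_le)
qed

lemma norm_powr_of_real:
  "w \<noteq> 0 \<Longrightarrow> norm (w powr complex_of_real c) = norm w powr c"
  by (simp add: norm_powr_real_powr powr_def)

lemma Re_powr_of_real:
  "w \<noteq> 0 \<Longrightarrow> Re (w powr complex_of_real c) = norm w powr c * cos (c * Im (Ln w))"
  by (simp add: powr_def Re_exp)

lemma cos_mult_half_pi_pos:
  assumes "0 < c" "c < 1"
  shows "0 < cos (c * pi / 2)"
proof (rule cos_gt_zero_pi)
  show "- (pi / 2) < c * pi / 2" using assms pi_gt_zero by (smt (verit) divide_pos_pos mult_pos_pos)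
  have "c * pi < 1 * pi" using assms by (intro mult_strict_right_mono) auto
  then show "c * pi / 2 < pi / 2" by simp
qed

text \<open>
  On the right half plane \<open>|arg| < \<pi>/2\<close>, so \<open>|w|\<^sup>-\<^sup>c \<le> Re (w\<^sup>-\<^sup>c) / cos (c \<pi>/2)\<close>, and the right side is harmonic.
\<close>

lemma circ_mean_powr_kernel:
  assumes z: "norm z < 1" and c: "0 < c" "c < 1"
  shows "(\<integral>\<^sup>+ t. ennreal (norm (1 - ecis t * z) powr - c) \<partial>circ) \<le> ennreal (1 / cos (c * pi / 2))"
proof -
  note cospos = cos_mult_half_pi_pos[OF c]
  let ?g = "\<lambda>w. (1 - w) powr complex_of_real (-c)"
  have hol: "?g holomorphic_on unit_disc"
    using one_minus_disc(2) by (intro holomorphic_intros) (force simp: complex_nonpos_Reals_iff)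
  have bd: "norm (1 - w) powr - c \<le> Re (?g w) / cos (c * pi / 2)" if w: "norm w < 1" for w
  proof -
    have "\<bar>Im (Ln (1 - w))\<bar> < pi / 2" using one_minus_disc[OF w] Re_Ln_pos_lt[of "1 - w"] by simp
    then have "\<bar>c * Im (Ln (1 - w))\<bar> \<le> c * pi / 2" using c by (simp add: abs_mult)
    then have "cos (c * pi / 2) \<le> cos \<bar>c * Im (Ln (1 - w))\<bar>"
    proof (intro cos_monotone_0_pi_le)
      have "c * pi \<le> 1 * pi" using c by (intro mult_right_mono) auto
      then show "c * pi / 2 \<le> pi" using pi_gt_zero by linarith
    qed auto
    then have "cos (c * pi / 2) \<le> cos (c * Im (Ln (1 - w)))" by simp
    then have "norm (1 - w) powr - c * cos (c * pi / 2) \<le> Re (?g w)"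
      using one_minus_disc(1)[OF w] by (subst Re_powr_of_real) (auto intro!: mult_left_mono)
    then show ?thesis using cospos by (simp add: field_simps)
  qed
  have pos: "0 \<le> Re (?g w)" if "norm w < 1" for w
  proof -
    have "0 \<le> Re (?g w) / cos (c * pi / 2)" by (rule order_trans[OF powr_ge_zero bd[OF that]])
    then show ?thesis using cospos by (metis divide_neg_pos not_le)
  qed
  have "(\<integral>\<^sup>+ t. ennreal (norm (1 - ecis t * z) powr - c) \<partial>circ) \<le>
      (\<integral>\<^sup>+ t. ennreal (1 / cos (c * pi / 2)) * ennreal (Re (?g (ecis t * z))) \<partial>circ)"
    using z cospos by (intro nn_integral_mono, subst ennreal_mult'[symmetric])
      (auto intro!: ennreal_leI bd[THEN order_trans] pos simp: norm_mult)
  also have "\<dots> = ennreal (1 / cos (c * pi / 2)) * (\<integral>\<^sup>+ t. ennreal (Re (?g (ecis t * z))) \<partial>circ)"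
    unfolding cis_conv_exp by (rule nn_integral_cmult) measurable
  also have "(\<integral>\<^sup>+ t. ennreal (Re (?g (ecis t * z))) \<partial>circ) = 1"
    using circ_mean_Re[OF hol z] pos by simp
  finally show ?thesis by simp
qed

lemma nn_integral_log_kernel:
  fixes \<kappa> :: real
  assumes "0 < \<kappa>"
  shows "(\<integral>\<^sup>+ x. ennreal (1 / (\<kappa> + 2 * pi * x)) * indicator {0..1/2} x \<partial>lborel) = ennreal (ln (1 + pi / \<kappa>) / (2 * pi))"
proof -
  have "(\<integral>\<^sup>+ x. ennreal (1 / (\<kappa> + 2 * pi * x)) * indicator {0..1/2} x \<partial>lborel) =
      ennreal (ln (\<kappa> + 2 * pi * (1/2)) / (2 * pi) - ln (\<kappa> + 2 * pi * 0) / (2 * pi))"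
    using assms
  proof (intro nn_integral_FTC_Icc)
    fix x :: real assume x: "x \<in> {0..1/2}"
    have "0 < \<kappa> + 2 * pi * x" using assms x by (intro add_pos_nonneg) auto
    then show "((\<lambda>x. ln (\<kappa> + 2 * pi * x) / (2 * pi)) has_real_derivative 1 / (\<kappa> + 2 * pi * x)) (at x)"
      "0 \<le> 1 / (\<kappa> + 2 * pi * x)"
      by (auto intro!: derivative_eq_intros)
  qed auto
  also have "ln (\<kappa> + 2 * pi * (1/2)) / (2 * pi) - ln (\<kappa> + 2 * pi * 0) / (2 * pi) = (ln (\<kappa> + pi) - ln \<kappa>) / (2 * pi)"
    by (simp add: diff_divide_distrib)
  also have "ln (\<kappa> + pi) - ln \<kappa> = ln (1 + pi / \<kappa>)"
  proof -
    have "1 + pi / \<kappa> = (\<kappa> + pi) / \<kappa>" using assms by (simp add: field_simps)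
    moreover have "\<kappa> + pi \<noteq> 0" using assms pi_gt_zero by linarith
    ultimately show ?thesis using assms by (simp add: ln_div)
  qed
  finally show ?thesis .
qed

text \<open>If 2 \<pi> a is the argument of z, then at t = 1 - a the rotated point lies at distance
  1 - |z| from 1, and this distance grows at most at rate 2 \<pi> in t. Integrating the reciprocal
  produces the logarithm.\<close>

lemma circ_mean_inverse_lower:
  assumes z: "norm z < 1"
  shows "ennreal (ln (1 + pi / (1 - norm z)) / (2 * pi)) \<le> (\<integral>\<^sup>+ t. ennreal (1 / norm (1 - ecis t * z)) \<partial>circ)"
proof -
  define \<kappa> where "\<kappa> = 1 - norm z"
  have \<kappa>: "0 < \<kappa>" using z by (simp add: \<kappa>_def)
  obtain a where a: "0 \<le> a" "a \<le> 1" "z = of_real (norm z) * ecis a"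
  proof
    show "0 \<le> Arg2pi z / (2 * pi)" "Arg2pi z / (2 * pi) \<le> 1"
      using Arg2pi[of z] by (auto simp: field_simps intro: less_imp_le)
    show "z = of_real (norm z) * ecis (Arg2pi z / (2 * pi))"
      using Arg2pi[of z] by (simp add: cis_conv_exp is_Arg_def)
  qed
  have le: "norm (1 - ecis t * z) \<le> \<kappa> + 2 * pi * \<bar>t - (1 - a)\<bar>" for t
  proof -
    have e1: "ecis t * ecis a = ecis (t - (1 - a))"
    proof -
      have "ecis t * ecis a = cis (2 * pi * (t - (1 - a)) + 2 * pi)"
        by (simp add: cis_mult algebra_simps)
      then show ?thesis by (simp add: cis_mult[symmetric])
    qed
    define x where "x = 2 * pi * (t - (1 - a))"
    have "1 - ecis t * z = (1 - cis x) + of_real (1 - norm z) * cis x"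
    proof -
      have "ecis t * z = of_real (norm z) * (ecis t * ecis a)" by (subst a(3)) (simp add: mult_ac)
      also have "\<dots> = of_real (norm z) * cis x" by (simp add: e1 x_def)
      finally show ?thesis by (simp add: algebra_simps)
    qed
    then have "norm (1 - ecis t * z) \<le> norm (1 - cis x) + norm (of_real (1 - norm z) * cis x)"
      by (metis norm_triangle_ineq)
    also have "norm (of_real (1 - norm z) * cis x) = \<kappa>"
      using z by (simp add: norm_mult \<kappa>_def del: of_real_diff)
    also have "norm (1 - cis x) \<le> \<bar>x\<bar>"
      using dist_exp_i_1[of x] abs_sin_x_le_abs_x[of "x / 2"] by (simp add: norm_minus_commute cis_conv_exp)
    also have "\<bar>x\<bar> = 2 * pi * \<bar>t - (1 - a)\<bar>" by (simp add: x_def abs_mult)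
    finally show ?thesis by simp
  qed
  have pos: "0 < norm (1 - ecis t * z)" for t
    using one_minus_disc(1)[of "ecis t * z"] z by (simp add: norm_mult)
  define h where "h = (\<lambda>x. ennreal (1 / (\<kappa> + 2 * pi * x)) * indicator {0..1/2} x)"
  have [measurable]: "h \<in> borel_measurable borel" unfolding h_def by measurable
  have hle: "h \<bar>t - (1 - a)\<bar> \<le> ennreal (1 / norm (1 - ecis t * z))" for t
    unfolding h_def using le[of t] pos[of t] \<kappa>
    by (auto simp: indicator_def intro!: ennreal_leI divide_left_mono mult_pos_pos add_pos_nonneg)
  \<comment> \<open>At least one side of 1 - a contains an interval of length 1/2 within {0..1};
    integrating over that side alone avoids wrapping around the circle.\<close>
  obtain \<sigma> :: real where \<sigma>: "\<bar>\<sigma>\<bar> = 1" "\<And>x. x \<in> {0..1/2} \<Longrightarrow> (1 - a) + \<sigma> * x \<in> {0..1}"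
  proof (cases "a \<le> 1/2")
    case True
    then show ?thesis using a by (intro that[of "-1"]) auto
  next
    case False
    then show ?thesis using a by (intro that[of 1]) auto
  qed
  have "ennreal (ln (1 + pi / \<kappa>) / (2 * pi)) = (\<integral>\<^sup>+ x. h x \<partial>lborel)"
    unfolding h_def by (rule nn_integral_log_kernel[OF \<kappa>, symmetric])
  also have "\<dots> \<le> (\<integral>\<^sup>+ x. h \<bar>((1 - a) + \<sigma> * x) - (1 - a)\<bar> * indicator {0..1} ((1 - a) + \<sigma> * x) \<partial>lborel)"
    using \<sigma> by (intro nn_integral_mono) (auto simp: h_def indicator_def abs_mult)
  also have "\<dots> = (\<integral>\<^sup>+ t. h \<bar>t - (1 - a)\<bar> * indicator {0..1} t \<partial>lborel)"
    using \<sigma>(1) by (subst (2) nn_integral_real_affine[of _ \<sigma> "1 - a"]) auto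
  also have "\<dots> = (\<integral>\<^sup>+ t. h \<bar>t - (1 - a)\<bar> \<partial>circ)"
    by (rule nn_integral_circ[symmetric]) measurable
  also have "\<dots> \<le> (\<integral>\<^sup>+ t. ennreal (1 / norm (1 - ecis t * z)) \<partial>circ)"
    by (intro nn_integral_mono hle)
  finally show ?thesis by (simp add: \<kappa>_def)
qed

text \<open>
  Calderon's device for M. Riesz' theorem: the deviation of \<open>|z|\<^sup>s\<close> from the harmonic function
  \<open>B Re z\<^sup>s\<close> is controlled by \<open>Re z\<close>, because \<open>B cos (s \<phi>) \<ge> 1\<close> where \<open>\<phi>\<close> is close to \<open>\<plusminus>\<pi>/2\<close>.
\<close>

lemma norm_powr_le_Re:
  fixes s :: real
  assumes s: "0 < s" and cs: "cos (s * pi / 2) \<noteq> 0"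
  obtains A B where "0 \<le> A" "\<And>z. 0 < Re z \<Longrightarrow> norm z powr s \<le> A * Re z powr s + B * Re (z powr complex_of_real s)"
proof -
  \<comment> \<open>With this normalisation B cos (s \<phi>) tends to 2 as \<phi> approaches
    \<pi>/2, so it exceeds 1 on a left neighbourhood. \<open>B\<close> can be negative.\<close>
  define B where "B = 2 / cos (s * pi / 2)"
  have "((\<lambda>\<phi>. B * cos (s * \<phi>)) \<longlongrightarrow> B * cos (s * (pi / 2))) (at_left (pi / 2))"
    by (intro tendsto_intros)
  moreover have "B * cos (s * (pi / 2)) = 2" using cs by (simp add: B_def)
  ultimately have "((\<lambda>\<phi>. B * cos (s * \<phi>)) \<longlongrightarrow> 2) (at_left (pi / 2))" by simp
  then have "\<forall>\<^sub>F \<phi> in at_left (pi / 2). 1 < B * cos (s * \<phi>)"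
    by (rule order_tendstoD) simp
  then obtain d where d: "d < pi / 2" "\<And>\<phi>. d < \<phi> \<Longrightarrow> \<phi> < pi / 2 \<Longrightarrow> 1 < B * cos (s * \<phi>)"
    unfolding eventually_at_left_field by auto
  define d' where "d' = max 0 d"
  have d': "0 \<le> d'" "d' < pi / 2" using d pi_gt_zero unfolding d'_def by linarith+
  define m where "m = cos d' powr s"
  have "0 < cos d'" using d' by (intro cos_gt_zero_pi) auto
  then have m: "0 < m" by (simp add: m_def)
  \<comment> \<open>Below d' the cosine is bounded away from 0, and A cos(\<phi>)^s >= 1 + |B|
    outweighs the worst value -|B| of the other term.\<close>
  define A where "A = (1 + \<bar>B\<bar>) / m"
  have A: "0 \<le> A" using m by (simp add: A_def)
  have key: "1 \<le> A * cos \<phi> powr s + B * cos (s * \<phi>)" if \<phi>: "0 \<le> \<phi>" "\<phi> < pi / 2" for \<phi>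
  proof (cases "d' < \<phi>")
    case True
    then have "1 < B * cos (s * \<phi>)" using d(2) \<phi> by (auto simp: d'_def)
    moreover have "0 \<le> A * cos \<phi> powr s" using A by simp
    ultimately show ?thesis by linarith
  next
    case False
    then have "cos d' \<le> cos \<phi>" using d' \<phi> by (intro cos_monotone_0_pi_le) auto
    then have "m \<le> cos \<phi> powr s"
      unfolding m_def using d' s by (intro powr_mono2) (auto intro!: less_imp_le[OF cos_gt_zero_pi])
    then have "A * m \<le> A * cos \<phi> powr s" using A by (intro mult_left_mono)
    moreover have "A * m = 1 + \<bar>B\<bar>" using m by (simp add: A_def)
    moreover have "- \<bar>B\<bar> \<le> B * cos (s * \<phi>)"
    proof -
      have "\<bar>B * cos (s * \<phi>)\<bar> \<le> \<bar>B\<bar>" by (simp add: abs_mult mult_left_le)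
      then show ?thesis by linarith
    qed
    ultimately show ?thesis by linarith
  qed
  show thesis
  proof (rule that[OF A])
    fix z :: complex assume z: "0 < Re z"
    then have z0: "z \<noteq> 0" by auto
    define \<phi> where "\<phi> = \<bar>Im (Ln z)\<bar>"
    have \<phi>: "0 \<le> \<phi>" "\<phi> < pi / 2" using z z0 Re_Ln_pos_lt[of z] by (auto simp: \<phi>_def)
    have re: "Re z = norm z * cos \<phi>"
    proof -
      have "Re z = Re (exp (Ln z))" using z0 by simp
      also have "\<dots> = norm z * cos (Im (Ln z))" using z0 by (simp only: Re_exp) simp
      finally show ?thesis by (simp add: \<phi>_def)
    qed
    have re2: "Re (z powr complex_of_real s) = norm z powr s * cos (s * \<phi>)"
      using Re_powr_of_real[OF z0, of s] s cos_abs_real[of "s * Im (Ln z)"] by (simp add: \<phi>_def abs_mult)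
    have "norm z powr s * 1 \<le> norm z powr s * (A * cos \<phi> powr s + B * cos (s * \<phi>))"
      by (intro mult_left_mono key \<phi>) auto
    also have "\<dots> = A * Re z powr s + B * Re (z powr complex_of_real s)"
      unfolding re re2 using \<phi> by (subst powr_mult) (auto simp: algebra_simps intro!: less_imp_le[OF cos_gt_zero_pi])
    finally show "norm z powr s \<le> A * Re z powr s + B * Re (z powr complex_of_real s)" by simp
  qed
qed

section \<open>Kernel integrals of Lorentz functions\<close>

lemma nn_integral_powr_from_0:
  fixes b c :: real
  assumes "- 1 < b" "0 \<le> c"
  shows "(\<integral>\<^sup>+ y. ennreal (y powr b) * indicator {0..c} y \<partial>lborel) = ennreal (c powr (b + 1) / (b + 1))"
  using nn_integral_has_integral_lebesgue[OF _ has_integral_powr_from_0[OF assms]]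
  by (simp add: ennreal_mult'' ennreal_indicator mult.commute)

lemma nn_integral_powr_to_inf:
  fixes e y :: real
  assumes "e < - 1" "0 < y"
  shows "(\<integral>\<^sup>+ x. ennreal (x powr e) * indicator {y..} x \<partial>lborel) = ennreal (y powr (e + 1) / (- e - 1))"
proof -
  have "- (y powr (e + 1)) / (e + 1) = y powr (e + 1) / (- e - 1)"
    using assms by (simp add: field_simps)
  then show ?thesis
    using nn_integral_has_integral_lebesgue[OF _ has_integral_powr_to_inf[OF assms]]
    by (simp add: ennreal_mult'' ennreal_indicator mult.commute)
qed

lemma level_set_dA:
  assumes "f \<in> borel_measurable dA"
  shows "{z \<in> unit_disc. t < norm (f z)} \<in> sets dA"
  using assms borel_measurable_less[of "\<lambda>_. t" dA "\<lambda>z. norm (f z)"] by simp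

lemma dist_fun_bounds: "0 \<le> dist_fun f t" "dist_fun f t \<le> 1"
  by (simp_all add: dist_fun_def)

lemma dist_fun_antimono:
  assumes "f \<in> borel_measurable dA" "s \<le> t"
  shows "dist_fun f t \<le> dist_fun f s"
  unfolding dist_fun_def using assms(2)
  by (intro dA.finite_measure_mono level_set_dA assms) auto

lemma dist_fun_measurable:
  assumes "f \<in> borel_measurable dA"
  shows "dist_fun f \<in> borel_measurable borel"
proof -
  have "mono (\<lambda>t. - dist_fun f t)"
    using assms by (intro monoI) (simp add: dist_fun_antimono)
  from borel_measurable_uminus[OF borel_measurable_mono[OF this]] show ?thesis by simp
qed

lemma emeasure_level_set:
  "f \<in> borel_measurable dA \<Longrightarrow>
    (\<integral>\<^sup>+ w. (if t < norm (f w) then 1 else 0) \<partial>dA) = ennreal (dist_fun f t)"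
proof -
  assume f: "f \<in> borel_measurable dA"
  have "(\<integral>\<^sup>+ w. (if t < norm (f w) then 1 else 0) \<partial>dA) = (\<integral>\<^sup>+ w. indicator {z \<in> unit_disc. t < norm (f z)} w \<partial>dA)"
    by (intro nn_integral_cong) (auto simp: indicator_def)
  also have "\<dots> = ennreal (dist_fun f t)"
    using level_set_dA[OF f] by (simp add: dist_fun_def dA.emeasure_eq_measure)
  finally show ?thesis .
qed

lemma layer_cake:
  fixes r :: real
  assumes "0 \<le> r"
  shows "(\<integral>\<^sup>+ t. (if t < r then 1 else 0) * indicator {0<..} t \<partial>lborel) = ennreal r"
proof -
  have "(\<integral>\<^sup>+ t. (if t < r then 1 else 0) * indicator {0<..} t \<partial>lborel) = (\<integral>\<^sup>+ t. indicator {0<..<r} t \<partial>lborel)"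
    by (intro nn_integral_cong) (auto simp: indicator_def)
  also have "\<dots> = ennreal r" using assms by simp
  finally show ?thesis .
qed

text \<open>The L^{p,1} norm without its factor p, indexed by \<beta> = 1/p because the exponent in
  use is b + 1.\<close>

definition lorentz :: "real \<Rightarrow> (complex \<Rightarrow> complex) \<Rightarrow> ennreal"
  where "lorentz \<beta> f = (\<integral>\<^sup>+ t\<in>{0<..}. ennreal (dist_fun f t powr \<beta>) \<partial>lborel)"

definition kernel_int :: "(complex \<Rightarrow> real) \<Rightarrow> real \<Rightarrow> (complex \<Rightarrow> complex) \<Rightarrow> complex \<Rightarrow> ennreal"
  where "kernel_int k b f z = (\<integral>\<^sup>+ w. ennreal (k (z * cnj w) * wt w powr b * norm (f w)) \<partial>dA)"

text \<open>The function J of the overview: each layer {|f| > t} is weighted by \<epsilon>(t)^b, the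
  value of the weight y^b at the splitting height for K = 1.\<close>

definition kernel_aux :: "(complex \<Rightarrow> real) \<Rightarrow> real \<Rightarrow> (complex \<Rightarrow> complex) \<Rightarrow> complex \<Rightarrow> ennreal"
  where "kernel_aux k b f z = (\<integral>\<^sup>+ t\<in>{0<..}. ennreal (dist_fun f t powr b) *
    (\<integral>\<^sup>+ w. ennreal (k (z * cnj w)) * (if t < norm (f w) then 1 else 0) \<partial>dA) \<partial>lborel)"

lemma borel_measurable_cnj_mult [measurable]:
  "(\<lambda>p. fst p * cnj (snd p)) \<in> borel_measurable (borel \<Otimes>\<^sub>M borel)"
  unfolding borel_prod by (intro borel_measurable_continuous_onI continuous_intros)

lemma measurable_kernel_pair:
  fixes k :: "complex \<Rightarrow> real"
  assumes [measurable]: "k \<in> borel_measurable borel"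
  shows "(\<lambda>p. k (fst p * cnj (snd p))) \<in> borel_measurable (borel \<Otimes>\<^sub>M dA)"
proof -
  have 1: "(\<lambda>p. k (fst p * cnj (snd p))) \<in> borel_measurable (borel \<Otimes>\<^sub>M borel)" by measurable
  have 2: "(\<lambda>p. (fst p, snd p)) \<in> measurable (borel \<Otimes>\<^sub>M dA) (borel \<Otimes>\<^sub>M borel)"
    by (intro measurable_Pair measurable_compose[OF measurable_snd id_measurable_dA]) auto
  show ?thesis using measurable_compose[OF 2 1] by simp
qed

lemma measurable_kernel_dA:
  fixes k :: "complex \<Rightarrow> real"
  assumes k: "k \<in> borel_measurable borel"
  shows "(\<lambda>w. k (z * cnj w)) \<in> borel_measurable dA"
proof -
  have "(\<lambda>w. (z, w)) \<in> measurable dA (borel \<Otimes>\<^sub>M dA)" by (rule measurable_Pair1') simp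
  from measurable_compose[OF this measurable_kernel_pair[OF k]] show ?thesis by simp
qed

lemma kernel_aux_measurable:
  assumes k [measurable]: "k \<in> borel_measurable borel" and f [measurable]: "f \<in> borel_measurable dA"
  shows "kernel_aux k b f \<in> borel_measurable borel"
proof -
  note [measurable] = dist_fun_measurable[OF f] measurable_kernel_pair[OF k]
  have 1: "(\<lambda>q. k (fst (fst q) * cnj (snd q))) \<in> borel_measurable ((borel \<Otimes>\<^sub>M (lborel :: real measure)) \<Otimes>\<^sub>M dA)"
  proof -
    have "(\<lambda>q. (fst (fst q), snd q)) \<in> measurable ((borel \<Otimes>\<^sub>M (lborel :: real measure)) \<Otimes>\<^sub>M dA) ((borel :: complex measure) \<Otimes>\<^sub>M dA)"
      by measurable
    from measurable_compose[OF this measurable_kernel_pair[OF k]] show ?thesis by simp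
  qed
  have "(\<lambda>q. ennreal (k (fst (fst q) * cnj (snd q))) * (if snd (fst q) < norm (f (snd q)) then 1 else 0))
      \<in> borel_measurable ((borel \<Otimes>\<^sub>M lborel) \<Otimes>\<^sub>M dA)"
    using 1 by measurable
  then have "(\<lambda>q. \<integral>\<^sup>+ w. ennreal (k (fst q * cnj w)) * (if snd q < norm (f w) then 1 else 0) \<partial>dA)
      \<in> borel_measurable (borel \<Otimes>\<^sub>M lborel)"
    using dA.borel_measurable_nn_integral[of "\<lambda>q w. ennreal (k (fst q * cnj w)) * (if snd q < norm (f w) then 1 else 0)"]
    by (simp add: case_prod_beta')
  then have "(\<lambda>q. ennreal (dist_fun f (snd q) powr b) *
      (\<integral>\<^sup>+ w. ennreal (k (fst q * cnj w)) * (if snd q < norm (f w) then 1 else 0) \<partial>dA) * indicator {0<..} (snd q))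
      \<in> borel_measurable (borel \<Otimes>\<^sub>M lborel)"
    by measurable
  then show ?thesis
    unfolding kernel_aux_def
    using lborel.borel_measurable_nn_integral[of "\<lambda>z t. ennreal (dist_fun f t powr b) *
      (\<integral>\<^sup>+ w. ennreal (k (z * cnj w)) * (if t < norm (f w) then 1 else 0) \<partial>dA) * indicator {0<..} t"]
    by (simp add: case_prod_beta')
qed

text \<open>By Fubini the circular mean of the inner integral is at most B \<epsilon>(t), and
  \<epsilon>(t)^b \<epsilon>(t) = \<epsilon>(t)^(b+1) is exactly the integrand of the Lorentz
  norm.\<close>

lemma kernel_aux_mean:
  assumes k [measurable]: "k \<in> borel_measurable borel" and f [measurable]: "f \<in> borel_measurable dA"
    and mean: "\<And>z. norm z < 1 \<Longrightarrow> (\<integral>\<^sup>+ t. ennreal (k (ecis t * z)) \<partial>circ) \<le> ennreal B"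
    and z: "norm z < 1"
  shows "(\<integral>\<^sup>+ \<theta>. kernel_aux k b f (ecis \<theta> * z) \<partial>circ) \<le> ennreal B * lorentz (b + 1) f"
proof -
  interpret C: pair_sigma_finite circ dA ..
  interpret L: pair_sigma_finite circ lborel ..
  note [measurable] = dist_fun_measurable[OF f] measurable_kernel_pair[OF k]
  define g where "g = (\<lambda>\<theta> t w. ennreal (k (ecis \<theta> * z * cnj w)) * (if t < norm (f w) then 1 else 0 :: ennreal))"
  have e [measurable]: "(\<lambda>\<theta>. ecis \<theta> * z) \<in> borel_measurable circ"
    unfolding cis_conv_exp by measurable
  have g0: "(\<lambda>q. g (fst (fst q)) (snd (fst q)) (snd q)) \<in> borel_measurable ((circ \<Otimes>\<^sub>M lborel) \<Otimes>\<^sub>M dA)"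
  proof -
    have "(\<lambda>q. (ecis (fst (fst q)) * z, snd q)) \<in> measurable ((circ \<Otimes>\<^sub>M (lborel :: real measure)) \<Otimes>\<^sub>M dA) ((borel :: complex measure) \<Otimes>\<^sub>M dA)"
      by measurable
    from measurable_compose[OF this measurable_kernel_pair[OF k]]
    have "(\<lambda>q. k (ecis (fst (fst q)) * z * cnj (snd q))) \<in> borel_measurable ((circ \<Otimes>\<^sub>M (lborel :: real measure)) \<Otimes>\<^sub>M dA)" by simp
    then show ?thesis unfolding g_def by measurable
  qed
  have g1: "(\<lambda>p. \<integral>\<^sup>+ w. g (fst p) (snd p) w \<partial>dA) \<in> borel_measurable (circ \<Otimes>\<^sub>M lborel)"
    using dA.borel_measurable_nn_integral[of "\<lambda>p w. g (fst p) (snd p) w"] g0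
    by (simp add: case_prod_beta')
  have g1': "(\<lambda>(\<theta>, t). ennreal (dist_fun f t powr b) * (\<integral>\<^sup>+ w. g \<theta> t w \<partial>dA) * indicator {0<..} t) \<in> borel_measurable (circ \<Otimes>\<^sub>M lborel)"
    unfolding case_prod_beta' using g1 by measurable
  have g2: "(\<lambda>(\<theta>, w). g \<theta> t w) \<in> borel_measurable (circ \<Otimes>\<^sub>M dA)" for t
  proof -
    have "(\<lambda>q. ((fst q, t), snd q)) \<in> measurable (circ \<Otimes>\<^sub>M dA) ((circ \<Otimes>\<^sub>M lborel) \<Otimes>\<^sub>M dA)" by measurable
    from measurable_compose[OF this g0] show ?thesis by (simp add: case_prod_beta')
  qed
  have g3: "(\<lambda>\<theta>. \<integral>\<^sup>+ w. g \<theta> t w \<partial>dA) \<in> borel_measurable circ" for t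
    using dA.borel_measurable_nn_integral[OF g2] .
  have inner: "(\<integral>\<^sup>+ \<theta>. (\<integral>\<^sup>+ w. g \<theta> t w \<partial>dA) \<partial>circ) \<le> ennreal B * ennreal (dist_fun f t)" for t
  proof -
    have "(\<integral>\<^sup>+ \<theta>. (\<integral>\<^sup>+ w. g \<theta> t w \<partial>dA) \<partial>circ) = (\<integral>\<^sup>+ w. (\<integral>\<^sup>+ \<theta>. g \<theta> t w \<partial>circ) \<partial>dA)"
      by (rule C.Fubini'[symmetric]) (rule g2)
    also have "\<dots> \<le> (\<integral>\<^sup>+ w. ennreal B * (if t < norm (f w) then 1 else 0) \<partial>dA)"
    proof (rule nn_integral_mono)
      fix w assume "w \<in> space dA"
      then have w: "norm w < 1" by simp
      have "norm (z * cnj w) < 1" by (rule norm_mult_cnj_less_1[OF z w])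
      from mean[OF this] have "(\<integral>\<^sup>+ \<theta>. ennreal (k (ecis \<theta> * z * cnj w)) \<partial>circ) \<le> ennreal B"
        by (simp add: mult_ac)
      then show "(\<integral>\<^sup>+ \<theta>. g \<theta> t w \<partial>circ) \<le> ennreal B * (if t < norm (f w) then 1 else 0)"
        by (simp add: g_def)
    qed
    also have "\<dots> = ennreal B * (\<integral>\<^sup>+ w. (if t < norm (f w) then 1 else 0) \<partial>dA)"
      by (rule nn_integral_cmult) measurable
    finally show ?thesis by (simp add: emeasure_level_set)
  qed
  have "(\<integral>\<^sup>+ \<theta>. kernel_aux k b f (ecis \<theta> * z) \<partial>circ) =
      (\<integral>\<^sup>+ \<theta>. (\<integral>\<^sup>+ t. ennreal (dist_fun f t powr b) * (\<integral>\<^sup>+ w. g \<theta> t w \<partial>dA) * indicator {0<..} t \<partial>lborel) \<partial>circ)"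
    by (simp add: kernel_aux_def g_def)
  also have "\<dots> = (\<integral>\<^sup>+ t. (\<integral>\<^sup>+ \<theta>. ennreal (dist_fun f t powr b) * (\<integral>\<^sup>+ w. g \<theta> t w \<partial>dA) * indicator {0<..} t \<partial>circ) \<partial>lborel)"
    by (rule L.Fubini'[symmetric]) (rule g1')
  also have "\<dots> \<le> (\<integral>\<^sup>+ t. ennreal B * (ennreal (dist_fun f t powr (b + 1)) * indicator {0<..} t) \<partial>lborel)"
  proof (rule nn_integral_mono)
    fix t :: real
    have "(\<integral>\<^sup>+ \<theta>. ennreal (dist_fun f t powr b) * (\<integral>\<^sup>+ w. g \<theta> t w \<partial>dA) * indicator {0<..} t \<partial>circ) =
        (\<integral>\<^sup>+ \<theta>. (ennreal (dist_fun f t powr b) * indicator {0<..} t) * (\<integral>\<^sup>+ w. g \<theta> t w \<partial>dA) \<partial>circ)"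
      by (simp add: mult_ac)
    also have "\<dots> = (ennreal (dist_fun f t powr b) * indicator {0<..} t) * (\<integral>\<^sup>+ \<theta>. (\<integral>\<^sup>+ w. g \<theta> t w \<partial>dA) \<partial>circ)"
      by (rule nn_integral_cmult) (rule g3)
    also have "\<dots> \<le> (ennreal (dist_fun f t powr b) * indicator {0<..} t) * (ennreal B * ennreal (dist_fun f t))"
      by (intro mult_left_mono inner) auto
    also have "\<dots> = ennreal B * (ennreal (dist_fun f t * dist_fun f t powr b) * indicator {0<..} t)"
      by (simp add: ennreal_mult' dist_fun_bounds mult_ac)
    also have "dist_fun f t * dist_fun f t powr b = dist_fun f t powr (b + 1)"
      using powr_mult_base[of "dist_fun f t" b] by (simp add: dist_fun_bounds add.commute)
    finally show "(\<integral>\<^sup>+ \<theta>. ennreal (dist_fun f t powr b) * (\<integral>\<^sup>+ w. g \<theta> t w \<partial>dA) * indicator {0<..} t \<partial>circ) \<le>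
      ennreal B * (ennreal (dist_fun f t powr (b + 1)) * indicator {0<..} t)" .
  qed
  also have "\<dots> = ennreal B * lorentz (b + 1) f"
    unfolding lorentz_def by (rule nn_integral_cmult) measurable
  finally show ?thesis .
qed

text \<open>In each layer, where y <= K \<epsilon> the set {|f| > t} is forgotten and the radial
  integral of y^b up to K \<epsilon> is taken; where y > K \<epsilon>, b < 0 gives y^b <= (K
  \<epsilon>)^b and the set is kept.\<close>

lemma kernel_int_le:
  assumes k [measurable]: "k \<in> borel_measurable borel" and f [measurable]: "f \<in> borel_measurable dA"
    and mean: "\<And>z. norm z < 1 \<Longrightarrow> (\<integral>\<^sup>+ t. ennreal (k (ecis t * z)) \<partial>circ) \<le> ennreal B"
    and k_nonneg: "\<And>z. norm z < 1 \<Longrightarrow> 0 \<le> k z" and B: "0 \<le> B"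
    and z: "norm z < 1" and b: "- 1 < b" "b < 0" and K: "0 < K"
  shows "kernel_int k b f z \<le> ennreal (B * K powr (b + 1) / (b + 1)) * lorentz (b + 1) f + ennreal (K powr b) * kernel_aux k b f z"
proof -
  interpret L: pair_sigma_finite lborel dA ..
  note [measurable] = dist_fun_measurable[OF f] measurable_kernel_dA[OF k]
  have zw: "norm (z * cnj w) < 1" if "norm w < 1" for w
    by (rule norm_mult_cnj_less_1[OF z that])
  define ind where "ind = (\<lambda>t w. (if t < norm (f w) then 1 else 0 :: ennreal))"
  have ind_pair [measurable]: "(\<lambda>p. ind (fst p) (snd p)) \<in> borel_measurable (lborel \<Otimes>\<^sub>M dA)"
    unfolding ind_def by measurable
  have ind_w [measurable]: "ind t \<in> borel_measurable dA" for t
    unfolding ind_def by measurable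
  define k0 where "k0 = (\<lambda>w. ennreal (k (z * cnj w) * wt w powr b))"
  have [measurable]: "k0 \<in> borel_measurable dA" unfolding k0_def by measurable
  have layer: "(\<integral>\<^sup>+ w. k0 w * ind t w \<partial>dA) \<le> ennreal (B * K powr (b + 1) / (b + 1)) * ennreal (dist_fun f t powr (b + 1)) +
      ennreal (K powr b) * (ennreal (dist_fun f t powr b) * (\<integral>\<^sup>+ w. ennreal (k (z * cnj w)) * ind t w \<partial>dA))" for t
  proof (cases "dist_fun f t = 0")
    case True
    then have "(\<integral>\<^sup>+ w. ind t w \<partial>dA) = 0" by (simp add: ind_def emeasure_level_set)
    then have "AE w in dA. ind t w = 0" by (subst (asm) nn_integral_0_iff_AE) auto
    then have "(\<integral>\<^sup>+ w. k0 w * ind t w \<partial>dA) = 0" by (subst nn_integral_0_iff_AE) auto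
    then show ?thesis by simp
  next
    case False
    define \<epsilon> where "\<epsilon> = dist_fun f t"
    have \<epsilon>: "0 < \<epsilon>" using False dist_fun_bounds(1)[of f t] by (simp add: \<epsilon>_def)
    define \<phi> where "\<phi> = (\<lambda>y. ennreal (y powr b) * indicator {0..K * \<epsilon>} y)"
    have [measurable]: "\<phi> \<in> borel_measurable borel" unfolding \<phi>_def by measurable
    have "(\<integral>\<^sup>+ w. k0 w * ind t w \<partial>dA) \<le>
        (\<integral>\<^sup>+ w. \<phi> (wt w) * ennreal (k (z * cnj w)) + ennreal ((K * \<epsilon>) powr b) * (ennreal (k (z * cnj w)) * ind t w) \<partial>dA)"
    proof (rule nn_integral_mono)
      fix w assume "w \<in> space dA"
      then have w: "norm w < 1" by simp
      have k0: "k0 w = ennreal (wt w powr b) * ennreal (k (z * cnj w))"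
        unfolding k0_def using k_nonneg[OF zw[OF w]] by (simp add: ennreal_mult'' mult.commute)
      show "k0 w * ind t w \<le> \<phi> (wt w) * ennreal (k (z * cnj w)) + ennreal ((K * \<epsilon>) powr b) * (ennreal (k (z * cnj w)) * ind t w)"
      proof (cases "wt w \<le> K * \<epsilon>")
        case True
        then have "\<phi> (wt w) = ennreal (wt w powr b)" using wt_pos[OF w] by (simp add: \<phi>_def)
        then have "k0 w * ind t w \<le> \<phi> (wt w) * ennreal (k (z * cnj w))" by (auto simp: k0 ind_def)
        then show ?thesis by (rule order_trans) simp
      next
        case False
        then have "wt w powr b \<le> (K * \<epsilon>) powr b"
          using K \<epsilon> b by (intro powr_mono2') auto
        then have "k0 w * ind t w \<le> ennreal ((K * \<epsilon>) powr b) * ennreal (k (z * cnj w)) * ind t w"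
          unfolding k0 by (intro mult_right_mono ennreal_leI) auto
        then show ?thesis by (simp add: mult.assoc add_increasing)
      qed
    qed
    also have "\<dots> = (\<integral>\<^sup>+ w. \<phi> (wt w) * ennreal (k (z * cnj w)) \<partial>dA) +
        ennreal ((K * \<epsilon>) powr b) * (\<integral>\<^sup>+ w. ennreal (k (z * cnj w)) * ind t w \<partial>dA)"
      by (subst nn_integral_add) (simp_all add: nn_integral_cmult)
    also have "(\<integral>\<^sup>+ w. \<phi> (wt w) * ennreal (k (z * cnj w)) \<partial>dA) \<le> ennreal B * (\<integral>\<^sup>+ y. \<phi> y * indicator {0..1} y \<partial>lborel)"
    \<comment> \<open>Turning w backwards turns z * cnj w forwards, so the inner mean is that of
      \<open>k\<close> over the circle through z * cnj w.\<close>
    proof (rule nn_integral_radial_le[where e = "\<lambda>t. cis (- (2 * pi * t))"])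
      show "(\<lambda>w. ennreal (k (z * cnj w))) \<in> borel_measurable borel"
      proof -
        have "(\<lambda>w. z * cnj w) \<in> borel_measurable borel"
          by (intro borel_measurable_continuous_onI continuous_intros)
        then show ?thesis by measurable
      qed
      show "(\<lambda>t. cis (- (2 * pi * t))) \<in> borel_measurable borel" unfolding cis_conv_exp by measurable
      fix w :: complex assume w: "norm w < 1"
      show "(\<integral>\<^sup>+ t. ennreal (k (z * cnj (cis (- (2 * pi * t)) * w))) \<partial>circ) \<le> ennreal B"
        using mean[OF zw[OF w]] by (simp add: cis_cnj mult_ac)
    qed auto
    also have "(\<integral>\<^sup>+ y. \<phi> y * indicator {0..1} y \<partial>lborel) \<le> (\<integral>\<^sup>+ y. \<phi> y \<partial>lborel)"
      by (intro nn_integral_mono) (auto simp: indicator_def)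
    also have "(\<integral>\<^sup>+ y. \<phi> y \<partial>lborel) = ennreal ((K * \<epsilon>) powr (b + 1) / (b + 1))"
      unfolding \<phi>_def using b K \<epsilon> by (intro nn_integral_powr_from_0) auto
    also have "ennreal B * ennreal ((K * \<epsilon>) powr (b + 1) / (b + 1)) = ennreal (B * K powr (b + 1) / (b + 1)) * ennreal (\<epsilon> powr (b + 1))"
      using K \<epsilon> B b by (simp add: powr_mult ennreal_mult'[symmetric] ennreal_mult''[symmetric])
    also have "ennreal ((K * \<epsilon>) powr b) = ennreal (K powr b) * ennreal (\<epsilon> powr b)"
      using K \<epsilon> by (simp add: powr_mult ennreal_mult')
    finally show ?thesis
      by (simp add: \<epsilon>_def mult.assoc add_mono mult_left_mono)
  qed
  have "kernel_int k b f z = (\<integral>\<^sup>+ w. k0 w * (\<integral>\<^sup>+ t. ind t w * indicator {0<..} t \<partial>lborel) \<partial>dA)"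
    unfolding kernel_int_def ind_def by (intro nn_integral_cong) (simp add: layer_cake k0_def ennreal_mult'')
  also have "\<dots> = (\<integral>\<^sup>+ w. (\<integral>\<^sup>+ t. k0 w * ind t w * indicator {0<..} t \<partial>lborel) \<partial>dA)"
    unfolding mult.assoc ind_def by (intro nn_integral_cong nn_integral_cmult[symmetric]) measurable
  also have "\<dots> = (\<integral>\<^sup>+ t. (\<integral>\<^sup>+ w. k0 w * ind t w * indicator {0<..} t \<partial>dA) \<partial>lborel)"
    by (rule L.Fubini') (simp add: case_prod_beta')
  also have "\<dots> = (\<integral>\<^sup>+ t. (\<integral>\<^sup>+ w. k0 w * ind t w \<partial>dA) * indicator {0<..} t \<partial>lborel)"
    by (intro nn_integral_cong nn_integral_multc) measurable
  also have "\<dots> \<le> (\<integral>\<^sup>+ t. (ennreal (B * K powr (b + 1) / (b + 1)) * ennreal (dist_fun f t powr (b + 1)) +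
      ennreal (K powr b) * (ennreal (dist_fun f t powr b) * (\<integral>\<^sup>+ w. ennreal (k (z * cnj w)) * ind t w \<partial>dA))) * indicator {0<..} t \<partial>lborel)"
    by (intro nn_integral_mono mult_right_mono layer) auto
  also have "\<dots> = (\<integral>\<^sup>+ t. ennreal (B * K powr (b + 1) / (b + 1)) * (ennreal (dist_fun f t powr (b + 1)) * indicator {0<..} t) +
      ennreal (K powr b) * (ennreal (dist_fun f t powr b) * (\<integral>\<^sup>+ w. ennreal (k (z * cnj w)) * ind t w \<partial>dA) * indicator {0<..} t) \<partial>lborel)"
    by (simp add: distrib_right mult.assoc)
  also have "\<dots> = ennreal (B * K powr (b + 1) / (b + 1)) * lorentz (b + 1) f + ennreal (K powr b) * kernel_aux k b f z"
  proof -
    have m: "(\<lambda>t. \<integral>\<^sup>+ w. ennreal (k (z * cnj w)) * ind t w \<partial>dA) \<in> borel_measurable lborel"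
    proof -
      have "(\<lambda>p. ennreal (k (z * cnj (snd p))) * ind (fst p) (snd p)) \<in> borel_measurable (lborel \<Otimes>\<^sub>M dA)"
        by measurable
      from dA.borel_measurable_nn_integral_fst[OF this] show ?thesis by simp
    qed
    have ka: "kernel_aux k b f z = (\<integral>\<^sup>+ t. ennreal (dist_fun f t powr b) *
        (\<integral>\<^sup>+ w. ennreal (k (z * cnj w)) * ind t w \<partial>dA) * indicator {0<..} t \<partial>lborel)"
      by (simp add: kernel_aux_def ind_def)
    have sum: "(\<integral>\<^sup>+ t. c * u t + d * v t \<partial>lborel) = c * (\<integral>\<^sup>+ t. u t \<partial>lborel) + d * (\<integral>\<^sup>+ t. v t \<partial>lborel)"
      if [measurable]: "u \<in> borel_measurable lborel" "v \<in> borel_measurable lborel"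
      for c d and u v :: "real \<Rightarrow> ennreal"
    proof -
      have "(\<integral>\<^sup>+ t. c * u t + d * v t \<partial>lborel) = (\<integral>\<^sup>+ t. c * u t \<partial>lborel) + (\<integral>\<^sup>+ t. d * v t \<partial>lborel)"
        by (rule nn_integral_add) measurable
      then show ?thesis using that by (simp only: nn_integral_cmult)
    qed
    show ?thesis unfolding lorentz_def ka by (rule sum) (use m in measurable)
  qed
  finally show ?thesis .
qed

text \<open>
  The optimal \<open>K\<close> makes the first summand of the bound equal to half of the level \<open>\<Lambda>\<close>.
\<close>

lemma kernel_int_moment:
  assumes k: "k \<in> borel_measurable borel" and f: "f \<in> borel_measurable dA"
    and mean: "\<And>z. norm z < 1 \<Longrightarrow> (\<integral>\<^sup>+ t. ennreal (k (ecis t * z)) \<partial>circ) \<le> ennreal B"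
    and k_nonneg: "\<And>z. norm z < 1 \<Longrightarrow> 0 \<le> k z" and B: "0 < B"
    and b: "- 1 < b" "b < 0" and N: "lorentz (b + 1) f \<le> ennreal N" "0 < N"
  defines "p \<equiv> 1 / (b + 1)"
  obtains J where "J \<in> borel_measurable borel"
    "\<And>z. norm z < 1 \<Longrightarrow> (\<integral>\<^sup>+ t. J (ecis t * z) \<partial>circ) \<le> ennreal (2 * B * (2 * B / (b + 1)) powr (p - 1) * N powr p)"
    "\<And>z \<Lambda>. norm z < 1 \<Longrightarrow> 0 \<le> \<Lambda> \<Longrightarrow> ennreal \<Lambda> \<le> kernel_int k b f z \<Longrightarrow> ennreal (\<Lambda> powr p) \<le> J z"
proof -
  have p: "1 < p" "p * (b + 1) = 1" "p * b = 1 - p"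
    using b by (auto simp: p_def field_simps)
  \<comment> \<open>\<open>E\<close> is the factor of K^b that does not involve \<Lambda>: for the
    optimal K, K^b = \<Lambda>^(1-p) E.\<close>
  define E where "E = (2 * B * N / (b + 1)) powr (p - 1)"
  define J where "J = (\<lambda>z. ennreal (2 * E) * kernel_aux k b f z)"
  have base: "0 < 2 * B * N / (b + 1)" using B N b by simp
  have E: "0 < E" unfolding E_def using base by (simp only: powr_gt_zero)
  have Eeq: "E = (2 * B / (b + 1)) powr (p - 1) * N powr (p - 1)"
    unfolding E_def using B N b by (subst powr_mult[symmetric]) (auto simp: field_simps)
  have ka [measurable]: "kernel_aux k b f \<in> borel_measurable borel"
    by (rule kernel_aux_measurable[OF k f])
  show thesis
  proof (rule that[of J])
    show "J \<in> borel_measurable borel" unfolding J_def by measurable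
  next
    fix z :: complex assume z: "norm z < 1"
    have "(\<integral>\<^sup>+ t. J (ecis t * z) \<partial>circ) = ennreal (2 * E) * (\<integral>\<^sup>+ t. kernel_aux k b f (ecis t * z) \<partial>circ)"
      unfolding J_def cis_conv_exp by (rule nn_integral_cmult) measurable
    also have "\<dots> \<le> ennreal (2 * E) * (ennreal B * lorentz (b + 1) f)"
      by (intro mult_left_mono kernel_aux_mean k f mean z) auto
    also have "\<dots> \<le> ennreal (2 * E) * (ennreal B * ennreal N)"
      using N by (intro mult_left_mono) auto
    also have "\<dots> = ennreal (2 * B * (E * N))"
      using E B N by (simp add: ennreal_mult'[symmetric] mult_ac)
    also have "E * N = (2 * B / (b + 1)) powr (p - 1) * N powr p"
    proof -
      have "N powr p = N powr (p - 1) * N" using N by (simp add: powr_diff)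
      then show ?thesis by (simp add: Eeq)
    qed
    finally show "(\<integral>\<^sup>+ t. J (ecis t * z) \<partial>circ) \<le> ennreal (2 * B * (2 * B / (b + 1)) powr (p - 1) * N powr p)"
      by (simp add: mult.assoc)
  next
    \<comment> \<open>Testing all real \<Lambda> below the kernel integral covers the case where
      that integral is infinite: \<open>J\<close> is then infinite as well, which later gives
      finiteness almost everywhere.\<close>
    fix z :: complex and \<Lambda> :: real
    assume z: "norm z < 1" and L: "0 \<le> \<Lambda>" and le: "ennreal \<Lambda> \<le> kernel_int k b f z"
    show "ennreal (\<Lambda> powr p) \<le> J z"
    proof (cases "\<Lambda> = 0")
      case False
      then have L: "0 < \<Lambda>" using L by simp
      define K where "K = (\<Lambda> / (2 * B * N / (b + 1))) powr p"
      have K: "0 < K" using divide_pos_pos[OF L base] unfolding K_def by (simp only: powr_gt_zero)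
      have K1: "K powr (b + 1) = \<Lambda> * (b + 1) / (2 * B * N)"
        using L B N b unfolding K_def powr_powr p(2) by simp
      have "ennreal \<Lambda> \<le> ennreal (B * K powr (b + 1) / (b + 1)) * lorentz (b + 1) f + ennreal (K powr b) * kernel_aux k b f z"
        by (rule order_trans[OF le]) (intro kernel_int_le k f mean k_nonneg z b K less_imp_le[OF B])
      also have "ennreal (B * K powr (b + 1) / (b + 1)) * lorentz (b + 1) f \<le> ennreal (B * K powr (b + 1) / (b + 1)) * ennreal N"
        using N by (intro mult_left_mono) auto
      also have "\<dots> = ennreal (\<Lambda> / 2)"
      proof -
        have b1: "0 < b + 1" using b by simp
        then have "B * K powr (b + 1) / (b + 1) * N = \<Lambda> / 2" using B N unfolding K1 by simp
        moreover have "0 \<le> B * K powr (b + 1) / (b + 1)" using B b1 by simp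
        ultimately show ?thesis by (metis ennreal_mult')
      qed
      finally have "ennreal (\<Lambda> / 2) + ennreal (\<Lambda> / 2) \<le> ennreal (\<Lambda> / 2) + ennreal (K powr b) * kernel_aux k b f z"
        using L by (simp add: ennreal_plus[symmetric] del: ennreal_plus)
      then have half: "ennreal (\<Lambda> / 2) \<le> ennreal (K powr b) * kernel_aux k b f z"
        by (simp add: ennreal_add_left_cancel_le)
      have Kb: "K powr b = \<Lambda> powr (1 - p) * E"
      proof -
        have "K powr b = (\<Lambda> / (2 * B * N / (b + 1))) powr (1 - p)"
          unfolding K_def powr_powr p(3) ..
        also have "\<dots> = \<Lambda> powr (1 - p) / (2 * B * N / (b + 1)) powr (1 - p)"
          by (rule powr_divide)
        also have "\<dots> = \<Lambda> powr (1 - p) * E"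
          unfolding E_def using powr_minus_divide[of "2 * B * N / (b + 1)" "1 - p"] by simp
        finally show ?thesis .
      qed
      \<comment> \<open>The factor 2 \<Lambda>^(p-1) turns \<Lambda>/2 into \<Lambda>^p and cancels
        the \<Lambda>^(1-p) contained in K^b, so the bound \<open>J\<close> is free of
        \<Lambda>.\<close>
      have "ennreal (\<Lambda> powr p) = ennreal (2 * \<Lambda> powr (p - 1)) * ennreal (\<Lambda> / 2)"
        using L by (subst ennreal_mult'[symmetric]) (auto simp: powr_diff)
      also have "\<dots> \<le> ennreal (2 * \<Lambda> powr (p - 1)) * (ennreal (K powr b) * kernel_aux k b f z)"
        by (intro mult_left_mono half) auto
      also have "\<dots> = ennreal (2 * \<Lambda> powr (p - 1) * K powr b) * kernel_aux k b f z"
        by (subst ennreal_mult'') (auto simp: mult_ac)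
      also have "2 * \<Lambda> powr (p - 1) * K powr b = 2 * E"
      proof -
        have "\<Lambda> powr (p - 1) * \<Lambda> powr (1 - p) = 1"
          using L powr_add[of \<Lambda> "p - 1" "1 - p"] by simp
        then show ?thesis unfolding Kb by simp
      qed
      finally show ?thesis by (simp add: J_def)
    qed simp
  qed
qed

section \<open>From moments on circles to weak type estimates\<close>

text \<open>A bound on all circular means, integrated over the radii, bounds the integral of
  \<open>J\<close> over the disc.\<close>

lemma mean_finite_AE:
  assumes J [measurable]: "J \<in> borel_measurable borel"
    and mean: "\<And>z. norm z < 1 \<Longrightarrow> (\<integral>\<^sup>+ t. J (ecis t * z) \<partial>circ) \<le> ennreal A"
  shows "AE z in dA. J z < \<infinity>"
proof -
  have "(\<integral>\<^sup>+ w. (\<lambda>_. 1) (wt w) * J w \<partial>dA) \<le> ennreal A * (\<integral>\<^sup>+ y. (\<lambda>_. 1) y * indicator {0..1::real} y \<partial>lborel)"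
    by (rule nn_integral_radial_le[where e = ecis]) (auto simp: mean ecis_measurable)
  then have "(\<integral>\<^sup>+ w. J w \<partial>dA) \<le> ennreal A" by simp
  then have "(\<integral>\<^sup>+ w. J w \<partial>dA) \<noteq> \<infinity>" by (auto simp: top_unique)
  then have "AE z in dA. J z \<noteq> \<infinity>"
    by (intro nn_integral_PInf_AE borel_measurable_dA J)
  then show ?thesis by (simp add: less_top)
qed

text \<open>The annulus y <= y0 has area at most y0, which is already the desired bound. Above y0,
  Chebyshev's inequality of order s bounds the indicator by l^(-s) y^(a s) J; the means of J and the
  convergence of the integral of y^(a s) at infinity give another multiple of y0.\<close>

lemma weak_type_distribution:
  assumes a: "a < 0" and s: "0 < s" "a * s < - 1" and N: "0 < N" and C: "0 \<le> C" and l: "0 < l"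
    and J [measurable]: "J \<in> borel_measurable borel"
    and meas: "{z \<in> unit_disc. l < wt z powr a * G z} \<in> sets dA"
    and G: "\<And>z. norm z < 1 \<Longrightarrow> 0 \<le> G z" "\<And>z. norm z < 1 \<Longrightarrow> ennreal (G z powr s) \<le> J z"
    and mean: "\<And>z. norm z < 1 \<Longrightarrow> (\<integral>\<^sup>+ t. J (ecis t * z) \<partial>circ) \<le> ennreal (C * N powr s)"
  shows "measure dA {z \<in> unit_disc. l < wt z powr a * G z} \<le> (1 + C / (- (a * s) - 1)) * (N / l) powr (- 1 / a)"
proof -
  \<comment> \<open>The height at which N y^a equals the level l.\<close>
  define y0 where "y0 = (N / l) powr (- 1 / a)"
  have y0: "0 < y0" using N l by (simp add: y0_def)
  define \<phi> where "\<phi> = (\<lambda>y. ennreal (l powr (- s)) * (ennreal (y powr (a * s)) * indicator {y0..} y))"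
  define \<psi> where "\<psi> = (\<lambda>y. indicator {0..y0} y :: ennreal)"
  have [measurable]: "\<phi> \<in> borel_measurable borel" "\<psi> \<in> borel_measurable borel"
    unfolding \<phi>_def \<psi>_def by measurable
  let ?S = "{z \<in> unit_disc. l < wt z powr a * G z}"
  have "ennreal (measure dA ?S) = (\<integral>\<^sup>+ z. indicator ?S z \<partial>dA)"
    using meas by (simp add: dA.emeasure_eq_measure)
  also have "\<dots> \<le> (\<integral>\<^sup>+ z. \<psi> (wt z) * 1 + \<phi> (wt z) * J z \<partial>dA)"
  proof (rule nn_integral_mono)
    fix z assume "z \<in> space dA"
    then have z: "norm z < 1" by simp
    show "indicator ?S z \<le> \<psi> (wt z) * 1 + \<phi> (wt z) * J z"
    proof (cases "z \<in> ?S \<and> y0 < wt z")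
      case True
      have wz: "0 < wt z" using wt_pos[OF z] .
      have "1 \<le> (wt z powr a * G z / l) powr s"
        using True l s by (intro ge_one_powr_ge_zero) auto
      also have "\<dots> = l powr (- s) * wt z powr (a * s) * G z powr s"
        using G(1)[OF z] l by (simp add: powr_divide powr_mult powr_powr powr_minus_divide)
      finally have "1 \<le> ennreal (l powr (- s) * wt z powr (a * s) * G z powr s)" by simp
      also have "\<dots> = ennreal (l powr (- s) * wt z powr (a * s)) * ennreal (G z powr s)"
        by (rule ennreal_mult') simp
      also have "\<dots> \<le> ennreal (l powr (- s) * wt z powr (a * s)) * J z"
        by (intro mult_left_mono G z) auto
      also have "\<dots> = \<phi> (wt z) * J z"
        using True by (simp add: \<phi>_def ennreal_mult')
      finally show ?thesis using True by (simp add: add_increasing)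
    next
      case False
      then show ?thesis using wt_pos[OF z]
        by (auto simp: \<psi>_def indicator_def not_less add_increasing2)
    qed
  qed
  also have "\<dots> = (\<integral>\<^sup>+ z. \<psi> (wt z) * 1 \<partial>dA) + (\<integral>\<^sup>+ z. \<phi> (wt z) * J z \<partial>dA)"
    by (rule nn_integral_add) (rule borel_measurable_dA, measurable)+
  also have "\<dots> \<le> ennreal y0 + ennreal (C / (- (a * s) - 1) * y0)"
  proof (rule add_mono)
    show "(\<integral>\<^sup>+ z. \<psi> (wt z) * 1 \<partial>dA) \<le> ennreal y0"
    proof -
      have "(\<integral>\<^sup>+ z. \<psi> (wt z) * 1 \<partial>dA) = (\<integral>\<^sup>+ y. \<psi> y * indicator {0..1} y \<partial>lborel)"
        by (simp add: nn_integral_radial)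
      also have "\<dots> \<le> (\<integral>\<^sup>+ y. \<psi> y \<partial>lborel)"
        by (intro nn_integral_mono) (auto simp: indicator_def)
      also have "\<dots> = ennreal y0" using y0 by (simp add: \<psi>_def)
      finally show ?thesis .
    qed
    show "(\<integral>\<^sup>+ z. \<phi> (wt z) * J z \<partial>dA) \<le> ennreal (C / (- (a * s) - 1) * y0)"
    proof -
      have "(\<integral>\<^sup>+ z. \<phi> (wt z) * J z \<partial>dA) \<le> ennreal (C * N powr s) * (\<integral>\<^sup>+ y. \<phi> y * indicator {0..1} y \<partial>lborel)"
        by (rule nn_integral_radial_le[where e = ecis]) (auto simp: mean ecis_measurable)
      also have "\<dots> \<le> ennreal (C * N powr s) * (\<integral>\<^sup>+ y. \<phi> y \<partial>lborel)"
        by (intro mult_left_mono nn_integral_mono) (auto simp: indicator_def)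
      also have "(\<integral>\<^sup>+ y. \<phi> y \<partial>lborel) = ennreal (l powr (- s)) * ennreal (y0 powr (a * s + 1) / (- (a * s) - 1))"
        unfolding \<phi>_def nn_integral_powr_to_inf[OF s(2) y0, symmetric] by (rule nn_integral_cmult) measurable
      also have "ennreal (C * N powr s) * \<dots> = ennreal (C / (- (a * s) - 1) * (N powr s * l powr (- s) * y0 powr (a * s + 1)))"
        using C s by (simp add: ennreal_mult'[symmetric] ennreal_mult''[symmetric] mult_ac)
      also have "N powr s * l powr (- s) * y0 powr (a * s + 1) = y0"
      proof -
        have "N powr s * l powr (- s) = (N / l) powr s"
          using N l by (simp add: powr_divide powr_minus_divide)
        moreover have "y0 powr (a * s + 1) = (N / l) powr (- s + - 1 / a)"
        proof -
          have "- 1 / a * (a * s + 1) = - s + - 1 / a" using a by (simp add: field_simps)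
          then show ?thesis unfolding y0_def powr_powr by simp
        qed
        ultimately show ?thesis
          using N l by (simp add: powr_add[symmetric] y0_def)
      qed
      finally show ?thesis .
    qed
  qed
  also have "ennreal y0 + ennreal (C / (- (a * s) - 1) * y0) = ennreal ((1 + C / (- (a * s) - 1)) * y0)"
    using y0 C s by (subst ennreal_plus[symmetric]) (auto simp: algebra_simps)
  finally show ?thesis
    using y0 C s by (subst (asm) ennreal_le_iff) (auto simp: y0_def intro!: mult_nonneg_nonneg add_nonneg_nonneg)
qed

text \<open>Distribution functions are at most 1, so raising them to a power 1/q above -a only makes
  them smaller; the endpoint estimate thus covers all admissible q.\<close>

lemma weak_norm_le:
  assumes a: "a < 0" and q: "0 < q" "- a \<le> 1 / q" and N: "0 < N" and M: "0 \<le> M"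
    and le: "\<And>l. 0 < l \<Longrightarrow> dist_fun F l \<le> M * (N / l) powr (- 1 / a)"
  shows "weak_norm q F \<le> ennreal (M powr (- a) * N)"
  unfolding weak_norm_def
proof (rule SUP_least)
  fix l :: real assume "l \<in> {0<..}"
  then have l: "0 < l" by simp
  have "dist_fun F l powr (1 / q) \<le> dist_fun F l powr (- a)"
    using q dist_fun_bounds[of F l] by (intro powr_mono') auto
  also have "\<dots> \<le> (M * (N / l) powr (- 1 / a)) powr (- a)"
    using a le[OF l] dist_fun_bounds[of F l] by (intro powr_mono2) auto
  also have "\<dots> = M powr (- a) * (N / l)"
    using M N l a by (simp add: powr_mult powr_powr)
  finally have "l * dist_fun F l powr (1 / q) \<le> l * (M powr (- a) * (N / l))"
    using l by (intro mult_left_mono) auto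
  then show "ennreal (l * dist_fun F l powr (1 / q)) \<le> ennreal (M powr (- a) * N)"
    using l by (intro ennreal_leI) simp
qed

section \<open>Bounds from dominated kernels\<close>

lemma Lp1_norm_lorentz: "Lp1_norm p f = ennreal p * lorentz (1 / p) f"
  by (simp add: Lp1_norm_def lorentz_def)

text \<open>The estimates divide by N and therefore use strict majorants N > 0 of the norm; letting
  N decrease to the norm also settles functions of norm 0.\<close>

lemma maps_boundedly_Lp1I:
  assumes p: "0 < p" and c: "0 < c"
    and main: "\<And>f N. f \<in> borel_measurable dA \<Longrightarrow> lorentz (1 / p) f \<le> ennreal N \<Longrightarrow> 0 < N \<Longrightarrow>
      (AE z in dA. integrable dA (K f z)) \<and> F f \<in> borel_measurable dA \<and> NY (F f) \<le> ennreal (c * N)"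
  shows "maps_boundedly K F (Lp1_norm p) NY"
  unfolding maps_boundedly_def
proof (intro exI[of _ "c / p"] conjI ballI impI)
  show "0 \<le> c / p" using p c by simp
  fix f assume f: "f \<in> borel_measurable dA" and fin: "Lp1_norm p f < \<infinity>"
  then have "lorentz (1 / p) f < \<infinity>"
    using p by (auto simp: Lp1_norm_lorentz ennreal_mult_less_top)
  then obtain r where r: "0 \<le> r" "lorentz (1 / p) f = ennreal r"
    by (cases "lorentz (1 / p) f" rule: ennreal_cases) auto
  have N: "lorentz (1 / p) f \<le> ennreal (r + e)" "0 < r + e" if "0 < e" for e
    using r that by (auto intro: ennreal_leI)
  show "AE z in dA. integrable dA (K f z)" "F f \<in> borel_measurable dA"
    using main[OF f N[OF zero_less_one]] by auto
  have "NY (F f) \<le> ennreal (c * r)"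
  proof (rule ennreal_le_epsilon)
    fix e :: real assume e: "0 < e"
    then have "0 < e / c" using c by simp
    from main[OF f N[OF this]] have "NY (F f) \<le> ennreal (c * (r + e / c))" by simp
    also have "\<dots> = ennreal (c * r) + ennreal e"
      using c r e by (subst ennreal_plus[symmetric]) (auto simp: algebra_simps)
    finally show "NY (F f) \<le> ennreal (c * r) + ennreal e" .
  qed
  also have "ennreal (c * r) = ennreal (c / p) * Lp1_norm p f"
    unfolding Lp1_norm_lorentz r(2) using p c r(1) by (simp add: ennreal_mult'[symmetric])
  finally show "NY (F f) \<le> ennreal (c / p) * Lp1_norm p f" .
qed

lemma maps_boundedly_trans:
  assumes XY: "maps_boundedly K F X Y" and C: "0 \<le> C"
    and le: "\<And>f. f \<in> borel_measurable dA \<Longrightarrow> X f \<le> ennreal C * X' f"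
  shows "maps_boundedly K F X' Y"
proof -
  from XY obtain D where D: "0 \<le> D" and main: "\<And>f. f \<in> borel_measurable dA \<Longrightarrow> X f < \<infinity> \<Longrightarrow>
      (AE z in dA. integrable dA (K f z)) \<and> F f \<in> borel_measurable dA \<and> Y (F f) \<le> ennreal D * X f"
    unfolding maps_boundedly_def by blast
  show ?thesis
    unfolding maps_boundedly_def
  proof (intro exI[of _ "D * C"] conjI ballI impI)
    show "0 \<le> D * C" using D C by simp
    fix f assume f: "f \<in> borel_measurable dA" and fin: "X' f < \<infinity>"
    have "ennreal C * X' f < \<infinity>" using fin by (auto simp: ennreal_mult_less_top)
    then have X: "X f < \<infinity>" by (rule le_less_trans[OF le[OF f]])
    show "AE z in dA. integrable dA (K f z)" "F f \<in> borel_measurable dA"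
      using main[OF f X] by auto
    have "Y (F f) \<le> ennreal D * X f" using main[OF f X] by auto
    also have "\<dots> \<le> ennreal D * (ennreal C * X' f)" by (intro mult_left_mono le f) simp
    finally show "Y (F f) \<le> ennreal (D * C) * X' f" using D C by (simp add: ennreal_mult mult.assoc)
  qed
qed

text \<open>The moment hypothesis concerns a majorant \<open>G\<close>, not \<open>F\<close> itself;
  the constant \<open>D\<close> is absorbed by passing from the level l to l / D.\<close>

lemma weak_norm_of_moment:
  assumes a: "a < 0" and s: "0 < s" "a * s < - 1" and N: "0 < N" and C: "0 \<le> C" and D: "0 < D"
    and q: "0 < q" "- a \<le> 1 / q"
    and J: "J \<in> borel_measurable borel" and Gm [measurable]: "G \<in> borel_measurable dA" and F: "F \<in> borel_measurable dA"
    and G: "\<And>z. norm z < 1 \<Longrightarrow> 0 \<le> G z" "\<And>z. norm z < 1 \<Longrightarrow> ennreal (G z powr s) \<le> J z"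
    and mean: "\<And>z. norm z < 1 \<Longrightarrow> (\<integral>\<^sup>+ t. J (ecis t * z) \<partial>circ) \<le> ennreal (C * N powr s)"
    and FG: "AE z in dA. norm (F z) \<le> D * (wt z powr a * G z)"
  shows "weak_norm q F \<le> ennreal ((1 + C / (- (a * s) - 1)) powr (- a) * D * N)"
proof -
  have meas: "{z \<in> unit_disc. l < wt z powr a * G z} \<in> sets dA" for l
  proof -
    have "{z \<in> space dA. l < wt z powr a * G z} \<in> sets dA" by measurable
    then show ?thesis by simp
  qed
  have "weak_norm q F \<le> ennreal ((1 + C / (- (a * s) - 1)) powr (- a) * (D * N))"
  proof (rule weak_norm_le[OF a q])
    show "0 < D * N" "0 \<le> 1 + C / (- (a * s) - 1)" using D N C s by auto
    fix l :: real assume l: "0 < l"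
    have "dist_fun F l \<le> measure dA {z \<in> unit_disc. l / D < wt z powr a * G z}"
      unfolding dist_fun_def
    proof (rule dA.finite_measure_mono_AE[OF _ meas])
      show "AE z in dA. z \<in> {z \<in> unit_disc. l < norm (F z)} \<longrightarrow> z \<in> {z \<in> unit_disc. l / D < wt z powr a * G z}"
        using FG by eventually_elim (use D in \<open>auto simp: field_simps\<close>)
    qed
    also have "\<dots> \<le> (1 + C / (- (a * s) - 1)) * (N / (l / D)) powr (- 1 / a)"
      using l D by (intro weak_type_distribution[OF a s N C _ J meas G mean]) auto
    also have "N / (l / D) = D * N / l" by simp
    finally show "dist_fun F l \<le> (1 + C / (- (a * s) - 1)) * (D * N / l) powr (- 1 / a)" .
  qed
  then show ?thesis by (simp add: mult.assoc)
qed

section \<open>Measurability of the integrands and operators\<close>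

lemma kernel_int_measurable:
  assumes k: "k \<in> borel_measurable borel" and f [measurable]: "f \<in> borel_measurable dA"
  shows "kernel_int k b f \<in> borel_measurable borel"
proof -
  note [measurable] = measurable_kernel_pair[OF k]
  have "(\<lambda>q. ennreal (k (fst q * cnj (snd q)) * wt (snd q) powr b * norm (f (snd q)))) \<in> borel_measurable (borel \<Otimes>\<^sub>M dA)"
    by measurable
  from dA.borel_measurable_nn_integral_fst[OF this] show ?thesis
    unfolding kernel_int_def by simp
qed

lemma integral_operator_measurable:
  fixes h :: "complex \<Rightarrow> complex"
  assumes h: "h \<in> borel_measurable borel" and f [measurable]: "f \<in> borel_measurable dA"
  shows "(\<lambda>w. of_real (wt w powr b) / h (z * cnj w) * f w) \<in> borel_measurable dA"
    and "(\<lambda>z. of_real (wt z powr a) * (LINT w|dA. of_real (wt w powr b) / h (z * cnj w) * f w)) \<in> borel_measurable dA"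
proof -
  have 1: "(\<lambda>p. h (fst p * cnj (snd p))) \<in> borel_measurable (borel \<Otimes>\<^sub>M borel)"
    using h by measurable
  have 2: "(\<lambda>p. (fst p, snd p)) \<in> measurable (borel \<Otimes>\<^sub>M dA) (borel \<Otimes>\<^sub>M borel)"
    by (intro measurable_Pair measurable_compose[OF measurable_snd id_measurable_dA]) auto
  have h2 [measurable]: "(\<lambda>p. h (fst p * cnj (snd p))) \<in> borel_measurable (borel \<Otimes>\<^sub>M dA)"
    using measurable_compose[OF 2 1] by simp
  have "(\<lambda>w. (z, w)) \<in> measurable dA (borel \<Otimes>\<^sub>M dA)" by (rule measurable_Pair1') simp
  from measurable_compose[OF this h2] have [measurable]: "(\<lambda>w. h (z * cnj w)) \<in> borel_measurable dA" by simp
  show "(\<lambda>w. of_real (wt w powr b) / h (z * cnj w) * f w) \<in> borel_measurable dA"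
    by measurable
  have "(\<lambda>(z, w). of_real (wt w powr b) / h (z * cnj w) * f w) \<in> borel_measurable (borel \<Otimes>\<^sub>M dA)"
    unfolding case_prod_beta' by measurable
  from dA.borel_measurable_lebesgue_integral[OF this]
  have "(\<lambda>z. LINT w|dA. of_real (wt w powr b) / h (z * cnj w) * f w) \<in> borel_measurable borel" .
  then have [measurable]: "(\<lambda>z. LINT w|dA. of_real (wt w powr b) / h (z * cnj w) * f w) \<in> borel_measurable dA"
    by (rule borel_measurable_dA)
  show "(\<lambda>z. of_real (wt z powr a) * (LINT w|dA. of_real (wt w powr b) / h (z * cnj w) * f w)) \<in> borel_measurable dA"
    by measurable
qed

text \<open>The principal power is continuous only off its branch cut, but 1 - \<zeta> stays in the
  right half plane for \<zeta> in the disc. The value 0 outside is arbitrary, since z * cnj w never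
  leaves the disc.\<close>

lemma powr_denominator_measurable:
  "(\<lambda>\<zeta>. if \<zeta> \<in> unit_disc then (1 - \<zeta>) powr complex_of_real c else 0) \<in> borel_measurable borel"
proof (rule borel_measurable_continuous_on_if)
  have "(\<lambda>\<zeta>. (1 - \<zeta>) powr complex_of_real c) holomorphic_on unit_disc"
    using one_minus_disc(2) by (intro holomorphic_intros) (force simp: complex_nonpos_Reals_iff)
  then show "continuous_on unit_disc (\<lambda>\<zeta>. (1 - \<zeta>) powr complex_of_real c)"
    by (rule holomorphic_on_imp_continuous_on)
qed auto

lemma T_S_measurable:
  assumes f: "f \<in> borel_measurable dA"
  shows "norm z < 1 \<Longrightarrow> T_integrand b c f z \<in> borel_measurable dA"
    and "S_integrand b c f z \<in> borel_measurable dA"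
    and "T_op a b c f \<in> borel_measurable dA" and "S_op a b c f \<in> borel_measurable dA"
proof -
  define hT where "hT = (\<lambda>\<zeta>. if \<zeta> \<in> unit_disc then (1 - \<zeta>) powr complex_of_real c else 0)"
  define hS where "hS = (\<lambda>\<zeta>::complex. complex_of_real (norm (1 - \<zeta>) powr c))"
  have hT: "hT \<in> borel_measurable borel" unfolding hT_def by (rule powr_denominator_measurable)
  have hS: "hS \<in> borel_measurable borel" unfolding hS_def by measurable
  have T: "T_integrand b c f z w = of_real (wt w powr b) / hT (z * cnj w) * f w" if "norm z < 1" "norm w < 1" for z w
    using norm_mult_cnj_less_1[OF that] by (simp add: T_integrand_def hT_def)
  have S: "S_integrand b c f z w = of_real (wt w powr b) / hS (z * cnj w) * f w" for z w
    by (simp add: S_integrand_def hS_def)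
  show "norm z < 1 \<Longrightarrow> T_integrand b c f z \<in> borel_measurable dA"
    using integral_operator_measurable(1)[OF hT f, of b z] T by (subst measurable_cong) auto
  show "S_integrand b c f z \<in> borel_measurable dA"
    using integral_operator_measurable(1)[OF hS f, of b z] S by (subst measurable_cong) auto
  have "T_op a b c f z = of_real (wt z powr a) * (LINT w|dA. of_real (wt w powr b) / hT (z * cnj w) * f w)"
    if "z \<in> space dA" for z
    unfolding T_op_def using that T by (intro arg_cong2[where f="(*)"] Bochner_Integration.integral_cong) auto
  then show "T_op a b c f \<in> borel_measurable dA"
    using integral_operator_measurable(2)[OF hT f, of a b] by (subst measurable_cong) auto
  have "S_op a b c f z = of_real (wt z powr a) * (LINT w|dA. of_real (wt w powr b) / hS (z * cnj w) * f w)" for z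
    unfolding S_op_def S ..
  then show "S_op a b c f \<in> borel_measurable dA"
    using integral_operator_measurable(2)[OF hS f, of a b] by (subst measurable_cong) auto
qed

lemma norm_integrands:
  assumes "norm z < 1" "norm w < 1"
  shows "norm (T_integrand b c f z w) = norm (1 - z * cnj w) powr - c * wt w powr b * norm (f w)"
    and "norm (S_integrand b c f z w) = norm (1 - z * cnj w) powr - c * wt w powr b * norm (f w)"
  using one_minus_disc(1)[OF norm_mult_cnj_less_1[OF assms]]
  by (simp_all add: T_integrand_def S_integrand_def norm_mult norm_divide norm_powr_of_real powr_minus_divide)

section \<open>Trading weights against the kernel\<close>

text \<open>Both follow from |1 - z cnj w| >= 1 - |z| |w| >= 1 - |z|, the same with w, and 1 - r^2
  <= 2 (1 - r).\<close>

lemma wt_le_kernel: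
  assumes "norm z < 1" "norm w < 1"
  shows "wt z \<le> 2 * norm (1 - z * cnj w)" "wt w \<le> 2 * norm (1 - z * cnj w)"
proof -
  have *: "1 - norm z * norm w \<le> norm (1 - z * cnj w)"
    using norm_triangle_ineq2[of 1 "z * cnj w"] by (simp add: norm_mult)
  have "norm z * norm w \<le> norm z" "norm z * norm w \<le> norm w"
    using assms by (simp_all add: mult_left_le mult_left_le_one_le)
  moreover have "wt z \<le> 2 * (1 - norm z)" for z :: complex
  proof -
    have "0 \<le> (1 - norm z)\<^sup>2" by simp
    then show ?thesis by (simp add: power2_eq_square algebra_simps)
  qed
  note this[of z] this[of w] *
  ultimately show "wt z \<le> 2 * norm (1 - z * cnj w)" "wt w \<le> 2 * norm (1 - z * cnj w)"
    by (smt (verit))+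
qed

text \<open>For x = 1 - |z|^2, y = 1 - |w|^2, k = |1 - z cnj w| this replaces (a, b, c) by (a - d, b
  - e, c - d - e), using x^d y^e <= (2k)^(d+e). The quantity c - a - b is unchanged, while the
  kernel exponent drops.\<close>

lemma weight_shift:
  fixes x y k d e a b c :: real
  assumes "0 < x" "x \<le> 2 * k" "0 < y" "y \<le> 2 * k" "0 \<le> d" "0 \<le> e"
  shows "x powr a * (k powr - c * y powr b) \<le> 2 powr (d + e) * (x powr (a - d) * (k powr - (c - d - e) * y powr (b - e)))"
proof -
  have k: "0 < k" using assms by linarith
  have "x powr d * y powr e \<le> (2 * k) powr d * (2 * k) powr e"
    using assms by (intro mult_mono powr_mono2) auto
  also have "\<dots> = 2 powr (d + e) * k powr (d + e)"
    using k by (simp add: powr_mult powr_add)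
  finally have *: "x powr d * y powr e \<le> 2 powr (d + e) * k powr (d + e)" .
  have "x powr a * (k powr - c * y powr b) = (x powr d * y powr e) * (x powr (a - d) * (k powr - c * y powr (b - e)))"
    using assms by (simp add: powr_diff)
  also have "\<dots> \<le> (2 powr (d + e) * k powr (d + e)) * (x powr (a - d) * (k powr - c * y powr (b - e)))"
    by (intro mult_right_mono *) auto
  also have "\<dots> = 2 powr (d + e) * (x powr (a - d) * ((k powr (d + e) * k powr - c) * y powr (b - e)))"
    by (simp add: mult_ac)
  also have "k powr (d + e) * k powr - c = k powr - (c - d - e)"
    by (simp add: powr_add[symmetric] algebra_simps)
  finally show ?thesis .
qed

lemma integrable_mult_cancel_left:
  fixes f :: "'a \<Rightarrow> complex"
  assumes "c \<noteq> 0" "integrable M (\<lambda>x. c * f x)"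
  shows "integrable M f"
proof -
  have "integrable M (\<lambda>x. inverse c * (c * f x))"
    by (intro integrable_mult_right impI assms(2))
  moreover have "(\<lambda>x. inverse c * (c * f x)) = f"
    using assms(1) by (simp add: fun_eq_iff)
  ultimately show ?thesis by simp
qed

text \<open>Only the modulus of the integrand enters, so one argument serves both operators. Here
  \<open>a\<close>, \<open>b\<close>, \<open>c\<close> are the exponents of the dominating kernel
  and \<open>a0\<close> is the outer exponent of the operator.\<close>

lemma maps_boundedly_dominated:
  fixes K :: "(complex \<Rightarrow> complex) \<Rightarrow> complex \<Rightarrow> complex \<Rightarrow> complex"
  assumes b: "- 1 < b" "b < 0" and c: "0 < c" "c < 1" and a: "a < - (b + 1)"
    and q: "0 < q" "- a \<le> 1 / q" and D: "0 < D"
    and Km: "\<And>f z. f \<in> borel_measurable dA \<Longrightarrow> norm z < 1 \<Longrightarrow> K f z \<in> borel_measurable dA"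
    and Fm: "\<And>f. f \<in> borel_measurable dA \<Longrightarrow> F f \<in> borel_measurable dA"
    and F: "\<And>f z. F f z = of_real (wt z powr a0) * (LINT w|dA. K f z w)"
    and le: "\<And>f z w. norm z < 1 \<Longrightarrow> norm w < 1 \<Longrightarrow>
      wt z powr a0 * norm (K f z w) \<le> D * (wt z powr a * (norm (1 - z * cnj w) powr - c * wt w powr b * norm (f w)))"
  shows "maps_boundedly K F (Lp1_norm (1 / (b + 1))) (weak_norm q)"
proof -
  define k where "k = (\<lambda>\<zeta>::complex. norm (1 - \<zeta>) powr - c)"
  define B where "B = 1 / cos (c * pi / 2)"
  define p where "p = 1 / (b + 1)"
  define C where "C = 2 * B * (2 * B / (b + 1)) powr (p - 1)"
  have B: "0 < B" using cos_mult_half_pi_pos[OF c] by (simp add: B_def)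
  have C: "0 \<le> C" using B by (simp add: C_def)
  have p: "0 < p" "1 / p = b + 1" using b by (auto simp: p_def)
  have a0: "a < 0" using a b by simp
  have ap: "a * p < - 1" using a b by (simp add: p_def field_simps)
  have k: "k \<in> borel_measurable borel" unfolding k_def by measurable
  have mean: "(\<integral>\<^sup>+ t. ennreal (k (ecis t * z)) \<partial>circ) \<le> ennreal B" if "norm z < 1" for z
    unfolding k_def B_def by (rule circ_mean_powr_kernel[OF that c])
  have k0: "0 \<le> k \<zeta>" for \<zeta> by (simp add: k_def)
  define c0 where "c0 = (1 + C / (- (a * p) - 1)) powr (- a) * D"
  have c0: "0 < c0"
  proof -
    have "0 \<le> C / (- (a * p) - 1)" using C ap by (intro divide_nonneg_pos) auto
    then have "0 < (1 + C / (- (a * p) - 1)) powr (- a)" unfolding powr_gt_zero by linarith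
    then show ?thesis unfolding c0_def using D by (rule mult_pos_pos)
  qed
  show ?thesis
    unfolding p_def[symmetric]
  proof (rule maps_boundedly_Lp1I[OF p(1) c0], unfold p(2))
    fix f N assume f: "f \<in> borel_measurable dA" and N: "lorentz (b + 1) f \<le> ennreal N" "0 < N"
    obtain J where J: "J \<in> borel_measurable borel"
      "\<And>z. norm z < 1 \<Longrightarrow> (\<integral>\<^sup>+ t. J (ecis t * z) \<partial>circ) \<le> ennreal (C * N powr p)"
      "\<And>z \<Lambda>. norm z < 1 \<Longrightarrow> 0 \<le> \<Lambda> \<Longrightarrow> ennreal \<Lambda> \<le> kernel_int k b f z \<Longrightarrow> ennreal (\<Lambda> powr p) \<le> J z"
      using kernel_int_moment[OF k f mean k0 B b N] unfolding C_def p_def by metis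
    define G where "G = (\<lambda>z. enn2real (kernel_int k b f z))"
    have "AE z in dA. J z < \<infinity>" by (rule mean_finite_AE[OF J(1) J(2)])
    then have ki_fin: "AE z in dA. kernel_int k b f z < \<infinity>"
      using AE_space
    proof eventually_elim
      fix z assume Jz: "J z < \<infinity>" and "z \<in> space dA"
      then have z: "norm z < 1" by simp
      show "kernel_int k b f z < \<infinity>"
      proof (rule ccontr)
        assume "\<not> kernel_int k b f z < \<infinity>"
        then have top: "kernel_int k b f z = \<infinity>" by (simp add: less_top[symmetric])
        obtain r where r: "0 \<le> r" "J z = ennreal r" using Jz by (cases "J z" rule: ennreal_cases) auto
        \<comment> \<open>A test value whose p-th power exceeds the finite number J z by 1.\<close>
        have "ennreal (((r + 1) powr (1 / p)) powr p) \<le> J z"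
          by (rule J(3)[OF z]) (simp_all add: top)
        moreover have "((r + 1) powr (1 / p)) powr p = r + 1" using p(1) r(1) by (simp add: powr_powr)
        ultimately show False using r by simp
      qed
    qed
    have bound: "(\<integral>\<^sup>+ w. ennreal (wt z powr a0 * norm (K f z w)) \<partial>dA) \<le> ennreal (D * wt z powr a) * kernel_int k b f z"
      if z: "norm z < 1" for z
    proof -
      have "(\<integral>\<^sup>+ w. ennreal (wt z powr a0 * norm (K f z w)) \<partial>dA) \<le>
          (\<integral>\<^sup>+ w. ennreal (D * wt z powr a) * ennreal (k (z * cnj w) * wt w powr b * norm (f w)) \<partial>dA)"
        using le[OF z, of _ f] D
        by (intro nn_integral_mono) (auto simp: ennreal_mult'[symmetric] k_def mult.assoc intro!: ennreal_leI)
      also have "\<dots> = ennreal (D * wt z powr a) * kernel_int k b f z"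
        unfolding kernel_int_def
      proof (rule nn_integral_cmult)
        note [measurable] = f measurable_kernel_dA[OF k]
        show "(\<lambda>w. ennreal (k (z * cnj w) * wt w powr b * norm (f w))) \<in> borel_measurable dA" by measurable
      qed
      finally show ?thesis .
    qed
    have good: "AE z in dA. integrable dA (K f z) \<and> norm (F f z) \<le> D * (wt z powr a * G z)"
      using ki_fin AE_space
    proof eventually_elim
      fix z assume fin: "kernel_int k b f z < \<infinity>" and "z \<in> space dA"
      then have z: "norm z < 1" by simp
      have wz: "0 < wt z powr a0" using wt_pos[OF z] by simp
      have ki: "kernel_int k b f z = ennreal (G z)" using fin by (simp add: G_def)
      have le': "(\<integral>\<^sup>+ w. ennreal (wt z powr a0 * norm (K f z w)) \<partial>dA) \<le> ennreal (D * wt z powr a * G z)"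
        using bound[OF z] D by (simp add: ki ennreal_mult'[symmetric])
      \<comment> \<open>The domination hypothesis bounds only the product with the outer weight, so
        that weight stays inside until integrability is known; being nonzero, it then
        cancels.\<close>
      have i: "integrable dA (\<lambda>w. of_real (wt z powr a0) * K f z w)"
      proof (rule integrableI_bounded)
        show "(\<lambda>w. of_real (wt z powr a0) * K f z w) \<in> borel_measurable dA" using Km[OF f z] by measurable
        show "(\<integral>\<^sup>+ w. ennreal (norm (of_real (wt z powr a0) * K f z w)) \<partial>dA) < \<infinity>"
          using le_less_trans[OF le' ennreal_less_top] by (simp add: norm_mult)
      qed
      have "complex_of_real (wt z powr a0) \<noteq> 0" using wz unfolding of_real_eq_0_iff by linarith
      from integrable_mult_cancel_left[OF this i] have "integrable dA (K f z)" .
      moreover have "norm (F f z) \<le> D * (wt z powr a * G z)"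
      proof -
        have "norm (F f z) = norm (LINT w|dA. of_real (wt z powr a0) * K f z w)"
          by (simp add: F)
        then have "ennreal (norm (F f z)) \<le> (\<integral>\<^sup>+ w. ennreal (norm (of_real (wt z powr a0) * K f z w)) \<partial>dA)"
          using integral_norm_bound_ennreal[OF i] by simp
        also have "\<dots> \<le> ennreal (D * wt z powr a * G z)" using le' by (simp add: norm_mult)
        finally show ?thesis using D by (subst (asm) ennreal_le_iff) (auto simp: G_def mult.assoc)
      qed
      ultimately show "integrable dA (K f z) \<and> norm (F f z) \<le> D * (wt z powr a * G z)" ..
    qed
    have "weak_norm q (F f) \<le> ennreal (c0 * N)"
      unfolding c0_def
    proof (rule weak_norm_of_moment[OF a0 p(1) ap N(2) C D q J(1) _ Fm[OF f]])
      show "G \<in> borel_measurable dA" unfolding G_def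
        using borel_measurable_dA[OF kernel_int_measurable[OF k f, of b]] by measurable
      fix z :: complex assume z: "norm z < 1"
      show "0 \<le> G z" by (simp add: G_def)
      \<comment> \<open>Where the kernel integral is infinite, \<open>enn2real\<close> makes G z
        equal to 0, which is still a legitimate test value.\<close>
      show "ennreal (G z powr p) \<le> J z"
        by (rule J(3)[OF z]) (auto simp: G_def ennreal_enn2real_if)
      show "(\<integral>\<^sup>+ t. J (ecis t * z) \<partial>circ) \<le> ennreal (C * N powr p)" by (rule J(2)[OF z])
    next
      show "AE z in dA. norm (F f z) \<le> D * (wt z powr a * G z)" using good by eventually_elim auto
    qed
    moreover have "AE z in dA. integrable dA (K f z)" using good by eventually_elim auto
    ultimately show "(AE z in dA. integrable dA (K f z)) \<and> F f \<in> borel_measurable dA \<and> weak_norm q (F f) \<le> ennreal (c0 * N)"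
      using Fm[OF f] by blast
  qed
qed

text \<open>The shift \<open>d\<close> is taken from the weight in z and costs target exponent (1/q
  >= d - a); the shift \<open>e\<close> is taken from the weight in w and costs source exponent (1 /
  (b - e + 1) instead of 1 / (b + 1)).\<close>

lemma T_S_bounded_Lp1:
  assumes d: "0 \<le> d" "0 \<le> e" and b: "- 1 < b - e" "b - e < 0" and c: "0 < c - d - e" "c - d - e < 1"
    and a: "a - d < - (b - e + 1)" and q: "0 < q" "- (a - d) \<le> 1 / q"
  shows "T_bounded a b c (Lp1_norm (1 / (b - e + 1))) (weak_norm q)"
    and "S_bounded a b c (Lp1_norm (1 / (b - e + 1))) (weak_norm q)"
proof -
  have le: "wt z powr a * (norm (1 - z * cnj w) powr - c * wt w powr b * norm (f w)) \<le>
      2 powr (d + e) * (wt z powr (a - d) * (norm (1 - z * cnj w) powr - (c - d - e) * wt w powr (b - e) * norm (f w)))"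
    if z: "norm z < 1" and w: "norm w < 1" for z w and f :: "complex \<Rightarrow> complex"
    using mult_right_mono[OF weight_shift[OF wt_pos[OF z] wt_le_kernel(1)[OF z w] wt_pos[OF w] wt_le_kernel(2)[OF z w] d, of a c b] norm_ge_zero[of "f w"]]
    by (simp add: mult.assoc)
  have D: "0 < (2::real) powr (d + e)" by simp
  show "T_bounded a b c (Lp1_norm (1 / (b - e + 1))) (weak_norm q)"
  proof (rule maps_boundedly_dominated[OF b c a q D])
    show "T_op a b c f z = of_real (wt z powr a) * (LINT w|dA. T_integrand b c f z w)" for f z
      by (simp add: T_op_def)
  qed (auto simp only: norm_integrands le intro: T_S_measurable)
  show "S_bounded a b c (Lp1_norm (1 / (b - e + 1))) (weak_norm q)"
  proof (rule maps_boundedly_dominated[OF b c a q D])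
    show "S_op a b c f z = of_real (wt z powr a) * (LINT w|dA. S_integrand b c f z w)" for f z
      by (simp add: S_op_def)
  qed (auto simp only: norm_integrands le intro: T_S_measurable)
qed

section \<open>The Cauchy transform on Lorentz spaces\<close>

text \<open>Expanding 1 / (1 - z cnj w) geometrically exhibits F as the power series whose
  coefficients are the integrals of \<nu> cnj w^n; sum and integral commute because the terms are
  bounded in L^1 by |z|^n times the norm of \<nu>.\<close>

lemma cauchy_transform:
  fixes \<nu> :: "complex \<Rightarrow> complex"
  assumes \<nu>: "integrable dA \<nu>"
  defines "F \<equiv> \<lambda>z. LINT w|dA. \<nu> w / (1 - z * cnj w)"
  shows "norm z < 1 \<Longrightarrow> integrable dA (\<lambda>w. \<nu> w / (1 - z * cnj w))"
    and "F holomorphic_on unit_disc"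
proof -
  have [measurable]: "\<nu> \<in> borel_measurable dA" using \<nu> by (rule borel_measurable_integrable)
  have cnj [measurable]: "cnj \<in> borel_measurable dA"
    by (intro borel_measurable_dA borel_measurable_continuous_onI continuous_intros)
  have norm_cnj_power: "norm (\<nu> w * cnj w ^ n) \<le> norm (\<nu> w)" if "w \<in> space dA" for w n
    using that by (simp add: norm_mult norm_power mult_left_le power_le_one)
  have c: "integrable dA (\<lambda>w. \<nu> w * cnj w ^ n)" for n
    by (rule Bochner_Integration.integrable_bound[OF \<nu>]) (use norm_cnj_power in auto)
  have summand: "integrable dA (\<lambda>w. \<nu> w * cnj w ^ n * z ^ n)" for z n
    by (rule integrable_mult_left) (rule c)
  have geo: "(\<lambda>n. \<nu> w * cnj w ^ n * z ^ n) sums (\<nu> w / (1 - z * cnj w))" if "norm z < 1" "norm w < 1" for z w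
  proof -
    have "(\<lambda>n. \<nu> w * (z * cnj w) ^ n) sums (\<nu> w * (1 / (1 - z * cnj w)))"
      by (intro sums_mult geometric_sums norm_mult_cnj_less_1 that)
    then show ?thesis by (simp add: power_mult_distrib mult_ac)
  qed
  have summ1: "AE w in dA. summable (\<lambda>n. norm (\<nu> w * cnj w ^ n * z ^ n))" if z: "norm z < 1" for z
  proof (rule AE_I2)
    fix w assume "w \<in> space dA"
    then have "norm w < 1" by simp
    from norm_mult_cnj_less_1[OF z this] have "summable (\<lambda>n. norm (\<nu> w) * norm (z * cnj w) ^ n)"
      by (intro summable_mult summable_geometric) (simp only: real_norm_def abs_norm_cancel)
    then show "summable (\<lambda>n. norm (\<nu> w * cnj w ^ n * z ^ n))"
      by (simp add: norm_mult norm_power power_mult_distrib mult_ac)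
  qed
  have summ2: "summable (\<lambda>n. LINT w|dA. norm (\<nu> w * cnj w ^ n * z ^ n))" if z: "norm z < 1" for z
  proof (rule summable_comparison_test)
    show "summable (\<lambda>n. (LINT w|dA. norm (\<nu> w)) * norm z ^ n)"
      using z by (intro summable_mult summable_geometric) auto
    have "(LINT w|dA. norm (\<nu> w * cnj w ^ n * z ^ n)) \<le> (LINT w|dA. norm (\<nu> w) * norm z ^ n)" for n
    proof (rule integral_mono)
      show "integrable dA (\<lambda>w. norm (\<nu> w * cnj w ^ n * z ^ n))" by (rule integrable_norm[OF summand])
      show "integrable dA (\<lambda>w. norm (\<nu> w) * norm z ^ n)" by (intro integrable_mult_left integrable_norm \<nu>)
      fix w assume "w \<in> space dA"
      then show "norm (\<nu> w * cnj w ^ n * z ^ n) \<le> norm (\<nu> w) * norm z ^ n"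
        using norm_cnj_power[of w n] by (simp add: norm_mult[of _ "z ^ n"] norm_power[of z] mult_right_mono)
    qed
    then show "\<exists>N. \<forall>n\<ge>N. norm (LINT w|dA. norm (\<nu> w * cnj w ^ n * z ^ n)) \<le> (LINT w|dA. norm (\<nu> w)) * norm z ^ n"
      by (simp add: integral_nonneg_AE)
  qed
  have sum_eq: "(\<Sum>n. \<nu> w * cnj w ^ n * z ^ n) = \<nu> w / (1 - z * cnj w)" if "norm z < 1" "w \<in> space dA" for z w
    using geo[of z w] that by (simp add: sums_iff)
  show "integrable dA (\<lambda>w. \<nu> w / (1 - z * cnj w))" if z: "norm z < 1" for z
  proof -
    have "integrable dA (\<lambda>w. \<Sum>n. \<nu> w * cnj w ^ n * z ^ n) \<longleftrightarrow> integrable dA (\<lambda>w. \<nu> w / (1 - z * cnj w))"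
      by (rule Bochner_Integration.integrable_cong[OF refl sum_eq[OF z]])
    then show ?thesis using integrable_suminf[OF summand summ1[OF z] summ2[OF z]] by blast
  qed
  show "F holomorphic_on unit_disc"
  proof (rule power_series_holomorphic)
    fix z assume "z \<in> unit_disc"
    then have z: "norm z < 1" by simp
    have "(\<lambda>n. LINT w|dA. \<nu> w * cnj w ^ n * z ^ n) sums (LINT w|dA. (\<Sum>n. \<nu> w * cnj w ^ n * z ^ n))"
      by (rule sums_integral[OF summand summ1[OF z] summ2[OF z]])
    also have "(LINT w|dA. (\<Sum>n. \<nu> w * cnj w ^ n * z ^ n)) = F z"
      unfolding F_def by (rule Bochner_Integration.integral_cong[OF refl sum_eq[OF z]])
    finally show "(\<lambda>n. (LINT w|dA. \<nu> w * cnj w ^ n) * (z - 0) ^ n) sums F z"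
      by simp
  qed
qed

text \<open>Lowers the exponent from p to s without losing homogeneity. It is applied with x = Re F
  and y = N, where the p-th moment of x is at most a multiple of N^p.\<close>

lemma powr_add_le:
  fixes x y s p :: real
  assumes "0 \<le> x" "0 < y" "0 < s" "s \<le> p"
  shows "(x + y) powr s \<le> y powr s * 2 powr p * (1 + y powr - p * x powr p)"
proof -
  define r where "r = x / y"
  have r: "0 \<le> r" "x + y = y * (1 + r)" using assms by (auto simp: r_def field_simps)
  have "(1 + r) powr s \<le> (1 + r) powr p" using r assms by (intro powr_mono) auto
  also have "\<dots> \<le> (2 * max 1 r) powr p" using r assms by (intro powr_mono2) auto
  also have "\<dots> = 2 powr p * max 1 r powr p" using r by (simp add: powr_mult)
  also have "max 1 r powr p \<le> 1 + r powr p" by (auto simp: max_def)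
  finally have "(1 + r) powr s \<le> 2 powr p * (1 + r powr p)" by simp
  then have "y powr s * (1 + r) powr s \<le> y powr s * (2 powr p * (1 + r powr p))"
    by (intro mult_left_mono) auto
  also have "r powr p = y powr - p * x powr p"
    using assms by (simp add: r_def powr_divide powr_minus_divide)
  finally show ?thesis using r assms by (simp add: powr_mult mult.assoc)
qed

text \<open>For g >= 0 the real part of F is a kernel integral with the Poisson-type kernel Re (1 /
  (1 - \<zeta>)), whose means are 1, so its p-th moments are known. The s-th power of the modulus is
  then compared with that of the real part plus the harmonic function Re (F + N)^s, whose mean is
  its value at the centre.\<close>

lemma cauchy_transform_moment:
  fixes b s :: real
  assumes b: "- 1 < b" "b < 0" and s: "0 < s" "s \<le> 1 / (b + 1)" "cos (s * pi / 2) \<noteq> 0"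
  obtains C where "0 \<le> C"
    "\<And>g N z. g \<in> borel_measurable dA \<Longrightarrow> (\<And>w. 0 \<le> g w) \<Longrightarrow> lorentz (b + 1) (\<lambda>w. complex_of_real (g w)) \<le> ennreal N \<Longrightarrow> 0 < N \<Longrightarrow> norm z < 1 \<Longrightarrow>
      integrable dA (\<lambda>w. complex_of_real (wt w powr b * g w) / (1 - z * cnj w)) \<and>
      (\<integral>\<^sup>+ t. ennreal (norm (LINT w|dA. complex_of_real (wt w powr b * g w) / (1 - ecis t * z * cnj w)) powr s) \<partial>circ) \<le> ennreal (C * N powr s)"
proof -
  define p where "p = 1 / (b + 1)"
  have p: "0 < p" "s \<le> p" using b s by (auto simp: p_def)
  define C0 where "C0 = 2 * 1 * (2 * 1 / (b + 1)) powr (p - 1)"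
  have C0: "0 \<le> C0" by (simp add: C0_def)
  define C1 where "C1 = 2 powr p * (1 + C0)"
  have C1: "0 \<le> C1" using C0 by (simp add: C1_def)
  \<comment> \<open>The mass of \<nu> is at most (1 / (b + 1) + 1) N; one more N comes from the
    shift \<open>F1\<close>. So c2 N bounds |F1 0|.\<close>
  define c2 where "c2 = 1 / (b + 1) + 2"
  have c2: "0 < c2" using b by (simp add: c2_def add_pos_pos)
  obtain A B where A: "0 \<le> A" and AB: "\<And>z. 0 < Re z \<Longrightarrow> norm z powr s \<le> A * Re z powr s + B * Re (z powr complex_of_real s)"
    using norm_powr_le_Re[OF s(1,3)] by metis
  define C where "C = A * C1 + \<bar>B\<bar> * c2 powr s"
  show thesis
  proof (rule that[of C])
    show "0 \<le> C" using A C1 by (simp add: C_def)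
    fix g :: "complex \<Rightarrow> real" and N :: real and z :: complex
    assume g [measurable]: "g \<in> borel_measurable dA" and g0: "\<And>w. 0 \<le> g w"
      and N: "lorentz (b + 1) (\<lambda>w. complex_of_real (g w)) \<le> ennreal N" "0 < N" and z: "norm z < 1"
    define f where "f = (\<lambda>w. complex_of_real (g w))"
    have f [measurable]: "f \<in> borel_measurable dA" unfolding f_def by measurable
    define \<nu> where "\<nu> = (\<lambda>w. complex_of_real (wt w powr b * g w))"
    have \<nu>m [measurable]: "\<nu> \<in> borel_measurable dA" unfolding \<nu>_def by measurable
    \<comment> \<open>The general layer estimate for the constant kernel 1 at z = 0 with K = 1.
      Rotations fix the centre, so there \<open>kernel_aux\<close> equals its own circular
      mean.\<close>
    have mass: "(\<integral>\<^sup>+ w. ennreal (wt w powr b * g w) \<partial>dA) \<le> ennreal ((c2 - 1) * N)"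
    proof -
      let ?k = "\<lambda>_::complex. 1::real"
      have k1: "(\<integral>\<^sup>+ t. ennreal (?k (ecis t * z)) \<partial>circ) \<le> ennreal 1" for z
        by (simp add: circ.emeasure_space_1[simplified])
      have "kernel_aux ?k b f 0 = (\<integral>\<^sup>+ \<theta>. kernel_aux ?k b f (ecis \<theta> * 0) \<partial>circ)"
        by (simp add: circ.emeasure_space_1[simplified])
      also have "\<dots> \<le> ennreal 1 * lorentz (b + 1) f"
        by (rule kernel_aux_mean[OF _ f k1]) auto
      finally have aux: "kernel_aux ?k b f 0 \<le> ennreal N" using N by (simp add: f_def)
      have "kernel_int ?k b f 0 \<le> ennreal (1 * 1 powr (b + 1) / (b + 1)) * lorentz (b + 1) f + ennreal (1 powr b) * kernel_aux ?k b f 0"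
        by (rule kernel_int_le[OF _ f k1]) (use b in auto)
      also have "\<dots> \<le> ennreal (1 / (b + 1)) * ennreal N + ennreal N"
        using aux N by (intro add_mono) (auto simp: f_def intro!: mult_left_mono)
      also have "\<dots> = ennreal ((c2 - 1) * N)"
        using b N by (simp add: ennreal_mult'[symmetric] ennreal_plus[symmetric] c2_def algebra_simps del: ennreal_plus)
      finally show ?thesis using g0 by (simp add: kernel_int_def f_def)
    qed
    have \<nu>: "integrable dA \<nu>"
    proof (rule integrableI_bounded)
      show "(\<integral>\<^sup>+ w. ennreal (norm (\<nu> w)) \<partial>dA) < \<infinity>"
        using le_less_trans[OF mass ennreal_less_top] g0 by (simp add: \<nu>_def norm_mult)
    qed measurable
    define F where "F = (\<lambda>z. LINT w|dA. \<nu> w / (1 - z * cnj w))"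
    have int: "integrable dA (\<lambda>w. \<nu> w / (1 - z * cnj w))" if "norm z < 1" for z
      by (rule cauchy_transform(1)[OF \<nu> that])
    have hol: "F holomorphic_on unit_disc" unfolding F_def by (rule cauchy_transform(2)[OF \<nu>])
    define k where "k = (\<lambda>\<zeta>::complex. Re (1 / (1 - \<zeta>)))"
    have k: "k \<in> borel_measurable borel" unfolding k_def by measurable
    have k0: "0 \<le> k \<zeta>" if "norm \<zeta> < 1" for \<zeta> using one_minus_disc(3)[OF that] by (simp add: k_def)
    have mean: "(\<integral>\<^sup>+ t. ennreal (k (ecis t * z)) \<partial>circ) \<le> ennreal 1" if "norm z < 1" for z
      unfolding k_def using circ_mean_Cauchy_kernel[OF that] by simp
    have Re_F: "ennreal (Re (F z)) = kernel_int k b f z" "0 \<le> Re (F z)" if z: "norm z < 1" for z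
    proof -
      have re: "Re (\<nu> w / (1 - z * cnj w)) = k (z * cnj w) * wt w powr b * norm (f w)" for w
      proof -
        have "\<nu> w / (1 - z * cnj w) = of_real (wt w powr b * g w) * (1 / (1 - z * cnj w))"
          by (simp add: \<nu>_def)
        moreover have "Re (complex_of_real x * v) = x * Re v" for x v by simp
        ultimately have "Re (\<nu> w / (1 - z * cnj w)) = wt w powr b * g w * k (z * cnj w)" by (simp only: k_def)
        then show ?thesis using g0[of w] by (simp add: f_def mult_ac)
      qed
      have nn: "0 \<le> Re (\<nu> w / (1 - z * cnj w))" if "w \<in> space dA" for w
        unfolding re using k0[OF norm_mult_cnj_less_1[OF z, of w]] that by simp
      have eq: "Re (F z) = (LINT w|dA. Re (\<nu> w / (1 - z * cnj w)))"
        unfolding F_def by (rule integral_Re[symmetric]) (rule int[OF z])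
      show "0 \<le> Re (F z)" unfolding eq by (rule integral_nonneg_AE) (use nn in auto)
      have "ennreal (Re (F z)) = (\<integral>\<^sup>+ w. ennreal (Re (\<nu> w / (1 - z * cnj w))) \<partial>dA)"
        unfolding eq using nn by (intro nn_integral_eq_integral[symmetric] integrable_Re int z) auto
      then show "ennreal (Re (F z)) = kernel_int k b f z" by (simp only: re kernel_int_def)
    qed
    obtain J where J: "J \<in> borel_measurable borel"
      "\<And>z. norm z < 1 \<Longrightarrow> (\<integral>\<^sup>+ t. J (ecis t * z) \<partial>circ) \<le> ennreal (C0 * N powr p)"
      "\<And>z \<Lambda>. norm z < 1 \<Longrightarrow> 0 \<le> \<Lambda> \<Longrightarrow> ennreal \<Lambda> \<le> kernel_int k b f z \<Longrightarrow> ennreal (\<Lambda> powr p) \<le> J z"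
      using kernel_int_moment[OF k f mean k0 zero_less_one b N[folded f_def]] unfolding C0_def p_def by metis
    \<comment> \<open>Adding N makes the real part strictly positive even when g vanishes almost
      everywhere, so the principal power is holomorphic; the shift only increases the modulus, and
      F1 0 stays comparable to N.\<close>
    define F1 where "F1 = (\<lambda>z. F z + of_real N)"
    have hol1: "F1 holomorphic_on unit_disc" unfolding F1_def by (intro holomorphic_intros hol)
    have Re1: "0 < Re (F1 z)" if "norm z < 1" for z using Re_F(2)[OF that] N by (simp add: F1_def)
    have hols: "(\<lambda>z. F1 z powr complex_of_real s) holomorphic_on unit_disc"
      using Re1 by (intro holomorphic_intros hol1) (force simp: complex_nonpos_Reals_iff)
    let ?z = "\<lambda>t. ecis t * z"
    have nz: "norm (?z t) < 1" for t using z by (simp add: norm_mult)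
    have contF: "continuous_on UNIV (\<lambda>t. F1 (?z t))"
      by (rule continuous_on_ecis_mult[OF holomorphic_on_imp_continuous_on[OF hol1] z])
    define Y where "Y = (\<lambda>t. Re (F1 (?z t)) powr s)"
    have Ym [measurable]: "Y \<in> borel_measurable circ"
    proof -
      have "(\<lambda>t. Re (F1 (?z t))) \<in> borel_measurable borel"
        by (intro borel_measurable_continuous_onI continuous_intros contF)
      then have "Y \<in> borel_measurable borel" unfolding Y_def by measurable
      then show ?thesis by simp
    qed
    have Yint: "(\<integral>\<^sup>+ t. ennreal (Y t) \<partial>circ) \<le> ennreal (C1 * N powr s)"
    proof -
      have [measurable]: "(\<lambda>t. J (?z t)) \<in> borel_measurable circ"
        using measurable_compose[OF _ J(1), of "?z" borel] ecis_measurable by simp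
      have "(\<integral>\<^sup>+ t. ennreal (Y t) \<partial>circ) \<le> (\<integral>\<^sup>+ t. ennreal (N powr s * 2 powr p) * (1 + ennreal (N powr - p) * J (?z t)) \<partial>circ)"
      proof (rule nn_integral_mono)
        fix t
        have u: "0 \<le> Re (F (?z t))" by (rule Re_F(2)[OF nz])
        have Ju: "ennreal (Re (F (?z t)) powr p) \<le> J (?z t)"
          by (rule J(3)[OF nz u]) (simp add: Re_F(1)[OF nz])
        have "ennreal (Y t) \<le> ennreal (N powr s * 2 powr p * (1 + N powr - p * Re (F (?z t)) powr p))"
          unfolding Y_def F1_def using powr_add_le[OF u N(2) s(1) p(2)] by (intro ennreal_leI) simp
        also have "\<dots> = ennreal (N powr s * 2 powr p) * (1 + ennreal (N powr - p) * ennreal (Re (F (?z t)) powr p))"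
          by (simp add: ennreal_mult' ennreal_plus)
        also have "\<dots> \<le> ennreal (N powr s * 2 powr p) * (1 + ennreal (N powr - p) * J (?z t))"
          by (intro mult_left_mono add_left_mono Ju) auto
        finally show "ennreal (Y t) \<le> ennreal (N powr s * 2 powr p) * (1 + ennreal (N powr - p) * J (?z t))" .
      qed
      also have "\<dots> = ennreal (N powr s * 2 powr p) * (1 + ennreal (N powr - p) * (\<integral>\<^sup>+ t. J (?z t) \<partial>circ))"
        by (simp add: nn_integral_cmult nn_integral_add circ.emeasure_space_1[simplified])
      also have "\<dots> \<le> ennreal (N powr s * 2 powr p) * (1 + ennreal (N powr - p) * ennreal (C0 * N powr p))"
        by (intro mult_left_mono add_left_mono J(2) z) auto
      also have "ennreal (N powr - p) * ennreal (C0 * N powr p) = ennreal C0"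
        using N C0 by (simp add: ennreal_mult'[symmetric] powr_minus field_simps)
      also have "ennreal (N powr s * 2 powr p) * (1 + ennreal C0) = ennreal (N powr s * 2 powr p * (1 + C0))"
        using C0 by (simp add: ennreal_mult' ennreal_plus)
      finally show ?thesis by (simp add: C1_def mult_ac)
    qed
    have Y0: "0 \<le> Y t" for t by (simp add: Y_def)
    have Yi: "integrable circ Y"
      using le_less_trans[OF Yint ennreal_less_top] Y0 by (intro integrableI_bounded) auto
    have YI: "(LINT t|circ. Y t) \<le> C1 * N powr s"
    proof -
      have "ennreal (LINT t|circ. Y t) \<le> ennreal (C1 * N powr s)"
        using Yint by (simp add: nn_integral_eq_integral[OF Yi] Y0)
      then show ?thesis using C1 by (subst (asm) ennreal_le_iff) auto
    qed
    define R where "R = (\<lambda>t. Re (F1 (?z t) powr complex_of_real s))"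
    have Ri: "integrable circ R" and RI: "(LINT t|circ. R t) = Re (F1 0 powr complex_of_real s)"
      unfolding R_def using circ_mean_holomorphic[OF hols z] by (auto intro: integrable_Re)
    have F10: "\<bar>Re (F1 0 powr complex_of_real s)\<bar> \<le> c2 powr s * N powr s"
    proof -
      have nn: "AE w in dA. 0 \<le> wt w powr b * g w" using g0 by auto
      have "F 0 = of_real (LINT w|dA. wt w powr b * g w)" unfolding F_def \<nu>_def by (simp del: of_real_mult)
      moreover have L: "0 \<le> (LINT w|dA. wt w powr b * g w)" "(LINT w|dA. wt w powr b * g w) \<le> (c2 - 1) * N"
      proof -
        show "0 \<le> (LINT w|dA. wt w powr b * g w)" by (rule integral_nonneg_AE[OF nn])
        have "integrable dA (\<lambda>w. wt w powr b * g w)" using integrable_Re[OF \<nu>] by (simp add: \<nu>_def)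
        from nn_integral_eq_integral[OF this nn] mass
        have "ennreal (LINT w|dA. wt w powr b * g w) \<le> ennreal ((c2 - 1) * N)" by simp
        moreover have "0 \<le> (c2 - 1) * N" using b N by (simp add: c2_def)
        ultimately show "(LINT w|dA. wt w powr b * g w) \<le> (c2 - 1) * N" by simp
      qed
      ultimately have "norm (F1 0) \<le> c2 * N"
        using N(2) unfolding F1_def by (simp add: algebra_simps flip: of_real_add)
      moreover have "F1 0 \<noteq> 0" using Re1[of 0] by auto
      ultimately have "norm (F1 0 powr complex_of_real s) \<le> (c2 * N) powr s"
        using s by (subst norm_powr_of_real) (auto intro: powr_mono2)
      then show ?thesis using c2 N by (intro order_trans[OF abs_Re_le_cmod]) (simp add: powr_mult)
    qed
    have "(\<integral>\<^sup>+ t. ennreal (norm (F (?z t)) powr s) \<partial>circ) \<le> (\<integral>\<^sup>+ t. ennreal (A * Y t + B * R t) \<partial>circ)"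
    proof (intro nn_integral_mono ennreal_leI)
      fix t
      have "norm (F (?z t)) \<le> norm (F1 (?z t))"
        using Re_F(2)[OF nz[of t]] N(2) by (simp add: F1_def cmod_def power_mono)
      then have "norm (F (?z t)) powr s \<le> norm (F1 (?z t)) powr s" using s by (intro powr_mono2) auto
      also have "\<dots> \<le> A * Y t + B * R t" unfolding Y_def R_def by (rule AB[OF Re1[OF nz]])
      finally show "norm (F (?z t)) powr s \<le> A * Y t + B * R t" .
    qed
    also have "\<dots> = ennreal (LINT t|circ. A * Y t + B * R t)"
    proof (rule nn_integral_eq_integral)
      show "integrable circ (\<lambda>t. A * Y t + B * R t)" using Yi Ri by auto
      show "AE t in circ. 0 \<le> A * Y t + B * R t"
        using order_trans[OF powr_ge_zero AB[OF Re1[OF nz]]] by (auto simp: Y_def R_def)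
    qed
    also have "(LINT t|circ. A * Y t + B * R t) = A * (LINT t|circ. Y t) + B * Re (F1 0 powr complex_of_real s)"
      using Yi Ri by (simp add: RI)
    also have "\<dots> \<le> A * (C1 * N powr s) + \<bar>B\<bar> * (c2 powr s * N powr s)"
    proof (rule add_mono)
      show "A * (LINT t|circ. Y t) \<le> A * (C1 * N powr s)" using A YI by (intro mult_left_mono)
      \<comment> \<open>The signs of \<open>B\<close> and of this real part are both
        unknown.\<close>
      have "B * Re (F1 0 powr complex_of_real s) \<le> \<bar>B\<bar> * \<bar>Re (F1 0 powr complex_of_real s)\<bar>"
        by (metis abs_ge_self abs_mult)
      also have "\<dots> \<le> \<bar>B\<bar> * (c2 powr s * N powr s)" by (intro mult_left_mono F10) auto
      finally show "B * Re (F1 0 powr complex_of_real s) \<le> \<bar>B\<bar> * (c2 powr s * N powr s)" .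
    qed
    also have "\<dots> = C * N powr s" by (simp add: C_def algebra_simps)
    finally have "(\<integral>\<^sup>+ t. ennreal (norm (F (?z t)) powr s) \<partial>circ) \<le> ennreal (C * N powr s)"
      by (simp add: ennreal_leI)
    then show "integrable dA (\<lambda>w. complex_of_real (wt w powr b * g w) / (1 - z * cnj w)) \<and>
      (\<integral>\<^sup>+ t. ennreal (norm (LINT w|dA. complex_of_real (wt w powr b * g w) / (1 - ?z t * cnj w)) powr s) \<partial>circ) \<le> ennreal (C * N powr s)"
      using int[OF z] unfolding F_def \<nu>_def by blast
  qed
qed

text \<open>The cosine vanishes exactly at odd integers s; if p is one of them, any sufficiently
  small step down avoids it.\<close>

lemma exists_nonodd_exponent:
  fixes p r :: real
  assumes "r < p"
  obtains s where "r < s" "s \<le> p" "cos (s * pi / 2) \<noteq> 0"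
proof (cases "cos (p * pi / 2) = 0")
  case False
  then show ?thesis using assms by (intro that[of p]) auto
next
  case True
  \<comment> \<open>Half of the gap keeps p - d above r; the cap 1 keeps d \<pi>/2 inside (0,
    \<pi>), where the sine is positive.\<close>
  define d where "d = min 1 ((p - r) / 2)"
  have d: "0 < d" "d \<le> 1" "r < p - d" using assms by (auto simp: d_def min_def field_simps)
  have "0 < d * pi / 2" using d by simp
  moreover have "d * pi / 2 < pi"
  proof -
    have "d * pi \<le> 1 * pi" using d by (intro mult_right_mono) auto
    then show ?thesis using pi_gt_zero by linarith
  qed
  ultimately have sd: "0 < sin (d * pi / 2)" by (rule sin_gt_zero)
  have sp: "sin (p * pi / 2) \<noteq> 0" using True sin_zero_abs_cos_one by fastforce
  have "cos ((p - d) * pi / 2) = cos (p * pi / 2 - d * pi / 2)" by (simp add: left_diff_distrib diff_divide_distrib)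
  also have "\<dots> = sin (p * pi / 2) * sin (d * pi / 2)" using True by (simp add: cos_diff)
  finally show ?thesis using d sd sp by (intro that[of "p - d"]) auto
qed

lemma lorentz_mono:
  assumes g: "g \<in> borel_measurable dA" and \<beta>: "0 \<le> \<beta>"
    and le: "\<And>w. w \<in> unit_disc \<Longrightarrow> norm (f w) \<le> norm (g w)"
  shows "lorentz \<beta> f \<le> lorentz \<beta> g"
proof -
  have "dist_fun f t \<le> dist_fun g t" for t
    unfolding dist_fun_def using le by (intro dA.finite_measure_mono level_set_dA g) force
  then show ?thesis
    unfolding lorentz_def using \<beta>
    by (intro nn_integral_mono mult_right_mono ennreal_leI powr_mono2) (auto simp: dist_fun_bounds)
qed

text \<open>The passage from real part to modulus needs a nonnegative density, so f is split into
  the positive and negative parts of its real and imaginary parts; s is chosen strictly above -1/a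
  and admissible for the moment estimate.\<close>

lemma T_bounded_critical:
  assumes b: "- 1 < b" "b < 0" and a: "a < - (b + 1)"
  shows "T_bounded a b 1 (Lp1_norm (1 / (b + 1))) (weak_norm (- 1 / a))"
proof -
  define p where "p = 1 / (b + 1)"
  have p: "0 < p" "1 / p = b + 1" using b by (auto simp: p_def)
  have a0: "a < 0" using a b by simp
  have "- 1 / a < p" using a b a0 by (simp add: p_def field_simps)
  then obtain s where s: "- 1 / a < s" "s \<le> p" "cos (s * pi / 2) \<noteq> 0"
    by (rule exists_nonodd_exponent)
  have s0: "0 < s" using s(1) a0 by (smt (verit) divide_neg_neg)
  have as: "a * s < - 1" using s(1) a0 by (simp add: field_simps)
  obtain C where C: "0 \<le> C" and moment: "\<And>g N z. g \<in> borel_measurable dA \<Longrightarrow> (\<And>w. 0 \<le> g w) \<Longrightarrow>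
      lorentz (b + 1) (\<lambda>w. complex_of_real (g w)) \<le> ennreal N \<Longrightarrow> 0 < N \<Longrightarrow> norm z < 1 \<Longrightarrow>
      integrable dA (\<lambda>w. complex_of_real (wt w powr b * g w) / (1 - z * cnj w)) \<and>
      (\<integral>\<^sup>+ t. ennreal (norm (LINT w|dA. complex_of_real (wt w powr b * g w) / (1 - ecis t * z * cnj w)) powr s) \<partial>circ) \<le> ennreal (C * N powr s)"
    by (rule cauchy_transform_moment[OF b s0 s(2)[unfolded p_def] s(3)]) (rule that; blast)
  \<comment> \<open>4^s bounds the s-th power of a sum of four terms by the sum of their s-th
    powers, and 4 C adds up the four moments.\<close>
  define C' where "C' = 4 powr s * (4 * C)"
  have C': "0 \<le> C'" using C by (simp add: C'_def)
  define c0 where "c0 = (1 + C' / (- (a * s) - 1)) powr (- a) * 1"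
  have c0: "0 < c0"
  proof -
    have "0 \<le> C' / (- (a * s) - 1)" using C' as by (intro divide_nonneg_pos) auto
    then have "0 < (1 + C' / (- (a * s) - 1)) powr (- a)" unfolding powr_gt_zero by linarith
    then show ?thesis unfolding c0_def by simp
  qed
  show ?thesis
    unfolding p_def[symmetric]
  proof (rule maps_boundedly_Lp1I[OF p(1) c0], unfold p(2))
    fix f N assume f [measurable]: "f \<in> borel_measurable dA" and N: "lorentz (b + 1) f \<le> ennreal N" "0 < N"
    define g where "g = (\<lambda>j::nat. \<lambda>w. max 0 (if j = 0 then Re (f w) else if j = 1 then - Re (f w) else if j = 2 then Im (f w) else - Im (f w)))"
    have g_meas [measurable]: "g j \<in> borel_measurable dA" for j
      unfolding g_def by (cases "j = 0"; cases "j = 1"; cases "j = 2") simp_all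
    have g0: "0 \<le> g j w" for j w by (simp add: g_def)
    have gf: "norm (complex_of_real (g j w)) \<le> norm (f w)" for j w
      using abs_Re_le_cmod[of "f w"] abs_Im_le_cmod[of "f w"] by (auto simp: g_def)
    have f_eq: "f w = of_real (g 0 w) - of_real (g 1 w) + \<i> * of_real (g 2 w) - \<i> * of_real (g 3 w)" for w
      by (rule complex_eqI) (auto simp: g_def)
    have gN: "lorentz (b + 1) (\<lambda>w. complex_of_real (g j w)) \<le> ennreal N" for j
      by (rule order_trans[OF lorentz_mono[OF f] N(1)]) (use b gf in auto)
    define h where "h = (\<lambda>j z w. complex_of_real (wt w powr b * g j w) / (1 - z * cnj w))"
    define F where "F = (\<lambda>j z. LINT w|dA. h j z w)"
    have int: "integrable dA (h j z)" if "norm z < 1" for j z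
      using moment[OF g_meas g0 gN N(2) that] unfolding h_def by blast
    have mom: "(\<integral>\<^sup>+ t. ennreal (norm (F j (ecis t * z)) powr s) \<partial>circ) \<le> ennreal (C * N powr s)" if "norm z < 1" for j z
      using moment[OF g_meas g0 gN N(2) that] unfolding F_def h_def by blast
    have Fm [measurable]: "F j \<in> borel_measurable borel" for j
    proof -
      have cm: "(\<lambda>p. 1 - fst p * cnj (snd p)) \<in> borel_measurable (borel \<Otimes>\<^sub>M borel)" by measurable
      have 2: "(\<lambda>p. (fst p, snd p)) \<in> measurable (borel \<Otimes>\<^sub>M dA) (borel \<Otimes>\<^sub>M borel)"
        by (intro measurable_Pair measurable_compose[OF measurable_snd id_measurable_dA]) auto
      have [measurable]: "(\<lambda>p. 1 - fst p * cnj (snd p)) \<in> borel_measurable (borel \<Otimes>\<^sub>M dA)"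
        using measurable_compose[OF 2 cm] by simp
      have "(\<lambda>(z, w). h j z w) \<in> borel_measurable (borel \<Otimes>\<^sub>M dA)"
        unfolding h_def case_prod_beta' by measurable
      from dA.borel_measurable_lebesgue_integral[OF this] show ?thesis unfolding F_def .
    qed
    have T: "T_integrand b 1 f z w = h 0 z w - h 1 z w + \<i> * h 2 z w - \<i> * h 3 z w" if "norm z < 1" "norm w < 1" for z w
    proof -
      have nz: "1 - z * cnj w \<noteq> 0" by (rule one_minus_disc(1)[OF norm_mult_cnj_less_1[OF that]])
      then have "T_integrand b 1 f z w = of_real (wt w powr b) / (1 - z * cnj w) * f w"
        by (simp add: T_integrand_def)
      also have "\<dots> = h 0 z w - h 1 z w + \<i> * h 2 z w - \<i> * h 3 z w"
        by (subst f_eq) (simp add: h_def diff_divide_distrib add_divide_distrib algebra_simps)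
      finally show ?thesis .
    qed
    have Tint: "integrable dA (T_integrand b 1 f z)" if z: "norm z < 1" for z
    proof -
      have "integrable dA (\<lambda>w. h 0 z w - h 1 z w + \<i> * h 2 z w - \<i> * h 3 z w)"
        by (intro Bochner_Integration.integrable_diff Bochner_Integration.integrable_add integrable_mult_right int z)
      moreover have "integrable dA (T_integrand b 1 f z) \<longleftrightarrow> integrable dA (\<lambda>w. h 0 z w - h 1 z w + \<i> * h 2 z w - \<i> * h 3 z w)"
        by (rule Bochner_Integration.integrable_cong[OF refl]) (use T z in simp)
      ultimately show ?thesis by blast
    qed
    have Tval: "norm (T_op a b 1 f z) \<le> wt z powr a * (\<Sum>j<4. norm (F j z))" if z: "norm z < 1" for z
    proof -
      have "(LINT w|dA. T_integrand b 1 f z w) = (LINT w|dA. h 0 z w - h 1 z w + \<i> * h 2 z w - \<i> * h 3 z w)"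
        by (rule Bochner_Integration.integral_cong[OF refl]) (use T z in simp)
      also have "\<dots> = F 0 z - F 1 z + \<i> * F 2 z - \<i> * F 3 z"
        unfolding F_def using int[OF z] by (simp add: Bochner_Integration.integral_diff Bochner_Integration.integral_add)
      also have "norm \<dots> \<le> norm (F 0 z) + norm (F 1 z) + norm (\<i> * F 2 z) + norm (\<i> * F 3 z)"
        by (intro order_trans[OF norm_triangle_ineq4] add_right_mono order_trans[OF norm_triangle_ineq] order_refl)
      also have "\<dots> = (\<Sum>j<4. norm (F j z))" by (simp add: norm_mult eval_nat_numeral)
      finally show ?thesis by (simp add: T_op_def norm_mult mult_left_mono)
    qed
    define J where "J = (\<lambda>z. ennreal (4 powr s) * (\<Sum>j<4. ennreal (norm (F j z) powr s)))"
    have Jm: "J \<in> borel_measurable borel" unfolding J_def by measurable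
    have "weak_norm (- 1 / a) (T_op a b 1 f) \<le> ennreal (c0 * N)"
      unfolding c0_def
    proof (rule weak_norm_of_moment[OF a0 s0 as N(2) C' zero_less_one _ _ Jm _ T_S_measurable(3)[OF f], where G = "\<lambda>z. \<Sum>j<4. norm (F j z)"])
      show "0 < - 1 / a" "- a \<le> 1 / (- 1 / a)" using a0 by (auto simp: divide_neg_neg)
      show "(\<lambda>z. \<Sum>j<4. norm (F j z)) \<in> borel_measurable dA"
        by (rule borel_measurable_dA) measurable
      show "0 \<le> (\<Sum>j<4. norm (F j z))" for z by (simp add: sum_nonneg)
      show "AE z in dA. norm (T_op a b 1 f z) \<le> 1 * (wt z powr a * (\<Sum>j<4. norm (F j z)))"
        using Tval by auto
      fix z :: complex assume z: "norm z < 1"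
      show "ennreal ((\<Sum>j<4. norm (F j z)) powr s) \<le> J z"
      proof -
        \<comment> \<open>Bounding the sum by four times its largest term works for every s > 0; s
          can lie on either side of 1.\<close>
        define m where "m = Max ((\<lambda>j. norm (F j z)) ` {..<4::nat})"
        have "m \<in> (\<lambda>j. norm (F j z)) ` {..<4::nat}" unfolding m_def by (rule Max_in) (auto simp: lessThan_empty_iff)
        then obtain i where i: "i < 4" "m = norm (F i z)" by auto
        have "(\<Sum>j<4. norm (F j z)) \<le> (\<Sum>j<4::nat. m)"
          by (rule sum_mono) (auto simp: m_def)
        then have "(\<Sum>j<4. norm (F j z)) \<le> 4 * norm (F i z)" by (simp add: i)
        then have "(\<Sum>j<4. norm (F j z)) powr s \<le> (4 * norm (F i z)) powr s"
          using s0 by (intro powr_mono2) (auto simp: sum_nonneg)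
        also have "\<dots> = 4 powr s * norm (F i z) powr s" by (simp add: powr_mult)
        also have "\<dots> \<le> 4 powr s * (\<Sum>j<4. norm (F j z) powr s)"
          using i(1) by (intro mult_left_mono member_le_sum) auto
        finally have "ennreal ((\<Sum>j<4. norm (F j z)) powr s) \<le> ennreal (4 powr s * (\<Sum>j<4. norm (F j z) powr s))"
          by (rule ennreal_leI)
        then show ?thesis by (simp add: J_def ennreal_mult' sum_nonneg flip: sum_ennreal)
      qed
      show "(\<integral>\<^sup>+ t. J (ecis t * z) \<partial>circ) \<le> ennreal (C' * N powr s)"
      proof -
        have em [measurable]: "(\<lambda>t. ennreal (norm (F j (ecis t * z)) powr s)) \<in> borel_measurable circ" for j
        proof -
          have "(\<lambda>t. ecis t * z) \<in> borel_measurable circ" using ecis_measurable by simp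
          then show ?thesis by measurable
        qed
        have "(\<integral>\<^sup>+ t. J (ecis t * z) \<partial>circ) = ennreal (4 powr s) * (\<integral>\<^sup>+ t. (\<Sum>j<4. ennreal (norm (F j (ecis t * z)) powr s)) \<partial>circ)"
          unfolding J_def by (rule nn_integral_cmult) measurable
        also have "(\<integral>\<^sup>+ t. (\<Sum>j<4. ennreal (norm (F j (ecis t * z)) powr s)) \<partial>circ) =
            (\<Sum>j<4. \<integral>\<^sup>+ t. ennreal (norm (F j (ecis t * z)) powr s) \<partial>circ)"
          by (rule nn_integral_sum) measurable
        also have "ennreal (4 powr s) * \<dots> \<le> ennreal (4 powr s) * (\<Sum>j<4::nat. ennreal (C * N powr s))"
          by (intro mult_left_mono sum_mono mom z) auto
        also have "(\<Sum>j<4::nat. ennreal (C * N powr s)) = ennreal (4 * (C * N powr s))"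
          using C by (simp add: ennreal_mult')
        also have "ennreal (4 powr s) * ennreal (4 * (C * N powr s)) = ennreal (C' * N powr s)"
          using C by (simp add: C'_def ennreal_mult'[symmetric] mult_ac)
        finally show ?thesis .
      qed
    qed
    moreover have "AE z in dA. integrable dA (T_integrand b 1 f z)" using Tint by auto
    ultimately show "(AE z in dA. integrable dA (T_integrand b 1 f z)) \<and> T_op a b 1 f \<in> borel_measurable dA \<and>
        weak_norm (- 1 / a) (T_op a b 1 f) \<le> ennreal (c0 * N)"
      using T_S_measurable(3)[OF f] by blast
  qed
qed

section \<open>Lebesgue spaces and the critical exponent\<close>

text \<open>Weak L^r embeds in L^{1/\<beta>,1} on a probability space when r > 1/\<beta>: below t =
  A the distribution function is bounded by 1, above it the decay t^(-r \<beta>) is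
  integrable.\<close>

lemma lorentz_le_of_decay:
  assumes r: "0 < \<beta>" "1 < r * \<beta>" and A: "0 \<le> A"
    and le: "\<And>t. 0 < t \<Longrightarrow> dist_fun f t \<le> (A / t) powr r"
  shows "lorentz \<beta> f \<le> ennreal ((1 + 1 / (r * \<beta> - 1)) * A)"
proof -
  have b1: "dist_fun f t powr \<beta> \<le> 1" for t
    using r dist_fun_bounds[of f t] by (intro powr_le1) auto
  have b2: "dist_fun f t powr \<beta> \<le> A powr (r * \<beta>) * t powr (- (r * \<beta>))" if "0 < t" for t
  proof -
    have "dist_fun f t powr \<beta> \<le> ((A / t) powr r) powr \<beta>"
      using r dist_fun_bounds[of f t] le[OF that] by (intro powr_mono2) auto
    also have "\<dots> = A powr (r * \<beta>) * t powr (- (r * \<beta>))"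
      using A that by (simp add: powr_powr powr_divide powr_minus_divide)
    finally show ?thesis .
  qed
  show ?thesis
  \<comment> \<open>At A = 0 the tail integral would start at its singularity; the decay bound makes
    the distribution function vanish instead.\<close>
  proof (cases "A = 0")
    case True
    have "dist_fun f t powr \<beta> = 0" if "0 < t" for t
      using b2[OF that] True r by simp
    then have "lorentz \<beta> f = (\<integral>\<^sup>+ t. 0 \<partial>(lborel :: real measure))"
      unfolding lorentz_def by (intro nn_integral_cong) (auto simp: indicator_def)
    then show ?thesis using True by simp
  next
    case False
    then have A: "0 < A" using A by simp
    have "lorentz \<beta> f \<le> (\<integral>\<^sup>+ t. indicator {0..A} t + ennreal (A powr (r * \<beta>)) * (ennreal (t powr (- (r * \<beta>))) * indicator {A..} t) \<partial>lborel)"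
      unfolding lorentz_def
    proof (rule nn_integral_mono)
      fix t :: real
      show "ennreal (dist_fun f t powr \<beta>) * indicator {0<..} t \<le>
          indicator {0..A} t + ennreal (A powr (r * \<beta>)) * (ennreal (t powr (- (r * \<beta>))) * indicator {A..} t)"
      proof (cases "t \<le> A")
        case True
        then show ?thesis using b1[of t] by (auto simp: indicator_def add_increasing2)
      next
        case False
        then have "0 < t" using A by simp
        from b2[OF this] have "ennreal (dist_fun f t powr \<beta>) \<le> ennreal (A powr (r * \<beta>)) * ennreal (t powr (- (r * \<beta>)))"
          by (simp add: ennreal_mult'[symmetric] ennreal_leI)
        then show ?thesis using False by (simp add: indicator_def)
      qed
    qed
    also have "\<dots> = (\<integral>\<^sup>+ t. indicator {0..A} t \<partial>lborel) +
        (\<integral>\<^sup>+ t. ennreal (A powr (r * \<beta>)) * (ennreal (t powr (- (r * \<beta>))) * indicator {A..} t) \<partial>lborel)"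
      by (rule nn_integral_add) measurable
    also have "(\<integral>\<^sup>+ t. ennreal (A powr (r * \<beta>)) * (ennreal (t powr (- (r * \<beta>))) * indicator {A..} t) \<partial>lborel) =
        ennreal (A powr (r * \<beta>)) * ennreal (A powr (- (r * \<beta>) + 1) / (- (- (r * \<beta>)) - 1))"
    proof -
      have "- (r * \<beta>) < - 1" using r by simp
      from nn_integral_powr_to_inf[OF this A, symmetric] show ?thesis
        by (simp only:) (rule nn_integral_cmult, measurable)
    qed
    also have "\<dots> = ennreal (A / (r * \<beta> - 1))"
    proof -
      have "A powr (r * \<beta>) * A powr (- (r * \<beta>) + 1) = A"
        using A by (simp add: powr_add[symmetric])
      then show ?thesis using r by (simp add: ennreal_mult'[symmetric])
    qed
    also have "(\<integral>\<^sup>+ t. indicator {0..A} t \<partial>lborel) + ennreal (A / (r * \<beta> - 1)) = ennreal ((1 + 1 / (r * \<beta> - 1)) * A)"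
      using A r by (simp add: ennreal_plus[symmetric] algebra_simps del: ennreal_plus)
    finally show ?thesis .
  qed
qed

text \<open>For finite P, Chebyshev's inequality gives the decay required above. For P infinite, the
  distribution function is at most 1 and vanishes from the essential supremum on.\<close>

lemma lorentz_le_Lp_norm:
  assumes P: "1 \<le> P" "1 / P < ennreal \<beta>" and \<beta>: "0 < \<beta>"
  obtains C where "0 < C" "\<And>f. f \<in> borel_measurable dA \<Longrightarrow> lorentz \<beta> f \<le> ennreal C * Lp_norm P f"
proof (cases "P = \<infinity>")
  case True
  show thesis
  proof (rule that[OF zero_less_one])
    fix f :: "complex \<Rightarrow> complex" assume f [measurable]: "f \<in> borel_measurable dA"
    define E where "E = esssup dA (\<lambda>z. ennreal (norm (f z)))"
    have "lorentz \<beta> f \<le> (\<integral>\<^sup>+ t. indicator {0..} t * (if ennreal t < E then 1 else 0) \<partial>lborel)"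
      unfolding lorentz_def
    proof (rule nn_integral_mono)
      fix t :: real
      have "dist_fun f t = 0" if "\<not> ennreal t < E" "0 < t"
      proof -
        have "AE z in dA. \<not> t < norm (f z)"
          using esssup_AE[of "\<lambda>z. ennreal (norm (f z))" dA]
        proof eventually_elim
          fix z assume "ennreal (norm (f z)) \<le> esssup dA (\<lambda>z. ennreal (norm (f z)))"
          then have "ennreal (norm (f z)) \<le> ennreal t"
            by (rule order_trans) (use that in \<open>simp add: E_def not_less\<close>)
          then show "\<not> t < norm (f z)" using that by (simp add: ennreal_le_iff)
        qed
        then have "AE z in dA. z \<notin> {z \<in> unit_disc. t < norm (f z)}" by eventually_elim auto
        then have "emeasure dA {z \<in> unit_disc. t < norm (f z)} = 0"
          using AE_iff_measurable[OF level_set_dA[OF f], of "\<lambda>z. z \<notin> {z \<in> unit_disc. t < norm (f z)}" t] by auto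
        then show ?thesis by (simp add: dist_fun_def measure_def)
      qed
      moreover have "dist_fun f t powr \<beta> \<le> 1" using \<beta> dist_fun_bounds[of f t] by (intro powr_le1) auto
      ultimately show "ennreal (dist_fun f t powr \<beta>) * indicator {0<..} t \<le> indicator {0..} t * (if ennreal t < E then 1 else 0)"
        by (auto simp: indicator_def)
    qed
    also have "\<dots> \<le> E"
    proof (cases E rule: ennreal_cases)
      case (real r)
      have "(\<integral>\<^sup>+ t. indicator {0..} t * (if ennreal t < E then 1 else 0) \<partial>lborel) \<le> (\<integral>\<^sup>+ t. indicator {0..r} t \<partial>lborel)"
        using real by (intro nn_integral_mono) (auto simp: indicator_def ennreal_less_iff)
      then show ?thesis using real by simp
    qed simp
    finally show "lorentz \<beta> f \<le> ennreal 1 * Lp_norm P f"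
      using True by (simp add: Lp_norm_def E_def)
  qed
next
  case False
  then obtain r where r: "P = ennreal r" "0 \<le> r" by (cases P rule: ennreal_cases) auto
  have r1: "1 \<le> r" using P(1) r by (simp flip: ennreal_1)
  have "1 / r < \<beta>"
    using P(2) r r1 \<beta> by (simp add: divide_ennreal ennreal_less_iff flip: ennreal_1)
  then have rb: "1 < r * \<beta>" using r1 by (simp add: field_simps)
  define C where "C = 1 + 1 / (r * \<beta> - 1)"
  have C: "0 < C" using rb by (simp add: C_def add_pos_pos)
  show thesis
  proof (rule that[OF C])
    fix f :: "complex \<Rightarrow> complex" assume f [measurable]: "f \<in> borel_measurable dA"
    define I where "I = (\<integral>\<^sup>+ z. ennreal (norm (f z) powr r) \<partial>dA)"
    have Lp: "Lp_norm P f = (if I = \<infinity> then \<infinity> else ennreal (enn2real I powr (1 / r)))"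
      using False r by (simp add: Lp_norm_def I_def)
    show "lorentz \<beta> f \<le> ennreal C * Lp_norm P f"
    proof (cases "I = \<infinity>")
      case True
      then show ?thesis using C by (simp add: Lp ennreal_mult_top)
    next
      case fin: False
      define A where "A = enn2real I powr (1 / r)"
      have "dist_fun f t \<le> (A / t) powr r" if t: "0 < t" for t
      proof -
        have "ennreal (t powr r * dist_fun f t) = (\<integral>\<^sup>+ z. ennreal (t powr r) * (if t < norm (f z) then 1 else 0) \<partial>dA)"
          by (subst nn_integral_cmult) (simp_all add: emeasure_level_set ennreal_mult')
        also have "\<dots> \<le> I"
          unfolding I_def using t r1 by (intro nn_integral_mono) (auto intro!: ennreal_leI powr_mono2)
        also have "\<dots> = ennreal (enn2real I)" using fin by (simp add: ennreal_enn2real_if)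
        finally have "t powr r * dist_fun f t \<le> enn2real I" by (simp add: ennreal_le_iff)
        also have "enn2real I = A powr r" using r1 by (simp add: A_def powr_powr)
        finally show ?thesis using t by (simp add: powr_divide A_def field_simps)
      qed
      then have "lorentz \<beta> f \<le> ennreal (C * A)"
        unfolding C_def by (intro lorentz_le_of_decay \<beta> rb) (simp add: A_def)
      then show ?thesis using fin C by (simp add: Lp A_def[symmetric] ennreal_mult')
    qed
  qed
qed

lemma maps_boundedly_Lp_of_Lp1:
  assumes "maps_boundedly K F (Lp1_norm (1 / \<beta>)) Y" and "1 \<le> P" "1 / P < ennreal \<beta>" and \<beta>: "0 < \<beta>"
  shows "maps_boundedly K F (Lp_norm P) Y"
proof -
  obtain C where C: "0 < C" "\<And>f. f \<in> borel_measurable dA \<Longrightarrow> lorentz \<beta> f \<le> ennreal C * Lp_norm P f"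
    using lorentz_le_Lp_norm[OF assms(2-4)] by blast
  show ?thesis
  proof (rule maps_boundedly_trans[OF assms(1)])
    show "0 \<le> 1 / \<beta> * C" using C \<beta> by simp
    fix f :: "complex \<Rightarrow> complex" assume f: "f \<in> borel_measurable dA"
    have "Lp1_norm (1 / \<beta>) f = ennreal (1 / \<beta>) * lorentz \<beta> f" by (simp add: Lp1_norm_lorentz)
    also have "\<dots> \<le> ennreal (1 / \<beta>) * (ennreal C * Lp_norm P f)" by (intro mult_left_mono C f) auto
    finally show "Lp1_norm (1 / \<beta>) f \<le> ennreal (1 / \<beta> * C) * Lp_norm P f"
      using C \<beta> by (simp only: ennreal_mult'[of C, symmetric] mult.assoc[symmetric] ennreal_mult''[symmetric] less_imp_le ennreal_mult' )
  qed
qed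

section \<open>Counterexamples at the critical exponent\<close>

text \<open>Monotone convergence: the antiderivatives used below are available only away from the
  singularity at 0.\<close>

lemma nn_integral_Ioc_le:
  fixes \<phi> :: "real \<Rightarrow> ennreal"
  assumes [measurable]: "\<phi> \<in> borel_measurable borel"
    and le: "\<And>d. 0 < d \<Longrightarrow> d < 1 \<Longrightarrow> (\<integral>\<^sup>+ y. \<phi> y * indicator {d..1} y \<partial>lborel) \<le> M"
  shows "(\<integral>\<^sup>+ y. \<phi> y * indicator {0<..1} y \<partial>lborel) \<le> M"
proof -
  define d where "d = (\<lambda>n::nat. 1 / real (n + 2))"
  have d: "0 < d n" "d n < 1" for n by (auto simp: d_def)
  have inc: "incseq (\<lambda>n y. \<phi> y * indicator {d n..1} y)"
  proof (rule incseq_SucI, rule le_funI)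
    fix n y
    have "d (Suc n) \<le> d n" by (simp add: d_def frac_le)
    then show "\<phi> y * indicator {d n..1} y \<le> \<phi> y * indicator {d (Suc n)..1} y"
      by (auto simp: indicator_def)
  qed
  have "\<phi> y * indicator {0<..1} y \<le> (SUP n. \<phi> y * indicator {d n..1} y)" for y
  proof (cases "0 < y \<and> y \<le> 1")
    case True
    obtain n where "1 / y < real n" using reals_Archimedean2 by blast
    then have "d n \<le> y" using True by (simp add: d_def field_simps)
    then show ?thesis using True by (intro SUP_upper2[of n]) auto
  qed (auto simp: indicator_def)
  then have "(\<integral>\<^sup>+ y. \<phi> y * indicator {0<..1} y \<partial>lborel) \<le> (\<integral>\<^sup>+ y. (SUP n. \<phi> y * indicator {d n..1} y) \<partial>lborel)"
    by (intro nn_integral_mono) auto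
  also have "\<dots> = (SUP n. \<integral>\<^sup>+ y. \<phi> y * indicator {d n..1} y \<partial>lborel)"
    by (rule nn_integral_monotone_convergence_SUP[OF inc]) measurable
  also have "\<dots> \<le> M" by (intro SUP_least le d)
  finally show ?thesis .
qed

text \<open>With y = 1 - |w|^2, f^p = 1 / (y (1 - ln y)^p) is integrable because p > 1, while y^b f
  = 1 / (y (1 - ln y)) has the divergent primitive - ln (1 - ln y). The defining integral then
  diverges at every z, whatever the target \<open>Y\<close>.\<close>

lemma unbounded_Lp_critical:
  assumes b: "- 1 < b" "b < 0"
    and K: "\<And>f z w. norm z < 1 \<Longrightarrow> norm w < 1 \<Longrightarrow> norm (K f z w) = norm (1 - z * cnj w) powr - 1 * wt w powr b * norm (f w)"
  shows "\<not> maps_boundedly K F (Lp_norm (ennreal (1 / (b + 1)))) Y"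
proof
  assume bdd: "maps_boundedly K F (Lp_norm (ennreal (1 / (b + 1)))) Y"
  define p where "p = 1 / (b + 1)"
  have p: "1 < p" "(b + 1) * p = 1" using b by (auto simp: p_def field_simps)
  define \<phi> where "\<phi> = (\<lambda>y::real. y powr (- (b + 1)) / (1 - ln y))"
  have \<phi>m [measurable]: "\<phi> \<in> borel_measurable borel" unfolding \<phi>_def by measurable
  define f where "f = (\<lambda>w. complex_of_real (\<phi> (wt w)))"
  have f [measurable]: "f \<in> borel_measurable dA" unfolding f_def by (rule borel_measurable_dA) measurable
  have L: "1 \<le> 1 - ln y" if "0 < y" "y \<le> 1" for y :: real using that by simp
  have \<phi>_nonneg: "0 \<le> \<phi> y" if "0 < y" "y \<le> 1" for y using L[OF that] by (simp add: \<phi>_def)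
  have fin: "(\<integral>\<^sup>+ w. ennreal (norm (f w) powr p) \<partial>dA) \<le> ennreal (1 / (p - 1))"
  proof -
    have "(\<integral>\<^sup>+ w. ennreal (norm (f w) powr p) \<partial>dA) = (\<integral>\<^sup>+ y. ennreal (\<bar>\<phi> y\<bar> powr p) * indicator {0..1} y \<partial>lborel)"
      using nn_integral_radial[of "\<lambda>y. ennreal (\<bar>\<phi> y\<bar> powr p)"] by (simp add: f_def)
    also have "\<dots> = (\<integral>\<^sup>+ y. ennreal (\<bar>\<phi> y\<bar> powr p) * indicator {0<..1} y \<partial>lborel)"
      by (intro nn_integral_cong) (auto simp: indicator_def \<phi>_def)
    also have "\<dots> \<le> ennreal (1 / (p - 1))"
    proof (rule nn_integral_Ioc_le)
      fix d :: real assume d: "0 < d" "d < 1"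
      have "(\<integral>\<^sup>+ y. ennreal (\<bar>\<phi> y\<bar> powr p) * indicator {d..1} y \<partial>lborel) =
          (\<integral>\<^sup>+ y. ennreal (1 / y * (1 - ln y) powr - p) * indicator {d..1} y \<partial>lborel)"
      proof (rule nn_integral_cong)
        fix y :: real
        have "\<bar>\<phi> y\<bar> powr p = 1 / y * (1 - ln y) powr - p" if y: "d \<le> y" "y \<le> 1"
        proof -
          have y0: "0 < y" using d y by simp
          have "\<bar>\<phi> y\<bar> powr p = \<phi> y powr p" using \<phi>_nonneg[OF y0 y(2)] by simp
          also have "\<dots> = (y powr (- (b + 1))) powr p / (1 - ln y) powr p"
            unfolding \<phi>_def by (rule powr_divide)
          also have "(y powr (- (b + 1))) powr p = y powr (- 1)"
            using p(2) unfolding powr_powr minus_mult_left[symmetric] by (simp only:)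
          also have "y powr (- 1) / (1 - ln y) powr p = 1 / y * (1 - ln y) powr - p"
            using y0 by (simp add: powr_minus_divide)
          finally show ?thesis .
        qed
        then show "ennreal (\<bar>\<phi> y\<bar> powr p) * indicator {d..1} y = ennreal (1 / y * (1 - ln y) powr - p) * indicator {d..1} y"
          by (auto simp: indicator_def)
      qed
      also have "\<dots> = ennreal ((1 - ln 1) powr (1 - p) / (p - 1) - (1 - ln d) powr (1 - p) / (p - 1))"
      proof (rule nn_integral_FTC_Icc)
        fix y assume y: "y \<in> {d..1}"
        then have y0: "0 < y" "y \<le> 1" using d by auto
        show "0 \<le> 1 / y * (1 - ln y) powr - p" using y0 by simp
        have "((\<lambda>y. (1 - ln y) powr (1 - p) / (p - 1)) has_real_derivative
            ((1 - p) * (1 - ln y) powr (1 - p - 1) * (0 - 1 / y)) / (p - 1)) (at y)"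
        proof (rule DERIV_cdivide)
          have "((\<lambda>y. 1 - ln y) has_real_derivative 0 - 1 / y) (at y)"
            using y0 by (auto intro!: derivative_eq_intros)
          moreover have "0 < 1 - ln y" using L[OF y0] by linarith
          ultimately show "((\<lambda>y. (1 - ln y) powr (1 - p)) has_real_derivative
              (1 - p) * (1 - ln y) powr (1 - p - 1) * (0 - 1 / y)) (at y)"
            using DERIV_fun_powr[of "\<lambda>y. 1 - ln y" "0 - 1 / y" y "1 - p"] by simp
        qed
        moreover have "((1 - p) * (1 - ln y) powr (1 - p - 1) * (0 - 1 / y)) / (p - 1) = 1 / y * (1 - ln y) powr - p"
          using p(1) y0 by (simp add: field_simps)
        ultimately show "((\<lambda>y. (1 - ln y) powr (1 - p) / (p - 1)) has_real_derivative 1 / y * (1 - ln y) powr - p) (at y)"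
          by simp
      qed (use d in auto)
      also have "\<dots> \<le> ennreal (1 / (p - 1))" using p(1) by (intro ennreal_leI) simp
      finally show "(\<integral>\<^sup>+ y. ennreal (\<bar>\<phi> y\<bar> powr p) * indicator {d..1} y \<partial>lborel) \<le> ennreal (1 / (p - 1))" .
    qed measurable
    finally show ?thesis .
  qed
  have inf: "(\<integral>\<^sup>+ w. ennreal (wt w powr b * \<phi> (wt w)) \<partial>dA) = \<infinity>"
  proof (rule ccontr)
    assume "(\<integral>\<^sup>+ w. ennreal (wt w powr b * \<phi> (wt w)) \<partial>dA) \<noteq> \<infinity>"
    then obtain r where r: "0 \<le> r" "(\<integral>\<^sup>+ w. ennreal (wt w powr b * \<phi> (wt w)) \<partial>dA) = ennreal r"
      by (cases "\<integral>\<^sup>+ w. ennreal (wt w powr b * \<phi> (wt w)) \<partial>dA" rule: ennreal_cases) auto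
    \<comment> \<open>Chosen so that ln (1 - ln d) = r + 1, which exceeds the supposed value r of
      the integral.\<close>
    define d where "d = exp (1 - exp (r + 1))"
    have "1 < exp (r + 1)" using r by simp
    then have d: "0 < d" "d < 1" by (simp_all add: d_def)
    have "ennreal (r + 1) = ennreal (- ln (1 - ln 1) - - ln (1 - ln d))"
      by (simp add: d_def add.commute)
    also have "\<dots> = (\<integral>\<^sup>+ y. ennreal (1 / (y * (1 - ln y))) * indicator {d..1} y \<partial>lborel)"
    proof (rule nn_integral_FTC_Icc[symmetric])
      fix y assume y: "y \<in> {d..1}"
      then have y0: "0 < y" "y \<le> 1" using d by auto
      have lny: "ln y < 1" using L[OF y0] by linarith
      show "0 \<le> 1 / (y * (1 - ln y))" using lny y0 by simp
      show "((\<lambda>y. - ln (1 - ln y)) has_real_derivative 1 / (y * (1 - ln y))) (at y)"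
        using lny y0 by (auto intro!: derivative_eq_intros simp: field_simps)
    qed (use d in auto)
    also have "\<dots> \<le> (\<integral>\<^sup>+ y. ennreal (y powr b * \<phi> y) * indicator {0..1} y \<partial>lborel)"
    proof (rule nn_integral_mono)
      fix y :: real
      have "1 / (y * (1 - ln y)) = y powr b * \<phi> y" if "d \<le> y"
      proof -
        have y: "0 < y" using d that by simp
        have "y powr b * \<phi> y = (y powr b * y powr (- (b + 1))) / (1 - ln y)" by (simp add: \<phi>_def)
        also have "y powr b * y powr (- (b + 1)) = 1 / y"
          using y by (simp add: powr_add[symmetric] powr_minus_divide)
        finally show ?thesis by simp
      qed
      then show "ennreal (1 / (y * (1 - ln y))) * indicator {d..1} y \<le> ennreal (y powr b * \<phi> y) * indicator {0..1} y"
        using d by (auto simp: indicator_def)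
    qed
    also have "\<dots> = ennreal r"
      using nn_integral_radial[of "\<lambda>y. ennreal (y powr b * \<phi> y)"] r by simp
    finally show False using r by simp
  qed
  have "Lp_norm (ennreal (1 / (b + 1))) f < \<infinity>"
  proof -
    have "(\<integral>\<^sup>+ w. ennreal (norm (f w) powr p) \<partial>dA) \<noteq> \<infinity>"
      using le_less_trans[OF fin ennreal_less_top] by auto
    then show ?thesis using p b unfolding p_def[symmetric] by (simp add: Lp_norm_def Let_def)
  qed
  with bdd f have "AE z in dA. integrable dA (K f z)" unfolding maps_boundedly_def by blast
  then have "AE z in dA. False"
    using AE_space
  proof eventually_elim
    fix z assume int: "integrable dA (K f z)" and "z \<in> space dA"
    then have z: "norm z < 1" by simp
    \<comment> \<open>The kernel is at least 1/2, since |1 - z cnj w| <= 2.\<close>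
    have "(\<integral>\<^sup>+ w. ennreal (1 / 2) * ennreal (wt w powr b * \<phi> (wt w)) \<partial>dA) \<le> (\<integral>\<^sup>+ w. ennreal (norm (K f z w)) \<partial>dA)"
    proof (rule nn_integral_mono)
      fix w assume "w \<in> space dA"
      then have w: "norm w < 1" by simp
      have n: "0 < norm (1 - z * cnj w)" using one_minus_disc(1)[OF norm_mult_cnj_less_1[OF z w]] by simp
      have "norm (1 - z * cnj w) \<le> 1 + norm (z * cnj w)" using norm_triangle_ineq4[of 1 "z * cnj w"] by simp
      then have "norm (1 - z * cnj w) \<le> 2" using norm_mult_cnj_less_1[OF z w] by linarith
      then have "1 / 2 \<le> norm (1 - z * cnj w) powr - 1"
        using n by (simp add: powr_minus_divide field_simps)
      moreover have \<phi>0: "0 \<le> \<phi> (wt w)" by (rule \<phi>_nonneg[OF wt_pos[OF w] wt_le_1])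
      ultimately have "1 / 2 * (wt w powr b * \<phi> (wt w)) \<le> norm (1 - z * cnj w) powr - 1 * (wt w powr b * \<phi> (wt w))"
        by (intro mult_right_mono) auto
      also have "\<dots> = norm (K f z w)"
        unfolding K[OF z w] using \<phi>0 by (simp add: f_def mult.assoc)
      finally have "ennreal (1 / 2 * (wt w powr b * \<phi> (wt w))) \<le> ennreal (norm (K f z w))" by (rule ennreal_leI)
      then show "ennreal (1 / 2) * ennreal (wt w powr b * \<phi> (wt w)) \<le> ennreal (norm (K f z w))"
        using \<phi>0 by (subst ennreal_mult'[symmetric]) auto
    qed
    moreover have "(\<integral>\<^sup>+ w. ennreal (1 / 2) * ennreal (wt w powr b * \<phi> (wt w)) \<partial>dA) = ennreal (1 / 2) * \<infinity>"
      unfolding inf[symmetric] by (rule nn_integral_cmult) (rule borel_measurable_dA, measurable)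
    moreover have "ennreal (1 / 2) * \<infinity> = \<infinity>" by (simp add: ennreal_mult_top)
    ultimately have "(\<integral>\<^sup>+ w. ennreal (norm (K f z w)) \<partial>dA) = \<infinity>" by (simp add: top_unique)
    then show False using int by (simp add: integrable_iff_bounded)
  qed
  then show False by simp
qed

text \<open>For the indicator f of {y <= d} the Lorentz norm is p d^(b+1). On the same annulus, of
  measure d, |S f| is at least d^(a+b+1) m with m of order ln (1/d). Hence the weak norm is at least
  d^(b+1) m / 2, and the ratio is unbounded as d shrinks.\<close>

lemma S_unbounded_critical:
  assumes b: "- 1 < b" "b < 0" and a: "- 1 < a" "a < 0"
  shows "\<not> S_bounded a b 1 (Lp1_norm (1 / (b + 1))) (weak_norm (- 1 / a))"
proof
  assume "S_bounded a b 1 (Lp1_norm (1 / (b + 1))) (weak_norm (- 1 / a))"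
  then obtain C where C: "0 \<le> C" and bdd: "\<And>f. f \<in> borel_measurable dA \<Longrightarrow> Lp1_norm (1 / (b + 1)) f < \<infinity> \<Longrightarrow>
      weak_norm (- 1 / a) (S_op a b 1 f) \<le> ennreal C * Lp1_norm (1 / (b + 1)) f"
    unfolding maps_boundedly_def by blast
  define p where "p = 1 / (b + 1)"
  have p: "0 < p" "1 / p = b + 1" using b by (auto simp: p_def)
  \<comment> \<open>\<open>X\<close> is chosen so that X / (2 \<pi>) exceeds 2 C p; then
    \<open>d\<close> makes \<pi> / (2 d) = exp X, so that m is larger still.\<close>
  define X where "X = 4 * pi * (C * p) + 1"
  have X: "1 \<le> X" using C p by (simp add: X_def)
  define d where "d = pi / (2 * exp X)"
  have d: "0 < d" "d < 1"
  proof -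
    show "0 < d" by (simp add: d_def)
    have "2 \<le> exp X" using X exp_ge_add_one_self[of X] by linarith
    then have "pi < 2 * exp X" using pi_less_4 by linarith
    then show "d < 1" by (simp add: d_def)
  qed
  define m where "m = ln (1 + pi / (2 * d)) / (2 * pi)"
  have m: "2 * (C * p) < m"
  proof -
    have "pi / (2 * d) = exp X" by (simp add: d_def)
    moreover have "X < ln (1 + exp X)" by (metis exp_gt_zero exp_less_cancel_iff exp_ln less_add_one add.commute add_pos_pos zero_less_one)
    ultimately have "X / (2 * pi) < m" unfolding m_def by (simp add: divide_strict_right_mono)
    moreover have "2 * (C * p) < X / (2 * pi)" by (simp add: X_def field_simps)
    ultimately show ?thesis by linarith
  qed
  have m0: "0 < m" using m C p by (smt (verit) mult_nonneg_nonneg)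
  define f where "f = (\<lambda>w. complex_of_real (indicator {..d} (wt w)))"
  have f [measurable]: "f \<in> borel_measurable dA" unfolding f_def by (rule borel_measurable_dA) measurable
  have E: "measure dA {w \<in> unit_disc. wt w \<le> d} = d"
    using emeasure_dA_wt_le[of d] d by (simp add: measure_def)
  have lor: "lorentz (b + 1) f = ennreal (d powr (b + 1))"
  proof -
    have df: "dist_fun f t = (if t < 1 then d else 0)" if "0 < t" for t
    proof (cases "t < 1")
      case True
      have "{z \<in> unit_disc. t < norm (f z)} = {w \<in> unit_disc. wt w \<le> d}"
        using True that by (auto simp: f_def indicator_def)
      then show ?thesis using True E by (simp add: dist_fun_def)
    next
      case False
      then have empty: "{z \<in> unit_disc. t < norm (f z)} = {}"
        by (auto simp: f_def indicator_def)
      show ?thesis using False unfolding dist_fun_def empty by simp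
    qed
    have "lorentz (b + 1) f = (\<integral>\<^sup>+ t. ennreal (d powr (b + 1)) * indicator {0<..<1::real} t \<partial>lborel)"
      unfolding lorentz_def by (intro nn_integral_cong) (auto simp: indicator_def df)
    then show ?thesis by (simp add: nn_integral_cmult_indicator)
  qed
  have low: "d powr (a + b + 1) * m \<le> norm (S_op a b 1 f z)" if z: "norm z < 1" "wt z \<le> d" for z
  proof -
    define h where "h = (\<lambda>w. wt w powr b / norm (1 - z * cnj w) * indicator {..d} (wt w))"
    have [measurable]: "cnj \<in> borel_measurable borel"
      by (intro borel_measurable_continuous_onI continuous_intros)
    have [measurable]: "h \<in> borel_measurable dA"
      unfolding h_def by (rule borel_measurable_dA) measurable
    have h0: "0 \<le> h w" for w by (simp add: h_def)
    have "S_integrand b 1 f z w = complex_of_real (h w)" for w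
      by (simp add: S_integrand_def h_def f_def)
    then have S: "S_op a b 1 f z = complex_of_real (wt z powr a * (LINT w|dA. h w))"
      by (simp add: S_op_def)
    \<comment> \<open>Without finiteness the Bochner integral would be 0 by convention and the lower
      bound would be lost. For fixed z the kernel is bounded by 1 / (1 - |z|).\<close>
    have fin: "(\<integral>\<^sup>+ w. ennreal (h w) \<partial>dA) < \<infinity>"
    proof -
      have "(\<integral>\<^sup>+ w. ennreal (h w) \<partial>dA) \<le> (\<integral>\<^sup>+ w. ennreal (1 / (1 - norm z)) * ennreal (wt w powr b) \<partial>dA)"
      proof (rule nn_integral_mono)
        fix w assume "w \<in> space dA"
        then have w: "norm w < 1" by simp
        have "norm z * norm w \<le> norm z" using w by (simp add: mult_left_le)
        then have "1 - norm z \<le> norm (1 - z * cnj w)"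
          using norm_triangle_ineq2[of 1 "z * cnj w"] by (simp add: norm_mult)
        then have "wt w powr b / norm (1 - z * cnj w) \<le> wt w powr b / (1 - norm z)"
          using z by (intro divide_left_mono mult_pos_pos) auto
        then have "h w \<le> 1 / (1 - norm z) * wt w powr b"
          using z by (auto simp: h_def indicator_def)
        then show "ennreal (h w) \<le> ennreal (1 / (1 - norm z)) * ennreal (wt w powr b)"
          using z by (subst ennreal_mult'[symmetric]) (auto intro: ennreal_leI)
      qed
      also have "\<dots> = ennreal (1 / (1 - norm z)) * (\<integral>\<^sup>+ w. ennreal (wt w powr b) \<partial>dA)"
        by (rule nn_integral_cmult) (rule borel_measurable_dA, measurable)
      also have "(\<integral>\<^sup>+ w. ennreal (wt w powr b) \<partial>dA) = ennreal (1 powr (b + 1) / (b + 1))"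
        using nn_integral_radial[of "\<lambda>y. ennreal (y powr b)"] nn_integral_powr_from_0[of b 1] b by simp
      also have "ennreal (1 / (1 - norm z)) * \<dots> < \<infinity>"
        by (simp add: ennreal_mult_less_top)
      finally show ?thesis .
    qed
    have hint: "integrable dA h" using fin h0 by (intro integrableI_bounded) auto
    have "ennreal (d powr b * (d * m)) \<le> (\<integral>\<^sup>+ w. ennreal (h w) \<partial>dA)"
    proof -
      define \<phi> where "\<phi> = (\<lambda>y. ennreal (d powr b) * indicator {..d} y)"
      define J where "J = (\<lambda>w. ennreal (1 / norm (1 - z * cnj w)))"
      have [measurable]: "\<phi> \<in> borel_measurable borel" unfolding \<phi>_def by measurable
      have [measurable]: "J \<in> borel_measurable borel" unfolding J_def by measurable
      let ?e = "\<lambda>t. cis (- (2 * pi * t))"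
      have "ennreal (d powr b * (d * m)) = ennreal m * (\<integral>\<^sup>+ w. \<phi> (wt w) \<partial>dA)"
      proof -
        have "(\<integral>\<^sup>+ w. \<phi> (wt w) \<partial>dA) = (\<integral>\<^sup>+ y. ennreal (d powr b) * indicator {0..d} y \<partial>lborel)"
          unfolding nn_integral_radial[OF \<open>\<phi> \<in> borel_measurable borel\<close>]
          using d by (intro nn_integral_cong) (auto simp: \<phi>_def indicator_def)
        also have "\<dots> = ennreal (d powr b * d)"
          using d by (simp add: nn_integral_cmult_indicator ennreal_mult')
        finally show ?thesis using m0 d by (simp add: ennreal_mult'[symmetric] mult_ac)
      qed
      also have "\<dots> = (\<integral>\<^sup>+ w. \<phi> (wt w) * ennreal m \<partial>dA)"
        by (subst mult.commute) (rule nn_integral_multc[symmetric], rule borel_measurable_dA, measurable)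
      \<comment> \<open>The bound by m holds only for the mean over each circle, which suffices
        because the weight \<phi> is radial.\<close>
      also have "\<dots> \<le> (\<integral>\<^sup>+ w. \<phi> (wt w) * (\<integral>\<^sup>+ t. J (?e t * w) \<partial>circ) \<partial>dA)"
      proof (rule nn_integral_mono)
        fix w assume "w \<in> space dA"
        then have w: "norm w < 1" by simp
        show "\<phi> (wt w) * ennreal m \<le> \<phi> (wt w) * (\<integral>\<^sup>+ t. J (?e t * w) \<partial>circ)"
        proof (cases "wt w \<le> d")
          case True
          have zw: "norm (z * cnj w) < 1" by (rule norm_mult_cnj_less_1[OF z(1) w])
          have sq: "1 - norm v \<le> wt v" if "norm v < 1" for v :: complex
            using that by (simp add: power2_eq_square mult_left_le)
          \<comment> \<open>Source of the 2 d in m: for two points of the annulus, 1 - |z w| <= (1 -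
            |z|) + (1 - |w|) <= 2 d.\<close>
          have "0 \<le> (1 - norm z) * (1 - norm w)" using z w by simp
          then have "1 - norm (z * cnj w) \<le> (1 - norm z) + (1 - norm w)"
            by (simp add: norm_mult algebra_simps)
          then have "1 - norm (z * cnj w) \<le> 2 * d" using sq[OF z(1)] sq[OF w] z(2) True by linarith
          then have "m \<le> ln (1 + pi / (1 - norm (z * cnj w))) / (2 * pi)"
            unfolding m_def using zw d
            by (intro divide_right_mono ln_mono add_left_mono divide_left_mono mult_pos_pos) (auto simp: add_pos_pos)
          then have "ennreal m \<le> (\<integral>\<^sup>+ t. ennreal (1 / norm (1 - ecis t * (z * cnj w))) \<partial>circ)"
            by (intro order_trans[OF ennreal_leI circ_mean_inverse_lower[OF zw]])
          also have "\<dots> = (\<integral>\<^sup>+ t. J (?e t * w) \<partial>circ)"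
            by (simp add: J_def cis_cnj mult_ac)
          finally show ?thesis by (rule mult_left_mono) simp
        qed (simp add: \<phi>_def)
      qed
      also have "\<dots> = (\<integral>\<^sup>+ w. \<phi> (wt w) * J w \<partial>dA)"
      proof (rule nn_integral_radial_mean[symmetric])
        show "?e \<in> borel_measurable borel" unfolding cis_conv_exp by measurable
      qed auto
      also have "\<dots> \<le> (\<integral>\<^sup>+ w. ennreal (h w) \<partial>dA)"
      proof (rule nn_integral_mono)
        fix w assume "w \<in> space dA"
        then have w: "0 < wt w" using wt_pos[of w] by simp
        show "\<phi> (wt w) * J w \<le> ennreal (h w)"
        proof (cases "wt w \<le> d")
          case True
          then have "d powr b \<le> wt w powr b" using w b by (intro powr_mono2') auto
          then have "d powr b * (1 / norm (1 - z * cnj w)) \<le> wt w powr b * (1 / norm (1 - z * cnj w))"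
            by (intro mult_right_mono) auto
          then show ?thesis using True
            by (simp add: \<phi>_def J_def h_def ennreal_mult'[symmetric] ennreal_leI)
        qed (simp add: \<phi>_def)
      qed
      finally show ?thesis .
    qed
    also have "\<dots> = ennreal (LINT w|dA. h w)" using hint h0 by (intro nn_integral_eq_integral) auto
    finally have "d powr b * (d * m) \<le> (LINT w|dA. h w)"
      using h0 by (subst (asm) ennreal_le_iff) (auto intro: integral_nonneg_AE)
    moreover have "d powr a \<le> wt z powr a" using z wt_pos[OF z(1)] a by (intro powr_mono2') auto
    ultimately have "d powr a * (d powr b * (d * m)) \<le> wt z powr a * (LINT w|dA. h w)"
      using d m0 by (intro mult_mono) auto
    moreover have "d powr a * (d powr b * (d * m)) = d powr (a + b + 1) * m"
      using d by (simp add: powr_add)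
    moreover have "0 \<le> (LINT w|dA. h w)" using h0 by (intro integral_nonneg_AE) auto
    ultimately show ?thesis unfolding S by (simp add: norm_mult)
  qed
  define S where "S = {w \<in> unit_disc. wt w \<le> d}"
  \<comment> \<open>Half of the lower bound, because the distribution function counts only values
    strictly above the level.\<close>
  define l where "l = d powr (a + b + 1) * m / 2"
  have l: "0 < l" "l < d powr (a + b + 1) * m" using d m0 by (auto simp: l_def)
  have "d \<le> dist_fun (S_op a b 1 f) l"
  proof -
    have "measure dA S \<le> measure dA {z \<in> unit_disc. l < norm (S_op a b 1 f z)}"
    proof (rule dA.finite_measure_mono)
      show "S \<subseteq> {z \<in> unit_disc. l < norm (S_op a b 1 f z)}"
      proof
        fix z assume "z \<in> S"
        then have z: "norm z < 1" "wt z \<le> d" by (simp_all add: S_def)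
        show "z \<in> {z \<in> unit_disc. l < norm (S_op a b 1 f z)}"
          using less_le_trans[OF l(2) low[OF z]] z(1) by simp
      qed
      show "{z \<in> unit_disc. l < norm (S_op a b 1 f z)} \<in> sets dA"
        by (rule level_set_dA[OF T_S_measurable(4)[OF f]])
    qed
    then show ?thesis by (simp only: S_def E dist_fun_def)
  qed
  then have "d powr (- a) \<le> dist_fun (S_op a b 1 f) l powr (- a)"
    using d a by (intro powr_mono2) auto
  then have "l * d powr (- a) \<le> l * dist_fun (S_op a b 1 f) l powr (1 / (- 1 / a))"
    using l by (intro mult_left_mono) auto
  then have "ennreal (l * d powr (- a)) \<le> weak_norm (- 1 / a) (S_op a b 1 f)"
    unfolding weak_norm_def using l by (intro SUP_upper2[of l] ennreal_leI) auto
  also have "\<dots> \<le> ennreal C * Lp1_norm (1 / (b + 1)) f"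
  proof (rule bdd[OF f])
    show "Lp1_norm (1 / (b + 1)) f < \<infinity>"
      unfolding p_def[symmetric] Lp1_norm_lorentz p(2) lor by (simp add: ennreal_mult_less_top)
  qed
  also have "\<dots> = ennreal (C * p * d powr (b + 1))"
    unfolding p_def[symmetric] Lp1_norm_lorentz p(2) lor using C p by (simp add: ennreal_mult' mult.assoc)
  finally have "l * d powr (- a) \<le> C * p * d powr (b + 1)"
    using C p by (subst (asm) ennreal_le_iff) auto
  moreover have "l * d powr (- a) = d powr (b + 1) * (m / 2)"
    using d by (simp add: l_def powr_add powr_minus_divide)
  ultimately have "m / 2 * d powr (b + 1) \<le> C * p * d powr (b + 1)" by (simp add: mult_ac)
  then have "m / 2 \<le> C * p" using d by (simp add: mult_le_cancel_right)
  then show False using m by simp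
qed

theorem theorem10p6:
  fixes a b c :: real
  assumes "a > -1" and "b > -1"
    and "0 < c - a - b - 2" and "c - a - b - 2 < 1"
    and "c \<le> 1"
  shows
    "(c = 1 \<longrightarrow>
       (\<forall>(p::ennreal) (q::real). 1 \<le> p \<and> 0 \<le> 1 / p \<and> 1 / p < ennreal (b + 1) \<and> q = - 1 / a \<longrightarrow>
          T_bounded a b c (Lp_norm p) (weak_norm q) \<and> S_bounded a b c (Lp_norm p) (weak_norm q)) \<and>
       (\<forall>p q::real. p = 1 / (b + 1) \<and> 1 \<le> q \<and> - a \<le> 1 / q \<and> 1 / q \<le> 1 \<longrightarrow>
          \<not> T_bounded a b c (Lp_norm (ennreal p)) (weak_norm q) \<and>
          \<not> S_bounded a b c (Lp_norm (ennreal p)) (weak_norm q)) \<and>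
       (\<forall>p q::real. p = 1 / (b + 1) \<and> 1 \<le> q \<and> - a < 1 / q \<and> 1 / q \<le> 1 \<longrightarrow>
          T_bounded a b c (Lp1_norm p) (weak_norm q) \<and> S_bounded a b c (Lp1_norm p) (weak_norm q)) \<and>
       T_bounded a b c (Lp1_norm (1 / (b + 1))) (weak_norm (- 1 / a)) \<and>
       \<not> S_bounded a b c (Lp1_norm (1 / (b + 1))) (weak_norm (- 1 / a)))
     \<and>
     (c < 1 \<longrightarrow>
       (\<forall>(p::ennreal) (q::real). 1 \<le> p \<and> 0 \<le> 1 / p \<and> 1 / p < ennreal (b + 1) \<and> q = - 1 / a \<longrightarrow>
          T_bounded a b c (Lp_norm p) (weak_norm q) \<and> S_bounded a b c (Lp_norm p) (weak_norm q)) \<and>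
       (\<forall>p q::real. p = 1 / (b + 1) \<and> 1 \<le> q \<and> - a \<le> 1 / q \<and> 1 / q \<le> 1 \<longrightarrow>
          T_bounded a b c (Lp1_norm p) (weak_norm q) \<and> S_bounded a b c (Lp1_norm p) (weak_norm q)))"
proof -
  \<comment> \<open>The bound on \<open>a\<close> uses c <= 1 and c - a - b - 2 > 0; then b < - a -
    1 < 0 because a > -1, and c > a + b + 2 > 0.\<close>
  have a: "a < - (b + 1)" "a < 0" and b: "- 1 < b" "b < 0" and c: "0 < c"
    using assms by auto
  have q0: "0 < - 1 / a" "- a \<le> 1 / (- 1 / a)" using a by (auto simp: divide_neg_neg)
  show ?thesis
  proof (intro conjI impI allI; (elim conjE)?)
    fix P :: ennreal and q :: real
    assume c1: "c = 1" and P: "1 \<le> P" "1 / P < ennreal (b + 1)" and q: "q = - 1 / a"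
    obtain x where x: "0 \<le> x" "1 / P = ennreal x" "x < b + 1"
      using P(2) b by (cases "1 / P" rule: ennreal_cases) (auto simp: ennreal_less_iff)
    \<comment> \<open>Half of the gap between b + 1 and 1 / P. This lowers the kernel exponent to 1
      - e while 1 / P stays below b - e + 1; with d = 0 the target exponent -1/a is
      untouched.\<close>
    define e where "e = (b + 1 - x) / 2"
    have e: "0 < e" "e < 1" "x < b - e + 1" using x b by (auto simp: e_def field_simps)
    have P': "1 / P < ennreal (b - e + 1)" "0 < b - e + 1" using x e by (auto simp: ennreal_less_iff)
    have be: "- 1 < b - e" "b - e < 0" "a - 0 < - (b - e + 1)" "0 < c - 0 - e" "c - 0 - e < 1" "- (a - 0) \<le> 1 / (- 1 / a)"
      using P' e a b c1 q0 by auto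
    note bd = T_S_bounded_Lp1[OF order_refl less_imp_le[OF e(1)] be(1,2,4,5,3) q0(1) be(6)]
    show "T_bounded a b c (Lp_norm P) (weak_norm q)" "S_bounded a b c (Lp_norm P) (weak_norm q)"
      unfolding q by (rule maps_boundedly_Lp_of_Lp1[OF _ P(1) P'], rule bd)+
  next
    fix p q :: real
    assume c1: "c = 1" and p: "p = 1 / (b + 1)"
    show "\<not> T_bounded a b c (Lp_norm (ennreal p)) (weak_norm q)"
      unfolding p c1 by (rule unbounded_Lp_critical[OF b]) (rule norm_integrands)
    show "\<not> S_bounded a b c (Lp_norm (ennreal p)) (weak_norm q)"
      unfolding p c1 by (rule unbounded_Lp_critical[OF b]) (rule norm_integrands)
  next
    fix p q :: real
    assume c1: "c = 1" and p: "p = 1 / (b + 1)" and q: "1 \<le> q" "- a < 1 / q"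
    \<comment> \<open>The slack 1 / q + a is spent on the weight in z, so the source exponent is
      untouched; the cap 1/2 keeps the kernel exponent 1 - d positive.\<close>
    define d where "d = min (1 / 2) (a + 1 / q)"
    have d: "0 < d" "d \<le> 1 / 2" "d \<le> a + 1 / q" using q unfolding d_def by linarith+
    have "0 < q" "- (a - d) \<le> 1 / q" using q d by auto
    then show "T_bounded a b c (Lp1_norm p) (weak_norm q)" "S_bounded a b c (Lp1_norm p) (weak_norm q)"
      unfolding p using T_S_bounded_Lp1[of d 0 b c a q] d b a c1 by auto
  next
    assume c1: "c = 1"
    show "T_bounded a b c (Lp1_norm (1 / (b + 1))) (weak_norm (- 1 / a))"
      unfolding c1 by (rule T_bounded_critical[OF b a(1)])
    show "\<not> S_bounded a b c (Lp1_norm (1 / (b + 1))) (weak_norm (- 1 / a))"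
      unfolding c1 by (rule S_unbounded_critical[OF b]) (use assms a in auto)
  next
    fix P :: ennreal and q :: real
    assume c1: "c < 1" and P: "1 \<le> P" "1 / P < ennreal (b + 1)" and q: "q = - 1 / a"
    have b1: "0 < b + 1" using b by simp
    \<comment> \<open>For c < 1 the kernel already has bounded means, so no exponent is traded: d =
      e = 0.\<close>
    have bd: "T_bounded a b c (Lp1_norm (1 / (b + 1))) (weak_norm (- 1 / a))"
      "S_bounded a b c (Lp1_norm (1 / (b + 1))) (weak_norm (- 1 / a))"
      using T_S_bounded_Lp1[of 0 0 b c a "- 1 / a"] a b c c1 q0 by auto
    show "T_bounded a b c (Lp_norm P) (weak_norm q)" "S_bounded a b c (Lp_norm P) (weak_norm q)"
      unfolding q by (rule maps_boundedly_Lp_of_Lp1[OF _ P b1], rule bd)+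
  next
    fix p q :: real
    assume c1: "c < 1" and p: "p = 1 / (b + 1)" and q: "1 \<le> q" "- a \<le> 1 / q"
    show "T_bounded a b c (Lp1_norm p) (weak_norm q)" "S_bounded a b c (Lp1_norm p) (weak_norm q)"
      unfolding p using T_S_bounded_Lp1[of 0 0 b c a q] a b c c1 q by auto
  qed
qed

end
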